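(* If $K$ is a compact metric space and $d\in\mathbb{N}^+$, then the following statements are equivalent: (i) for the prevalent $f\in C(K,\mathbb{R}^d)$, for the generic $y\in f(K)$ we have $\dim_H f^{-1}(y)=\dim_H K$; (ii) $\dim_H U=\dim_H K$ for every non-empty open set $U\subset K$.
   Context: Prevalence: for an abelian Polish group $G$, a set $A\subset G$ is shy if there exist a Borel set $B\supset A$ in $G$ and a Borel probability measure $\nu$ on $G$ with $\nu(B+x)=0$ for all $x\in G$; complements of shy sets are prevalent. "For the prevalent $f\in G$ property $P$ holds" means that $\{f\in G: P(f)\}$ is prevalent. For compact metric $K$, $C(K,\mathbb{R}^d)$ is the Banach space of continuous maps $K\to\mathbb{R}^d$ with the maximum norm (an abelian Polish group under addition). "For the generic $y\in Y$ property $P$ holds", for a complete metric space $Y$ (here $Y=f(K)$), means that $\{y\in Y: P(y)\}$ is co-meager in $Y$. $\dim_H$ is Hausdorff dimension, with $\dim_H\emptyset=-1$. *)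

theory Defs
  imports "HOL-Probability.Probability"
begin

section \<open>Hausdorff dimension\<close>

text \<open>
  The summand \<open>diam(A)^s\<close>, with the usual conventions for \<open>s = 0\<close>: the empty set
  contributes \<open>0\<close> and every non-empty set contributes \<open>1\<close> (whereas \<open>0 powr 0 = 0\<close>).
\<close>

definition diam_pow :: "real \<Rightarrow> 'a::metric_space set \<Rightarrow> ennreal" where
  "diam_pow s A =
     (if A = {} then 0 else if s = 0 then 1 else ennreal (diameter A powr s))"

text \<open>
  Boundedness of the covering sets is required explicitly because \<open>diameter\<close> is \<open>0\<close> on
  unbounded sets. Finite covers are included, since the sets may be empty.
\<close>

definition hausdorff_premeasure :: "real \<Rightarrow> real \<Rightarrow> 'a::metric_space set \<Rightarrow> ennreal" where
  "hausdorff_premeasure s \<delta> E =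
     (INF A \<in> {A :: nat \<Rightarrow> 'a set. (\<forall>i. bounded (A i) \<and> diameter (A i) \<le> \<delta>) \<and> E \<subseteq> (\<Union>i. A i)}.
        \<Sum>i. diam_pow s (A i))"

text \<open>The supremum is the limit for \<open>\<delta> \<rightarrow> 0+\<close>, the premeasures being antitone in \<open>\<delta>\<close>.\<close>

definition hausdorff_measure :: "real \<Rightarrow> 'a::metric_space set \<Rightarrow> ennreal" where
  "hausdorff_measure s E = (SUP \<delta>\<in>{0<..}. hausdorff_premeasure s \<delta> E)"

text \<open>Extended real valued: a compact metric space may have infinite Hausdorff dimension.\<close>

definition hausdorff_dim :: "'a::metric_space set \<Rightarrow> ereal" where
  "hausdorff_dim E =
     (if E = {} then -1 else Inf (ereal ` {s. 0 \<le> s \<and> hausdorff_measure s E < \<infinity>}))"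

section \<open>Baire category in a topological space\<close>

definition nowhere_dense_in :: "'a topology \<Rightarrow> 'a set \<Rightarrow> bool" where
  "nowhere_dense_in X A \<longleftrightarrow> A \<subseteq> topspace X \<and> X interior_of (X closure_of A) = {}"

definition meager_in :: "'a topology \<Rightarrow> 'a set \<Rightarrow> bool" where
  "meager_in X A \<longleftrightarrow> (\<exists>N :: nat \<Rightarrow> 'a set. (\<forall>n. nowhere_dense_in X (N n)) \<and> A = (\<Union>n. N n))"

definition comeager_in :: "'a topology \<Rightarrow> 'a set \<Rightarrow> bool" where
  "comeager_in X A \<longleftrightarrow> A \<subseteq> topspace X \<and> meager_in X (topspace X - A)"

section \<open>Prevalence in an abelian Polish group\<close>

text \<open>
  The group is given by its topology \<open>G\<close> (with carrier \<open>topspace G\<close>) and its addition.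
\<close>

definition borel_sets_of :: "'a topology \<Rightarrow> 'a set set" where
  "borel_sets_of X = sigma_sets (topspace X) {U. openin X U}"

definition shy_in :: "'g topology \<Rightarrow> ('g \<Rightarrow> 'g \<Rightarrow> 'g) \<Rightarrow> 'g set \<Rightarrow> bool" where
  "shy_in G add A \<longleftrightarrow>
     (\<exists>B \<nu>. B \<in> borel_sets_of G \<and> A \<subseteq> B \<and>
        prob_space \<nu> \<and> space \<nu> = topspace G \<and> sets \<nu> = borel_sets_of G \<and>
        (\<forall>x \<in> topspace G. (\<lambda>b. add b x) ` B \<in> null_sets \<nu>))"

definition prevalent_in :: "'g topology \<Rightarrow> ('g \<Rightarrow> 'g \<Rightarrow> 'g) \<Rightarrow> 'g set \<Rightarrow> bool" where
  "prevalent_in G add A \<longleftrightarrow> A \<subseteq> topspace G \<and> shy_in G add (topspace G - A)"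

section \<open>The space of continuous maps on a compact set\<close>

text \<open>
  Maps on \<open>K\<close> are represented by functions on the ambient type that are \<open>undefined\<close>
  outside of \<open>K\<close>. The metric of \<^const>\<open>cfunspace\<close> is the supremum metric.
\<close>

definition C_metric :: "'a::metric_space set \<Rightarrow> ('a \<Rightarrow> 'b::real_normed_vector) metric" where
  "C_metric K = cfunspace (top_of_set K) euclidean_metric"

definition C_space :: "'a::metric_space set \<Rightarrow> ('a \<Rightarrow> 'b::real_normed_vector) set" where
  "C_space K = mspace (C_metric K)"

definition C_topology :: "'a::metric_space set \<Rightarrow> ('a \<Rightarrow> 'b::real_normed_vector) topology" where
  "C_topology K = mtopology_of (C_metric K)"

definition C_add :: "'a set \<Rightarrow> ('a \<Rightarrow> 'b::real_normed_vector) \<Rightarrow> ('a \<Rightarrow> 'b) \<Rightarrow> 'a \<Rightarrow> 'b" where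
  "C_add K f g = (\<lambda>x\<in>K. f x + g x)"

lemma topspace_C_topology: "topspace (C_topology K) = C_space K"
  by (simp add: C_topology_def C_space_def)

lemma C_space_compact:
  fixes K :: "'a::metric_space set"
  assumes "compact K"
  shows "(C_space K :: ('a \<Rightarrow> 'b::real_normed_vector) set) =
           {f. f \<in> extensional K \<and> continuous_on K f}"
proof -
  have b: "Metric_space.mbounded UNIV dist S \<longleftrightarrow> bounded S" for S :: "'b set"
    by (auto simp: Metric_space.mbounded_def[OF Met_TC.Metric_space_axioms] bounded_def subset_iff)
  have "bounded (f ` K)" if "continuous_on K f" for f :: "'a \<Rightarrow> 'b"
    using assms that compact_continuous_image compact_imp_bounded by blast
  then show ?thesis
    by (auto simp: C_space_def C_metric_def Metric_space.fspace_def[OF Met_TC.Metric_space_axioms] b)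
qed

lemma C_metric_dist:
  fixes f g :: "'a::metric_space \<Rightarrow> 'b::real_normed_vector"
  assumes "K \<noteq> {}" "f \<in> C_space K" "g \<in> C_space K"
  shows "mdist (C_metric K) f g = (SUP x\<in>K. norm (f x - g x))"
  using assms
  by (auto simp: C_space_def C_metric_def Metric_space.fdist_def[OF Met_TC.Metric_space_axioms]
      dist_norm cfunspace_def)

lemma C_add_closed:
  fixes f g :: "'a::metric_space \<Rightarrow> 'b::real_normed_vector"
  assumes "compact K" "f \<in> C_space K" "g \<in> C_space K"
  shows "C_add K f g \<in> C_space K"
  using assms by (auto simp: C_space_compact C_add_def intro!: continuous_on_add cong: continuous_on_cong)

end

theory Submission
  imports Defs
begin

text \<open>
  If some non-empty open \<open>U \<subseteq> K\<close> has smaller dimension, a bump supported in \<open>U\<close> gives a ball of maps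
  each of which has a non-empty relatively open set of values attained only in \<open>U\<close>, and balls are not
  shy because \<open>C(K)\<close> is separable.

  Conversely, for \<open>s < dim U\<close> there is a finitely additive probability on \<open>U\<close> with
  \<open>\<Lambda>(ball x r) \<le> C r\<^sup>\<sigma>\<close>, \<open>\<sigma> > s\<close>. Perturb a given \<open>f\<close> by \<open>\<Sum>\<^sub>n 2\<^sup>-\<^sup>n g\<^sub>n\<close>, where \<open>g\<^sub>n\<close> takes independent
  values on tiny separated pieces of \<open>K\<close>. With a kernel that reproduces itself under averaging over one
  more level, the smoothed occupation densities \<open>\<Lambda>(\<kappa>\<^sub>n(y - F\<^sub>n))\<close>, restricted to any piece of an earlier
  level, form martingales whose increments are as small as desired once the pieces are small enough,
  whatever the modulus of continuity of \<open>f\<close>. Hence almost surely the densities converge uniformly, the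
  limit is positive on some ball \<open>V\<close>, and for \<open>y \<in> V\<close> the limiting mass on the fibre over \<open>y\<close> of a
  set of small diameter \<open>r\<close> is \<open>O(r\<^sup>s)\<close>: the fibre has dimension at least \<open>s\<close>. One random field
  serves countably many \<open>U\<close> and \<open>s\<close>, and the resulting balls \<open>V\<close> are dense in \<open>f(K)\<close>.
\<close>

section \<open>Finitely additive Frostman means\<close>

text \<open>A single law must work for every \<open>f\<close>, so bumps, scales and thresholds are
  fixed before \<open>f\<close> appears. This is possible because the variance of a level is bounded
  through the size of the kernel and the masses of the pieces alone; \<open>f\<close> enters only
  through the point at which the kernel is evaluated, and the union bound runs over test sets and
  nets that depend on the level only.

  \<open>K\<close> may be connected, so a continuous field need not be constant on pieces that
  exhaust \<open>K\<close>. The pieces are therefore plateaus separated by gaps, and the mass in the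
  gaps is discarded at every level; the losses are summable.

  No limit measure on a fibre is constructed. A cheap cover of a compact fibre may be taken to be a
  finite family of open balls; it then also catches the support of the density at some finite level,
  where the contradiction arises. Hence finitely additive means suffice, and no measurability of
  \<open>U\<close> or of the pieces is at issue. The same finiteness makes the existence of a cheap
  cover an open condition on the map, which supplies the Borel sets that shyness asks for.\<close>

definition sublinear_on :: "('a \<Rightarrow> real) set \<Rightarrow> (('a \<Rightarrow> real) \<Rightarrow> real) \<Rightarrow> bool" where
  "sublinear_on S q \<longleftrightarrow>
     (\<forall>f\<in>S. \<forall>g\<in>S. q (\<lambda>x. f x + g x) \<le> q f + q g) \<and>
     (\<forall>f\<in>S. \<forall>c\<ge>0. q (\<lambda>x. c * f x) = c * q f)"

lemma sublinear_on_add: "sublinear_on S q \<Longrightarrow> f \<in> S \<Longrightarrow> g \<in> S \<Longrightarrow> q (\<lambda>x. f x + g x) \<le> q f + q g"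
  and sublinear_on_scale: "sublinear_on S q \<Longrightarrow> f \<in> S \<Longrightarrow> 0 \<le> c \<Longrightarrow> q (\<lambda>x. c * f x) = c * q f"
  by (auto simp: sublinear_on_def)

locale function_subspace =
  fixes S :: "('a \<Rightarrow> real) set"
  assumes add_closed: "f \<in> S \<Longrightarrow> g \<in> S \<Longrightarrow> (\<lambda>x. f x + g x) \<in> S"
    and scale_closed: "f \<in> S \<Longrightarrow> (\<lambda>x. c * f x) \<in> S"
begin

lemma minus_closed: "f \<in> S \<Longrightarrow> (\<lambda>x. - f x) \<in> S"
  using scale_closed[of f "-1"] by simp

lemma sublinear_zero:
  assumes "sublinear_on S q" "f \<in> S"
  shows "q (\<lambda>x. 0) = 0"
  using sublinear_on_scale[OF assms, of 0] by simp

lemma sublinear_minus_le: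
  assumes q: "sublinear_on S q" and f: "f \<in> S"
  shows "- q (\<lambda>x. - f x) \<le> q f"
  using sublinear_on_add[OF q f minus_closed[OF f]] sublinear_zero[OF q f] by simp

text \<open>
  The largest sublinear functional below \<open>q\<close> that is linear on the line through \<open>e\<close>.
\<close>

definition straighten :: "(('a \<Rightarrow> real) \<Rightarrow> real) \<Rightarrow> ('a \<Rightarrow> real) \<Rightarrow> ('a \<Rightarrow> real) \<Rightarrow> real" where
  "straighten q e f = (INF t\<in>{0..}. q (\<lambda>x. f x + t * e x) - t * q e)"

lemma straighten_lower:
  assumes q: "sublinear_on S q" and e: "e \<in> S" and f: "f \<in> S" and t: "0 \<le> t"
  shows "- q (\<lambda>x. - f x) \<le> q (\<lambda>x. f x + t * e x) - t * q e"
proof -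
  have "q (\<lambda>x. t * e x) \<le> q (\<lambda>x. f x + t * e x) + q (\<lambda>x. - f x)"
    using sublinear_on_add[OF q add_closed[OF f scale_closed[OF e, of t]] minus_closed[OF f]] by simp
  then show ?thesis
    using sublinear_on_scale[OF q e t] by simp
qed

lemma bdd_below_straighten:
  assumes q: "sublinear_on S q" and e: "e \<in> S" and f: "f \<in> S"
  shows "bdd_below ((\<lambda>t. q (\<lambda>x. f x + t * e x) - t * q e) ` {0..})"
  using straighten_lower[OF assms] by (intro bdd_belowI2) auto

lemma straighten_le:
  assumes q: "sublinear_on S q" and e: "e \<in> S" and f: "f \<in> S" and t: "0 \<le> t"
  shows "straighten q e f \<le> q (\<lambda>x. f x + t * e x) - t * q e"
  unfolding straighten_def using t
  by (intro cINF_lower bdd_below_straighten q e f) auto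

lemma sublinear_straighten:
  assumes q: "sublinear_on S q" and e: "e \<in> S"
  shows "sublinear_on S (straighten q e)"
  unfolding sublinear_on_def
proof (intro conjI ballI allI impI)
  fix f g assume f: "f \<in> S" and g: "g \<in> S"
  have "straighten q e (\<lambda>x. f x + g x) \<le> (q (\<lambda>x. f x + s * e x) - s * q e) + (q (\<lambda>x. g x + t * e x) - t * q e)"
    if "0 \<le> s" "0 \<le> t" for s t
  proof -
    have "straighten q e (\<lambda>x. f x + g x) \<le> q (\<lambda>x. (f x + g x) + (s + t) * e x) - (s + t) * q e"
      using that by (intro straighten_le q e add_closed f g) auto
    also have "(\<lambda>x. (f x + g x) + (s + t) * e x) = (\<lambda>x. (f x + s * e x) + (g x + t * e x))"
      by (auto simp: algebra_simps)
    also have "q \<dots> \<le> q (\<lambda>x. f x + s * e x) + q (\<lambda>x. g x + t * e x)"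
      by (intro sublinear_on_add[OF q] add_closed scale_closed f g e)
    finally show ?thesis by (simp add: algebra_simps)
  qed
  then have "straighten q e (\<lambda>x. f x + g x) - (q (\<lambda>x. f x + s * e x) - s * q e) \<le> straighten q e g"
    if "0 \<le> s" for s
    unfolding straighten_def[of q e g] using that
    by (intro cINF_greatest) (auto simp: diff_le_eq add.commute)
  then have "straighten q e (\<lambda>x. f x + g x) - straighten q e g \<le> straighten q e f"
    unfolding straighten_def[of q e f]
    by (intro cINF_greatest) (auto simp: algebra_simps)
  then show "straighten q e (\<lambda>x. f x + g x) \<le> straighten q e f + straighten q e g" by simp
next
  fix f and c :: real assume f: "f \<in> S" and c: "0 \<le> c"
  have le: "straighten q e (\<lambda>x. c * f x) \<le> c * straighten q e f" if c: "0 < c" and f: "f \<in> S" for c f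
  proof -
    have "straighten q e (\<lambda>x. c * f x) \<le> c * (q (\<lambda>x. f x + t * e x) - t * q e)" if t: "0 \<le> t" for t
    proof -
      have "straighten q e (\<lambda>x. c * f x) \<le> q (\<lambda>x. c * f x + (c * t) * e x) - (c * t) * q e"
        using c t by (intro straighten_le q e scale_closed f) auto
      also have "(\<lambda>x. c * f x + (c * t) * e x) = (\<lambda>x. c * (f x + t * e x))"
        by (auto simp: algebra_simps)
      also have "q \<dots> = c * q (\<lambda>x. f x + t * e x)"
        using c by (intro sublinear_on_scale[OF q] add_closed scale_closed f e) auto
      finally show ?thesis by (simp add: algebra_simps)
    qed
    then have "straighten q e (\<lambda>x. c * f x) / c \<le> straighten q e f"
      unfolding straighten_def[of q e f] using c
      by (intro cINF_greatest) (auto simp: field_simps)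
    with c show ?thesis by (simp add: field_simps)
  qed
  show "straighten q e (\<lambda>x. c * f x) = c * straighten q e f"
  proof (cases "c = 0")
    case True
    have "q (\<lambda>x. t * e x) - t * q e = 0" if "0 \<le> t" for t
      using sublinear_on_scale[OF q e that] by simp
    then have "(\<lambda>t. q (\<lambda>x. 0 + t * e x) - t * q e) ` {0..} = {0}" by force
    with True show ?thesis by (simp add: straighten_def)
  next
    case False
    with c have c: "0 < c" by simp
    have "straighten q e (\<lambda>x. inverse c * (c * f x)) \<le> inverse c * straighten q e (\<lambda>x. c * f x)"
      by (rule le) (use c f scale_closed in auto)
    moreover have "(\<lambda>x. inverse c * (c * f x)) = f" using c by (auto simp: field_simps)
    ultimately have "straighten q e f \<le> inverse c * straighten q e (\<lambda>x. c * f x)" by simp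
    with c have "c * straighten q e f \<le> straighten q e (\<lambda>x. c * f x)" by (simp add: field_simps)
    with le[OF c f] show ?thesis by simp
  qed
qed

lemma straighten_le_self:
  assumes "sublinear_on S q" "e \<in> S" "f \<in> S"
  shows "straighten q e f \<le> q f"
  using straighten_le[OF assms, of 0] by simp

text \<open>Zorn's lemma for the pointwise order. Along a chain the infimum is finite because every
  member stays above -p(-f), and it is subadditive because of two members of a chain the smaller one
  serves for both arguments.\<close>

lemma minimal_sublinear_exists:
  assumes p: "sublinear_on S p"
  shows "\<exists>q. sublinear_on S q \<and> (\<forall>f\<in>S. q f \<le> p f) \<and>
    (\<forall>r. sublinear_on S r \<longrightarrow> (\<forall>f\<in>S. r f \<le> q f) \<longrightarrow> (\<forall>f\<in>S. r f = q f))"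
proof -
  \<comment> \<open>Values outside \<open>S\<close> are set to 0 so that the pointwise order is
    antisymmetric on \<open>Q\<close>.\<close>
  define Q where "Q = {q. sublinear_on S q \<and> (\<forall>f\<in>S. q f \<le> p f) \<and> (\<forall>f. f \<notin> S \<longrightarrow> q f = 0)}"
  define P :: "(('a \<Rightarrow> real) \<Rightarrow> real) \<Rightarrow> (('a \<Rightarrow> real) \<Rightarrow> real) \<Rightarrow> bool"
    where "P = (\<lambda>q r. \<forall>f. r f \<le> q f)"
  have po: "partial_order_on Q (relation_of P Q)"
    by (rule partial_order_on_relation_ofI) (auto simp: P_def fun_eq_iff intro: order_trans antisym)
  have lower: "- p (\<lambda>x. - f x) \<le> q f" if "q \<in> Q" "f \<in> S" for q f
    using sublinear_minus_le[of q f] that minus_closed[OF that(2)] unfolding Q_def by force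
  have chain: "\<exists>u\<in>Q. \<forall>a\<in>C. P a u" if C: "C \<in> Chains (relation_of P Q)" for C
  proof (cases "C = {}")
    case True
    have "(\<lambda>f. if f \<in> S then p f else 0) \<in> Q"
      using p add_closed scale_closed by (auto simp: Q_def sublinear_on_def)
    with True show ?thesis by blast
  next
    case False
    have CQ: "C \<subseteq> Q" using C by (auto simp: Chains_def relation_of_def)
    have tot: "P a b \<or> P b a" if "a \<in> C" "b \<in> C" for a b
      using C that by (auto simp: Chains_def relation_of_def)
    have bdd: "bdd_below ((\<lambda>q. q f) ` C)" if "f \<in> S" for f
      using lower[OF _ that] CQ by (intro bdd_belowI2) auto
    define u where "u = (\<lambda>f. if f \<in> S then INF q\<in>C. q f else 0)"
    have u_le: "u f \<le> a f" if "a \<in> C" for a f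
    proof (cases "f \<in> S")
      case True then show ?thesis unfolding u_def using bdd that by (auto intro: cINF_lower)
    next
      case False then show ?thesis using that CQ by (auto simp: u_def Q_def)
    qed
    have "sublinear_on S u"
      unfolding sublinear_on_def
    proof (intro conjI ballI allI impI)
      fix f g assume f: "f \<in> S" and g: "g \<in> S"
      have *: "u (\<lambda>x. f x + g x) \<le> a f + b g" if ab: "a \<in> C" "b \<in> C" for a b
      proof -
        have sub: "sublinear_on S a" "sublinear_on S b" using ab CQ by (auto simp: Q_def)
        from tot[OF ab] show ?thesis
        proof
          assume "P a b"
          then have "b f \<le> a f" by (simp add: P_def)
          with u_le[OF ab(2), of "\<lambda>x. f x + g x"] sublinear_on_add[OF sub(2) f g] show ?thesis by linarith
        next
          assume "P b a"
          then have "a g \<le> b g" by (simp add: P_def)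
          with u_le[OF ab(1), of "\<lambda>x. f x + g x"] sublinear_on_add[OF sub(1) f g] show ?thesis by linarith
        qed
      qed
      have "u (\<lambda>x. f x + g x) - a f \<le> u g" if "a \<in> C" for a
      proof -
        have "u (\<lambda>x. f x + g x) - a f \<le> b g" if "b \<in> C" for b
          using *[OF \<open>a \<in> C\<close> that] by simp
        then have "u (\<lambda>x. f x + g x) - a f \<le> (INF b\<in>C. b g)"
          using False by (intro cINF_greatest) auto
        then show ?thesis using g by (simp add: u_def)
      qed
      then have "u (\<lambda>x. f x + g x) - u g \<le> a f" if "a \<in> C" for a using that by (simp add: algebra_simps)
      then have "u (\<lambda>x. f x + g x) - u g \<le> (INF a\<in>C. a f)" using False by (intro cINF_greatest) auto
      then show "u (\<lambda>x. f x + g x) \<le> u f + u g" using f by (simp add: u_def)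
    next
      fix f and c :: real assume f: "f \<in> S" and c: "0 \<le> c"
      have *: "a (\<lambda>x. c * f x) = c * a f" if "a \<in> C" for a
        using that CQ f c by (auto simp: Q_def sublinear_on_def)
      have "u (\<lambda>x. c * f x) = (INF a\<in>C. c * a f)"
        using * scale_closed[OF f] by (auto simp: u_def)
      also have "\<dots> = c * (INF a\<in>C. a f)"
      proof (rule antisym)
        show "c * (INF a\<in>C. a f) \<le> (INF a\<in>C. c * a f)"
          using False bdd[OF f] c by (intro cINF_greatest mult_left_mono cINF_lower)
        show "(INF a\<in>C. c * a f) \<le> c * (INF a\<in>C. a f)"
        proof (cases "c = 0")
          case True then show ?thesis using False by simp
        next
          case False
          with c have c: "0 < c" by simp
          have "bdd_below ((\<lambda>a. c * a f) ` C)"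
            using bdd[OF scale_closed[OF f, of c]] * by (simp cong: image_cong)
          then have "(INF a\<in>C. c * a f) / c \<le> a f" if "a \<in> C" for a
            using c cINF_lower[OF _ that, of "\<lambda>a. c * a f"] by (simp add: field_simps)
          then have "(INF a\<in>C. c * a f) / c \<le> (INF a\<in>C. a f)"
            using \<open>C \<noteq> {}\<close> by (intro cINF_greatest) auto
          with c show ?thesis by (simp add: field_simps)
        qed
      qed
      finally show "u (\<lambda>x. c * f x) = c * u f" using f by (simp add: u_def)
    qed
    moreover obtain a where "a \<in> C" using False by blast
    moreover have "u f \<le> p f" if "f \<in> S" for f
      using u_le[OF \<open>a \<in> C\<close>, of f] \<open>a \<in> C\<close> CQ that by (force simp: Q_def intro: order_trans)
    moreover have "u f = 0" if "f \<notin> S" for f using that by (simp add: u_def)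
    ultimately have "u \<in> Q" by (simp add: Q_def)
    then show ?thesis using u_le by (auto simp: P_def)
  qed
  obtain q where q: "q \<in> Q" and min: "\<And>r. r \<in> Q \<Longrightarrow> P q r \<Longrightarrow> r = q"
    using predicate_Zorn[OF po chain] by blast
  show ?thesis
  proof (intro exI[of _ q] conjI allI impI ballI)
    show "sublinear_on S q" "\<And>f. f \<in> S \<Longrightarrow> q f \<le> p f" using q by (auto simp: Q_def)
    fix r f assume r: "sublinear_on S r" and le: "\<forall>f\<in>S. r f \<le> q f" and f: "f \<in> S"
    let ?r = "\<lambda>f. if f \<in> S then r f else 0"
    have "?r = q"
    proof (rule min)
      show "?r \<in> Q" using r le q add_closed scale_closed
        by (auto simp: Q_def sublinear_on_def intro: order_trans)
      show "P q ?r" using le q by (auto simp: P_def Q_def)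
    qed
    then show "r f = q f" using f by (auto simp: fun_eq_iff split: if_splits)
  qed
qed

text \<open>
  A minimal sublinear functional agrees with each of its straightenings, hence is additive.
\<close>

lemma hahn_banach_dominated:
  assumes p: "sublinear_on S p" and e: "e \<in> S"
  shows "\<exists>L. (\<forall>f\<in>S. \<forall>g\<in>S. L (\<lambda>x. f x + g x) = L f + L g) \<and>
    (\<forall>f\<in>S. \<forall>c. L (\<lambda>x. c * f x) = c * L f) \<and> (\<forall>f\<in>S. L f \<le> p f) \<and> p e \<le> L e"
proof -
  obtain L where L: "sublinear_on S L" and le: "\<And>f. f \<in> S \<Longrightarrow> L f \<le> straighten p e f"
    and min: "\<And>r f. sublinear_on S r \<Longrightarrow> (\<And>f. f \<in> S \<Longrightarrow> r f \<le> L f) \<Longrightarrow> f \<in> S \<Longrightarrow> r f = L f"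
    using minimal_sublinear_exists[OF sublinear_straighten[OF p e]] by blast
  have add: "L (\<lambda>x. f x + g x) = L f + L g" if f: "f \<in> S" and g: "g \<in> S" for f g
  proof (rule antisym)
    show "L (\<lambda>x. f x + g x) \<le> L f + L g" by (rule sublinear_on_add[OF L f g])
    have "L f = straighten L g f"
      by (rule min[symmetric, OF sublinear_straighten[OF L g] straighten_le_self[OF L g] f])
    also have "\<dots> \<le> L (\<lambda>x. f x + 1 * g x) - 1 * L g" by (rule straighten_le[OF L g f]) simp
    finally show "L f + L g \<le> L (\<lambda>x. f x + g x)" by simp
  qed
  have minus: "L (\<lambda>x. - f x) = - L f" if f: "f \<in> S" for f
    using add[OF f minus_closed[OF f]] sublinear_zero[OF L f] by simp
  have scale: "L (\<lambda>x. c * f x) = c * L f" if f: "f \<in> S" for f c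
  proof (cases "0 \<le> c")
    case True then show ?thesis by (rule sublinear_on_scale[OF L f])
  next
    case False
    then have "L (\<lambda>x. (- c) * f x) = (- c) * L f" by (intro sublinear_on_scale[OF L f]) auto
    with minus[OF scale_closed[OF f, of c]] show ?thesis by simp
  qed
  \<comment> \<open>\<open>L\<close> lies below \<open>straighten p e\<close>, not merely below
    \<open>p\<close>: at -e the parameter t = 1 gives p(0) - p(e), hence L(-e) \<le> -p(e).\<close>
  have "L (\<lambda>x. - e x) \<le> straighten p e (\<lambda>x. - e x)" by (rule le[OF minus_closed[OF e]])
  also have "\<dots> \<le> p (\<lambda>x. - e x + 1 * e x) - 1 * p e"
    by (rule straighten_le[OF p e minus_closed[OF e]]) simp
  finally have "p e \<le> L e" using minus[OF e] sublinear_zero[OF p e] by simp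
  with add scale order_trans[OF le straighten_le_self[OF p e]] show ?thesis
    by blast
qed

end

section \<open>Integral and fractional covers by balls\<close>

text \<open>Finite form of Vitali's covering argument: pick a ball of largest radius, discard every
  ball meeting it, and recurse. A discarded ball has no larger radius, so it lies in the threefold
  enlargement of the picked one.\<close>

lemma disjoint_subfamily:
  fixes z :: "'i \<Rightarrow> 'a::metric_space" and r :: "'i \<Rightarrow> real"
  assumes "finite I" "\<And>i. i \<in> I \<Longrightarrow> 0 < r i"
  obtains J where "J \<subseteq> I" "disjoint_family_on (\<lambda>i. ball (z i) (r i)) J"
    "(\<Union>i\<in>I. ball (z i) (r i)) \<subseteq> (\<Union>i\<in>J. ball (z i) (3 * r i))"
  using assms
proof (induction "card I" arbitrary: I thesis rule: less_induct)
  case less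
  show ?case
  proof (cases "I = {}")
    case True then show ?thesis by (intro less.prems(1)[of "{}"]) (auto simp: disjoint_family_on_def)
  next
    case False
    then have "Max (r ` I) \<in> r ` I" using less.prems(2) by (intro Max_in) auto
    then obtain k where k: "k \<in> I" "Max (r ` I) = r k" by blast
    have k_max: "r i \<le> r k" if "i \<in> I" for i
      using that less.prems(2) by (simp flip: k(2))
    define I' where "I' = {i \<in> I. ball (z i) (r i) \<inter> ball (z k) (r k) = {}}"
    have "z k \<in> ball (z k) (r k)" using less.prems(3)[OF k(1)] by simp
    then have "k \<notin> I'" unfolding I'_def by blast
    then have "I' \<subset> I" using k(1) unfolding I'_def by blast
    then have "card I' < card I" by (rule psubset_card_mono[OF less.prems(2)])
    then obtain J where J: "J \<subseteq> I'" "disjoint_family_on (\<lambda>i. ball (z i) (r i)) J"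
      "(\<Union>i\<in>I'. ball (z i) (r i)) \<subseteq> (\<Union>i\<in>J. ball (z i) (3 * r i))"
      using less.hyps[of I'] less.prems(2,3) by (auto simp: I'_def)
    show ?thesis
    proof (rule less.prems(1))
      show "insert k J \<subseteq> I" using J k(1) by (auto simp: I'_def)
      show "disjoint_family_on (\<lambda>i. ball (z i) (r i)) (insert k J)"
      proof (subst disjoint_family_on_insert)
        show "k \<notin> J" using J \<open>k \<notin> I'\<close> by blast
        have "ball (z k) (r k) \<inter> ball (z i) (r i) = {}" if "i \<in> J" for i
          using that J(1) by (auto simp: I'_def)
        with J(2) show "ball (z k) (r k) \<inter> (\<Union>i\<in>J. ball (z i) (r i)) = {} \<and>
            disjoint_family_on (\<lambda>i. ball (z i) (r i)) J" by blast
      qed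
      show "(\<Union>i\<in>I. ball (z i) (r i)) \<subseteq> (\<Union>i\<in>insert k J. ball (z i) (3 * r i))"
      proof
        fix x assume "x \<in> (\<Union>i\<in>I. ball (z i) (r i))"
        then obtain i where i: "i \<in> I" "dist (z i) x < r i" by auto
        show "x \<in> (\<Union>i\<in>insert k J. ball (z i) (3 * r i))"
        proof (cases "i \<in> I'")
          case True
          then have "x \<in> (\<Union>i\<in>I'. ball (z i) (r i))" using i by auto
          then show ?thesis using J(3) by blast
        next
          case False
          then obtain y where "dist (z i) y < r i" "dist (z k) y < r k" using i by (auto simp: I'_def)
          then have "dist (z k) x < r k + r i + r i"
            using i dist_triangle[of "z k" x y] dist_triangle[of y x "z i"] by (simp add: dist_commute)
          then show ?thesis using k_max[OF i(1)] by auto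
        qed
      qed
    qed
  qed
qed

text \<open>
  Federer's comparison of fractional and integral covers: peel off a disjoint subfamily,
  lower its weights by their minimum, and repeat.
\<close>

lemma fractional_cover:
  fixes z :: "'i \<Rightarrow> 'a::metric_space" and r c w :: "'i \<Rightarrow> real"
  assumes "finite I" "\<And>i. i \<in> I \<Longrightarrow> 0 < r i" "\<And>i. i \<in> I \<Longrightarrow> 0 \<le> c i" "\<And>i. i \<in> I \<Longrightarrow> 0 \<le> w i"
    and cov: "\<And>x. x \<in> U \<Longrightarrow> m \<le> (\<Sum>i\<in>I. c i * indicator (ball (z i) (r i)) x)"
    and W: "\<And>J. J \<subseteq> I \<Longrightarrow> U \<subseteq> (\<Union>i\<in>J. ball (z i) (3 * r i)) \<Longrightarrow> W \<le> (\<Sum>i\<in>J. w i)"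
    and "0 < W"
  shows "m * W \<le> (\<Sum>i\<in>I. c i * w i)"
  using assms(1-6)
proof (induction "card I" arbitrary: I c m rule: less_induct)
  case less
  note fin = less.prems(1) and r = less.prems(2) and c = less.prems(3) and w = less.prems(4)
    and cov = less.prems(5) and W = less.prems(6)
  show ?case
  proof (cases "m \<le> 0")
    case True
    then have "m * W \<le> 0" using \<open>0 < W\<close> by (simp add: mult_le_0_iff)
    also have "0 \<le> (\<Sum>i\<in>I. c i * w i)" using c w by (intro sum_nonneg) auto
    finally show ?thesis .
  next
    case False
    obtain J where J: "J \<subseteq> I" and disj: "disjoint_family_on (\<lambda>i. ball (z i) (r i)) J"
      and sub: "(\<Union>i\<in>I. ball (z i) (r i)) \<subseteq> (\<Union>i\<in>J. ball (z i) (3 * r i))"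
      by (rule disjoint_subfamily[of I r z, OF fin r])
    have "U \<subseteq> (\<Union>i\<in>I. ball (z i) (r i))"
    proof
      fix x assume "x \<in> U"
      then have "(\<Sum>i\<in>I. c i * indicator (ball (z i) (r i)) x) \<noteq> 0" using cov[of x] False by auto
      then obtain i where "i \<in> I" "c i * indicator (ball (z i) (r i)) x \<noteq> 0" by (meson sum.not_neutral_contains_not_neutral)
      then show "x \<in> (\<Union>i\<in>I. ball (z i) (r i))" by (auto simp: indicator_def split: if_splits)
    qed
    with sub have WJ: "W \<le> (\<Sum>i\<in>J. w i)" by (intro W J) auto
    then have "J \<noteq> {}" using \<open>0 < W\<close> by auto
    have finJ: "finite J" using J fin finite_subset by blast
    have "Min (c ` J) \<in> c ` J" using \<open>J \<noteq> {}\<close> finJ by (intro Min_in) auto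
    then obtain k where k: "k \<in> J" "Min (c ` J) = c k" by blast
    have k_min: "c k \<le> c i" if "i \<in> J" for i
      using that finJ by (simp flip: k(2))
    define t where "t = c k"
    \<comment> \<open>Removing the minimal weight on \<open>J\<close> makes the weight of
      \<open>k\<close> vanish, so \<open>k\<close> leaves the index set and the induction on its
      size applies.\<close>
    define c' where "c' = (\<lambda>i. c i - (if i \<in> J then t else 0))"
    have c'k: "c' k = 0" using k(1) by (simp add: c'_def t_def)
    have kI: "k \<in> I" using k(1) J by auto
    have t0: "0 \<le> t" using c kI by (simp add: t_def)
    have split: "(\<Sum>i\<in>I. c i * h i) = (\<Sum>i\<in>I - {k}. c' i * h i) + t * (\<Sum>i\<in>J. h i)" for h :: "'i \<Rightarrow> real"
    proof -
      have "(\<Sum>i\<in>I. c i * h i) = (\<Sum>i\<in>I. c' i * h i + t * (if i \<in> J then h i else 0))"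
        by (intro sum.cong) (auto simp: c'_def algebra_simps)
      also have "\<dots> = (\<Sum>i\<in>I. c' i * h i) + t * (\<Sum>i\<in>I. if i \<in> J then h i else 0)"
        by (simp add: sum.distrib sum_distrib_left)
      also have "(\<Sum>i\<in>I. if i \<in> J then h i else 0) = (\<Sum>i\<in>J. h i)"
        using fin J by (simp add: sum.inter_restrict[symmetric] Int_absorb1)
      also have "(\<Sum>i\<in>I. c' i * h i) = (\<Sum>i\<in>I - {k}. c' i * h i)"
        using fin kI c'k by (simp add: sum.remove)
      finally show ?thesis .
    qed
    \<comment> \<open>The balls of \<open>J\<close> are disjoint, so the covering sum drops by at
      most \<open>t\<close> at each point. The cost drops by \<open>t\<close> times that of
      \<open>J\<close>, which is at least \<open>t * W\<close>.\<close>
    have "(m - t) * W \<le> (\<Sum>i\<in>I - {k}. c' i * w i)"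
    proof (rule less.hyps)
      show "card (I - {k}) < card I" using fin kI by (rule card_Diff1_less)
      show "0 \<le> c' i" if "i \<in> I - {k}" for i using that c k_min by (auto simp: c'_def t_def)
      show "m - t \<le> (\<Sum>i\<in>I - {k}. c' i * indicator (ball (z i) (r i)) x)" if "x \<in> U" for x
      proof -
        have "(\<Sum>i\<in>J. indicator (ball (z i) (r i)) x :: real) = indicator (\<Union>i\<in>J. ball (z i) (r i)) x"
          by (rule indicator_UN_disjoint[symmetric]) (use finJ disj in auto)
        also have "\<dots> \<le> 1" by (simp add: indicator_def)
        finally have "t * (\<Sum>i\<in>J. indicator (ball (z i) (r i)) x) \<le> t"
          using t0 by (rule mult_left_le)
        with cov[OF that] split[of "\<lambda>i. indicator (ball (z i) (r i)) x"] show ?thesis by linarith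
      qed
      show "W \<le> sum w J" if "J \<subseteq> I - {k}" "U \<subseteq> (\<Union>i\<in>J. ball (z i) (3 * r i))" for J
        using that by (intro W) auto
    qed (use fin r w in auto)
    moreover have "t * W \<le> t * (\<Sum>i\<in>J. w i)" using WJ t0 by (rule mult_left_mono)
    ultimately show ?thesis using split[of w] by (simp add: algebra_simps)
  qed
qed


section \<open>Finite ball covers and finitely additive means\<close>

text \<open>For compact \<open>E\<close> this says that the \<open>s\<close>-dimensional content, in
  terms of balls and their radii, is below \<open>e\<close>. There is no mesh bound: for
  \<open>s > 0\<close> a small sum already forces small radii. Finitely many open balls make the
  property survive small perturbations of a compact fibre.\<close>

definition coverable :: "real \<Rightarrow> real \<Rightarrow> 'a::metric_space set \<Rightarrow> bool" where
  "coverable s e E \<longleftrightarrow> (\<exists>(n::nat) z r. (\<forall>i<n. 0 < r i) \<and> E \<subseteq> (\<Union>i<n. ball (z i) (r i)) \<and>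
     (\<Sum>i<n. r i powr s) < e)"

lemma coverableI:
  assumes I: "finite I" "\<And>i. i \<in> I \<Longrightarrow> 0 < r i" "E \<subseteq> (\<Union>i\<in>I. ball (z i) (r i))" "(\<Sum>i\<in>I. r i powr s) < e"
  shows "coverable s e E"
proof -
  obtain h where h: "bij_betw h {..<card I} I"
    using ex_bij_betw_nat_finite[OF I(1)] by (auto simp: atLeast0LessThan)
  show ?thesis
    unfolding coverable_def
  proof (intro exI conjI allI impI)
    show "0 < (r \<circ> h) i" if "i < card I" for i
      using bij_betwE[OF h] that I(2) by auto
    show "E \<subseteq> (\<Union>i<card I. ball ((z \<circ> h) i) ((r \<circ> h) i))"
    proof
      fix x assume "x \<in> E"
      then obtain i where "i \<in> I" "x \<in> ball (z i) (r i)" using I(3) by blast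
      moreover from \<open>i \<in> I\<close> obtain k where "k < card I" "i = h k"
        using bij_betw_imp_surj_on[OF h] by blast
      ultimately show "x \<in> (\<Union>i<card I. ball ((z \<circ> h) i) ((r \<circ> h) i))" by auto
    qed
    show "(\<Sum>i<card I. (r \<circ> h) i powr s) < e"
      using I(4) sum.reindex_bij_betw[OF h, of "\<lambda>i. r i powr s"] by simp
  qed
qed

lemma coverable_subset: "coverable s e F \<Longrightarrow> E \<subseteq> F \<Longrightarrow> coverable s e E"
  unfolding coverable_def by (elim exE conjE, intro exI conjI) (auto intro: order_trans)

definition bounded_fun_on :: "'a set \<Rightarrow> ('a \<Rightarrow> real) \<Rightarrow> bool" where
  "bounded_fun_on U f \<longleftrightarrow> (\<exists>B. \<forall>x\<in>U. \<bar>f x\<bar> \<le> B)"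

lemma bounded_fun_onI: "(\<And>x. x \<in> U \<Longrightarrow> \<bar>f x\<bar> \<le> B) \<Longrightarrow> bounded_fun_on U f"
  by (auto simp: bounded_fun_on_def)

lemma bounded_fun_on_add [intro]:
  assumes "bounded_fun_on U f" "bounded_fun_on U g"
  shows "bounded_fun_on U (\<lambda>x. f x + g x)"
proof -
  obtain A B where "\<forall>x\<in>U. \<bar>f x\<bar> \<le> A" "\<forall>x\<in>U. \<bar>g x\<bar> \<le> B"
    using assms by (auto simp: bounded_fun_on_def)
  then show ?thesis by (intro bounded_fun_onI[where B = "A + B"]) (metis abs_triangle_ineq add_mono order_trans)
qed

lemma bounded_fun_on_mult [intro]:
  assumes "bounded_fun_on U f" "bounded_fun_on U g"
  shows "bounded_fun_on U (\<lambda>x. f x * g x)"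
proof -
  obtain A B where "\<forall>x\<in>U. \<bar>f x\<bar> \<le> A" "\<forall>x\<in>U. \<bar>g x\<bar> \<le> B"
    using assms by (auto simp: bounded_fun_on_def)
  then show ?thesis
    by (intro bounded_fun_onI[where B = "A * B"])
       (auto simp: abs_mult intro!: mult_mono order_trans[OF abs_ge_zero])
qed

lemma bounded_fun_on_const [intro, simp]: "bounded_fun_on U (\<lambda>x. c)"
  by (auto simp: bounded_fun_on_def)

lemma bounded_fun_on_indicator [intro, simp]: "bounded_fun_on U (\<lambda>x. indicator A x)"
  by (rule bounded_fun_onI[where B = 1]) (simp add: indicator_def)

lemma bounded_fun_on_indicator' [intro, simp]: "bounded_fun_on U (indicator A)"
  using bounded_fun_on_indicator .

lemma bounded_fun_on_diff [intro]:
  assumes "bounded_fun_on U f" "bounded_fun_on U g"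
  shows "bounded_fun_on U (\<lambda>x. f x - g x)"
  using bounded_fun_on_add[OF assms(1) bounded_fun_on_mult[OF bounded_fun_on_const[of U "-1"] assms(2)]] by simp

lemma bounded_fun_on_sum [intro]:
  "(\<And>i. i \<in> I \<Longrightarrow> bounded_fun_on U (f i)) \<Longrightarrow> bounded_fun_on U (\<lambda>x. \<Sum>i\<in>I. f i x)"
  by (induction I rule: infinite_finite_induct) auto

text \<open>A finitely additive probability, given as a positive linear functional on all functions
  bounded on \<open>U\<close>. Indicators of arbitrary sets are admissible, and values outside
  \<open>U\<close> do not matter (\<open>cong\<close>).\<close>

locale mean =
  fixes U :: "'a set" and \<Lambda> :: "('a \<Rightarrow> real) \<Rightarrow> real"
  assumes add: "bounded_fun_on U f \<Longrightarrow> bounded_fun_on U g \<Longrightarrow> \<Lambda> (\<lambda>x. f x + g x) = \<Lambda> f + \<Lambda> g"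
    and scale: "bounded_fun_on U f \<Longrightarrow> \<Lambda> (\<lambda>x. c * f x) = c * \<Lambda> f"
    and nonneg: "bounded_fun_on U f \<Longrightarrow> (\<And>x. x \<in> U \<Longrightarrow> 0 \<le> f x) \<Longrightarrow> 0 \<le> \<Lambda> f"
    and one: "\<Lambda> (\<lambda>x. 1) = 1"
begin

lemma zero: "\<Lambda> (\<lambda>x. 0) = 0"
  using scale[of "\<lambda>x. 0" 0] by simp

lemma const: "\<Lambda> (\<lambda>x. c) = c"
  using scale[of "\<lambda>x. 1" c] one by simp

lemma diff: "bounded_fun_on U f \<Longrightarrow> bounded_fun_on U g \<Longrightarrow> \<Lambda> (\<lambda>x. f x - g x) = \<Lambda> f - \<Lambda> g"
  using add[of f "\<lambda>x. - 1 * g x"] scale[of g "-1"] bounded_fun_on_mult[of U "\<lambda>x. - 1" g] by simp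

lemma mono:
  assumes "bounded_fun_on U f" "bounded_fun_on U g" "\<And>x. x \<in> U \<Longrightarrow> f x \<le> g x"
  shows "\<Lambda> f \<le> \<Lambda> g"
  using nonneg[of "\<lambda>x. g x - f x"] diff[of g f] assms by auto

lemma cong:
  assumes "bounded_fun_on U f" "\<And>x. x \<in> U \<Longrightarrow> f x = g x"
  shows "\<Lambda> f = \<Lambda> g"
proof -
  have "bounded_fun_on U g" using assms by (simp add: bounded_fun_on_def)
  with assms show ?thesis by (intro antisym mono) auto
qed

lemma sum:
  "(\<And>i. i \<in> I \<Longrightarrow> bounded_fun_on U (f i)) \<Longrightarrow> \<Lambda> (\<lambda>x. \<Sum>i\<in>I. f i x) = (\<Sum>i\<in>I. \<Lambda> (f i))"
  by (induction I rule: infinite_finite_induct) (auto simp: zero add bounded_fun_on_sum)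

lemma le_const:
  assumes "bounded_fun_on U f" "\<And>x. x \<in> U \<Longrightarrow> f x \<le> B"
  shows "\<Lambda> f \<le> B"
  using mono[of f "\<lambda>x. B"] assms by (simp add: const)

lemma abs_diff_le:
  assumes "bounded_fun_on U f" "bounded_fun_on U g" "\<And>x. x \<in> U \<Longrightarrow> \<bar>f x - g x\<bar> \<le> B"
  shows "\<bar>\<Lambda> f - \<Lambda> g\<bar> \<le> B"
proof -
  have le: "f x - g x \<le> B" "g x - f x \<le> B" if "x \<in> U" for x
    using assms(3)[OF that] by auto
  have "\<Lambda> (\<lambda>x. f x - g x) \<le> B" "\<Lambda> (\<lambda>x. g x - f x) \<le> B"
    using assms le by (intro le_const bounded_fun_on_diff; simp)+
  then show ?thesis using assms by (simp add: diff)
qed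

lemma indicator_le_1: "\<Lambda> (indicator A) \<le> 1"
  by (rule le_const) (auto simp: indicator_def)

lemma indicator_nonneg: "0 \<le> \<Lambda> (indicator A)"
  by (rule nonneg) auto

lemma indicator_subset: "A \<inter> U \<subseteq> B \<Longrightarrow> \<Lambda> (indicator A) \<le> \<Lambda> (indicator B)"
  by (rule mono) (auto simp: indicator_def)

lemma indicator_UN_le:
  assumes "finite I" "A \<inter> U \<subseteq> (\<Union>i\<in>I. B i)"
  shows "\<Lambda> (indicator A) \<le> (\<Sum>i\<in>I. \<Lambda> (indicator (B i)))"
proof -
  have "\<Lambda> (indicator A) \<le> \<Lambda> (\<lambda>x. \<Sum>i\<in>I. indicator (B i) x)"
  proof (rule mono)
    fix x assume "x \<in> U"
    show "indicator A x \<le> (\<Sum>i\<in>I. indicator (B i) x :: real)"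
    proof (cases "x \<in> A")
      case True
      then obtain i where "i \<in> I" "x \<in> B i" using assms \<open>x \<in> U\<close> by auto
      then show ?thesis using assms(1) True
        by (auto intro!: order_trans[OF _ member_le_sum[of i I "\<lambda>i. indicator (B i) x"]])
    qed (auto intro: sum_nonneg)
  qed auto
  also have "\<dots> = (\<Sum>i\<in>I. \<Lambda> (indicator (B i)))" by (rule sum) auto
  finally show ?thesis .
qed

end

text \<open>
  The dominating functional of the Hahn-Banach argument is the weighted Hausdorff content;
  finitely many balls suffice because the mean need only be finitely additive.
\<close>

lemma frostman_mean:
  fixes U :: "'a::metric_space set"
  assumes "bounded U" "0 < c" "\<not> coverable s c U"
  obtains \<Lambda> C where "mean U \<Lambda>" "0 < C" "\<And>x r. 0 < r \<Longrightarrow> \<Lambda> (indicator (ball x r)) \<le> C * r powr s"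
proof -
  define fam :: "(real \<times> 'a \<times> real) list \<Rightarrow> bool"
    where "fam L \<longleftrightarrow> (\<forall>(c, z, r)\<in>set L. 0 \<le> c \<and> 0 < r)" for L
  define val :: "(real \<times> 'a \<times> real) list \<Rightarrow> 'a \<Rightarrow> real"
    where "val L x = (\<Sum>(c, z, r)\<leftarrow>L. c * indicator (ball z r) x)" for L x
  define cost :: "(real \<times> 'a \<times> real) list \<Rightarrow> real"
    where "cost L = (\<Sum>(c, z, r)\<leftarrow>L. c * r powr s)" for L
  define D where "D h = {L. fam L \<and> (\<forall>x\<in>U. h x \<le> val L x)}" for h :: "'a \<Rightarrow> real"
  define p where "p h = (INF L\<in>D h. cost L)" for h
  let ?S = "{f. bounded_fun_on U f}"
  interpret function_subspace ?S by unfold_locales auto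
  obtain x0 R where R: "U \<subseteq> ball x0 R" "0 < R"
    using assms(1) by (metis bounded_subset_ballD)
  have cost_nonneg: "0 \<le> cost L" if "fam L" for L
    using that unfolding cost_def fam_def by (intro sum_list_nonneg) auto
  have bdd: "bdd_below (cost ` D h)" for h
    by (rule bdd_belowI2[of _ 0]) (auto simp: D_def cost_nonneg)
  have ne: "D h \<noteq> {}" if "bounded_fun_on U h" for h
  proof -
    from that obtain B where "\<forall>x\<in>U. \<bar>h x\<bar> \<le> B" unfolding bounded_fun_on_def by blast
    then have "[(\<bar>B\<bar>, x0, R)] \<in> D h" using R by (force simp: D_def fam_def val_def indicator_def)
    then show ?thesis by blast
  qed
  have p_le: "p h \<le> cost L" if "L \<in> D h" for h L
    unfolding p_def by (rule cINF_lower[OF bdd that])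
  have "sublinear_on ?S p"
    unfolding sublinear_on_def
  proof (intro conjI ballI allI impI)
    fix f g assume f: "f \<in> ?S" and g: "g \<in> ?S"
    have "p (\<lambda>x. f x + g x) \<le> cost M + cost L" if "L \<in> D f" "M \<in> D g" for L M
    proof -
      have "L @ M \<in> D (\<lambda>x. f x + g x)" using that by (force simp: D_def fam_def val_def intro: add_mono)
      from p_le[OF this] show ?thesis by (simp add: cost_def)
    qed
    then have "p (\<lambda>x. f x + g x) - cost L \<le> p g" if "L \<in> D f" for L
      unfolding p_def[of g] using that ne g by (intro cINF_greatest) (auto simp: diff_le_eq)
    then have "p (\<lambda>x. f x + g x) - p g \<le> p f"
      unfolding p_def[of f] using ne f by (intro cINF_greatest) (auto simp: algebra_simps)
    then show "p (\<lambda>x. f x + g x) \<le> p f + p g" by simp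
  next
    fix f and a :: real assume f: "f \<in> ?S" and a: "0 \<le> a"
    have le: "p (\<lambda>x. a * f x) \<le> a * p f" if a: "0 < a" and f: "bounded_fun_on U f" for a f
    proof -
      have "p (\<lambda>x. a * f x) \<le> a * cost L" if "L \<in> D f" for L
      proof -
        have "val (map (\<lambda>(c, z, r). (a * c, z, r)) L) x = a * val L x" for x
          by (simp add: val_def comp_def case_prod_unfold sum_list_const_mult mult.assoc)
        moreover have "fam (map (\<lambda>(c, z, r). (a * c, z, r)) L)"
          using that a by (auto simp: D_def fam_def)
        ultimately have "map (\<lambda>(c, z, r). (a * c, z, r)) L \<in> D (\<lambda>x. a * f x)"
          using that a by (auto simp: D_def)
        from p_le[OF this] show ?thesis
          by (simp add: cost_def comp_def case_prod_unfold sum_list_const_mult mult.assoc)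
      qed
      then have "p (\<lambda>x. a * f x) / a \<le> p f"
        unfolding p_def[of f] using ne f a by (intro cINF_greatest) (auto simp: field_simps)
      with a show ?thesis by (simp add: field_simps)
    qed
    show "p (\<lambda>x. a * f x) = a * p f"
    proof (cases "a = 0")
      case True
      have "[] \<in> D (\<lambda>x. 0)" by (simp add: D_def fam_def val_def)
      from p_le[OF this] have "p (\<lambda>x. 0) \<le> 0" by (simp add: cost_def)
      moreover have "0 \<le> p (\<lambda>x. 0)"
        unfolding p_def by (intro cINF_greatest ne) (auto simp: D_def cost_nonneg)
      ultimately show ?thesis using True by simp
    next
      case False
      with a have a: "0 < a" by simp
      have "p (\<lambda>x. inverse a * (a * f x)) \<le> inverse a * p (\<lambda>x. a * f x)"
        using a f by (intro le) auto
      then have "a * p f \<le> p (\<lambda>x. a * f x)" using a by (simp add: field_simps)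
      with le[OF a, of f] f show ?thesis by simp
    qed
  qed
  moreover have "(\<lambda>x. 1) \<in> ?S" by simp
  ultimately obtain L where L:
    "\<And>f g. f \<in> ?S \<Longrightarrow> g \<in> ?S \<Longrightarrow> L (\<lambda>x. f x + g x) = L f + L g"
    "\<And>f a. f \<in> ?S \<Longrightarrow> L (\<lambda>x. a * f x) = a * L f" "\<And>f. f \<in> ?S \<Longrightarrow> L f \<le> p f" "p (\<lambda>x. 1) \<le> L (\<lambda>x. 1)"
    using hahn_banach_dominated[of p "\<lambda>x. 1"] by blast
  \<comment> \<open>No balls of tripled radii can cover \<open>U\<close> at cost below
    \<open>c\<close>, so \<open>fractional_cover\<close> bounds the cost of weighted covers as well;
    the factor \<open>3 powr s\<close> pays for the tripling. This makes L(1) positive, so that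
    \<open>L\<close> can be normalised.\<close>
  have "c / 3 powr s \<le> cost M" if M: "M \<in> D (\<lambda>x. 1)" for M
  proof -
    let ?I = "{..<length M}"
    let ?c = "\<lambda>i. fst (M ! i)" and ?z = "\<lambda>i. fst (snd (M ! i))" and ?r = "\<lambda>i. snd (snd (M ! i))"
    have fam: "0 \<le> ?c i" "0 < ?r i" if "i \<in> ?I" for i
      using M that nth_mem[of i M] by (fastforce simp: D_def fam_def case_prod_unfold)+
    have "1 * (c / 3 powr s) \<le> (\<Sum>i\<in>?I. ?c i * (?r i powr s))"
    proof (rule fractional_cover[where r = ?r and z = ?z and U = U])
      show "1 \<le> (\<Sum>i\<in>?I. ?c i * indicator (ball (?z i) (?r i)) x)" if "x \<in> U" for x
        using M that by (auto simp: D_def val_def sum_list_sum_nth case_prod_unfold atLeast0LessThan)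
      show "c / 3 powr s \<le> (\<Sum>i\<in>J. ?r i powr s)"
        if J: "J \<subseteq> ?I" "U \<subseteq> (\<Union>i\<in>J. ball (?z i) (3 * ?r i))" for J
      proof (rule ccontr)
        assume "\<not> ?thesis"
        then have *: "3 powr s * (\<Sum>i\<in>J. ?r i powr s) < c" by (simp add: field_simps)
        have "(\<Sum>i\<in>J. (3 * ?r i) powr s) = 3 powr s * (\<Sum>i\<in>J. ?r i powr s)"
          using J fam by (auto simp: sum_distrib_left powr_mult less_imp_le subset_iff intro!: sum.cong)
        with * have "coverable s c U"
          using J fam finite_subset[OF J(1)] by (intro coverableI[of J "\<lambda>i. 3 * ?r i" _ ?z]) auto
        with assms show False by blast
      qed
    qed (use fam assms in auto)
    then show ?thesis by (simp add: cost_def sum_list_sum_nth case_prod_unfold atLeast0LessThan)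
  qed
  then have "c / 3 powr s \<le> p (\<lambda>x. 1)" unfolding p_def by (intro cINF_greatest ne) auto
  moreover have "0 < c / 3 powr s" using assms by simp
  ultimately have L1: "0 < L (\<lambda>x. 1)" using L(4) by linarith
  define \<Lambda> where "\<Lambda> f = L f / L (\<lambda>x. 1)" for f
  show thesis
  proof (rule that[of \<Lambda> "1 / L (\<lambda>x. 1)"])
    show "mean U \<Lambda>"
    proof
      fix f assume f: "bounded_fun_on U f" "\<And>x. x \<in> U \<Longrightarrow> 0 \<le> f x"
      have b: "bounded_fun_on U (\<lambda>x. - 1 * f x)" 
        by (rule bounded_fun_on_mult[OF bounded_fun_on_const f(1)])
      \<comment> \<open>The empty family dominates -f when \<open>f\<close> is nonnegative on
        \<open>U\<close>, so L(-f) \<le> p(-f) \<le> 0.\<close>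
      have "[] \<in> D (\<lambda>x. - 1 * f x)" using f by (simp add: D_def fam_def val_def)
      from p_le[OF this] have "p (\<lambda>x. - 1 * f x) \<le> 0" by (simp add: cost_def)
      with L(3)[of "\<lambda>x. - 1 * f x"] L(2)[of f "-1"] b f have "0 \<le> L f" by simp
      then show "0 \<le> \<Lambda> f" using L1 by (simp add: \<Lambda>_def)
    qed (use L(1,2) L1 in \<open>auto simp: \<Lambda>_def add_divide_distrib\<close>)
    show "0 < 1 / L (\<lambda>x. 1)" using L1 by simp
    fix x :: 'a and r :: real assume "0 < r"
    then have "[(1, x, r)] \<in> D (indicator (ball x r))" by (simp add: D_def fam_def val_def)
    from p_le[OF this] L(3)[of "indicator (ball x r)"] have "L (indicator (ball x r)) \<le> r powr s"
      by (simp add: cost_def)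
    then show "\<Lambda> (indicator (ball x r)) \<le> 1 / L (\<lambda>x. 1) * r powr s"
      using L1 by (simp add: \<Lambda>_def divide_right_mono)
  qed
qed

section \<open>Covers by balls and Hausdorff dimension\<close>

lemma diameter_ball_le:
  fixes z :: "'a::metric_space"
  assumes "0 < r"
  shows "diameter (ball z r) \<le> 2 * r"
proof -
  have ne: "ball z r \<noteq> {}" using assms by auto
  have "dist x y \<le> 2 * r" if "x \<in> ball z r" "y \<in> ball z r" for x y
    using that dist_triangle[of x y z] by (auto simp: dist_commute)
  then show ?thesis
    using ne by (auto simp: diameter_def intro!: cSUP_least)
qed

lemma hausdorff_dim_nonneg: "E \<noteq> {} \<Longrightarrow> 0 \<le> hausdorff_dim E"
  unfolding hausdorff_dim_def by (auto intro!: Inf_greatest)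

lemma hausdorff_measure_mono: "E \<subseteq> F \<Longrightarrow> hausdorff_measure s E \<le> hausdorff_measure s F"
  unfolding hausdorff_measure_def hausdorff_premeasure_def
  by (intro SUP_mono' INF_superset_mono) auto

lemma hausdorff_dim_mono:
  assumes "E \<subseteq> F"
  shows "hausdorff_dim E \<le> hausdorff_dim F"
proof (cases "E = {}")
  case True
  then show ?thesis using hausdorff_dim_nonneg[of F]
    by (cases "F = {}") (auto simp: hausdorff_dim_def[of "{}"] intro: order_trans[of _ 0])
next
  case False
  then show ?thesis
    using assms hausdorff_measure_mono[OF assms]
    by (auto simp: hausdorff_dim_def intro!: Inf_superset_mono image_mono intro: le_less_trans)
qed

text \<open>A cover of small total cost has small radii, hence small mesh, so arbitrarily cheap
  covers make the premeasure vanish at every scale.\<close>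

lemma coverable_imp_hausdorff_dim_le:
  fixes U :: "'a::metric_space set"
  assumes s: "0 < s" and cov: "\<And>c. 0 < c \<Longrightarrow> coverable s c U"
  shows "hausdorff_dim U \<le> ereal s"
proof (cases "U = {}")
  case True then show ?thesis using s by (simp add: hausdorff_dim_def one_ereal_def)
next
  case False
  have small: "hausdorff_premeasure s \<delta> U \<le> ennreal e" if \<delta>: "0 < \<delta>" and e: "0 < e" for \<delta> e
  proof -
    \<comment> \<open>The first bound forces every radius below \<open>\<delta> / 2\<close>, so
      diameters are at most \<delta>; the second absorbs the factor \<open>2 powr s\<close> lost
      between radii and diameters.\<close>
    define c where "c = min ((\<delta> / 2) powr s) (e / 2 powr s)"
    have "0 < c" using \<delta> e by (simp add: c_def)
    from cov[OF this] obtain n :: nat and z r where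
      r: "\<And>i. i < n \<Longrightarrow> 0 < r i" and U: "U \<subseteq> (\<Union>i<n. ball (z i) (r i))" and
      sum: "(\<Sum>i<n. r i powr s) < c" by (auto simp: coverable_def)
    define A where "A i = (if i < n then ball (z i) (r i) else {})" for i
    have diam: "diameter (A i) \<le> 2 * r i" if "i < n" for i
      using diameter_ball_le[OF r[OF that]] that by (simp add: A_def)
    have r_le: "2 * r i \<le> \<delta>" if "i < n" for i
    proof -
      have "r i powr s \<le> (\<Sum>i<n. r i powr s)" using that by (intro member_le_sum) auto
      with sum have "r i powr s < (\<delta> / 2) powr s" by (simp add: c_def)
      then have "r i < \<delta> / 2" using r[OF that] s \<delta> by (meson half_gt_zero linorder_not_less powr_mono2 less_imp_le)
      then show ?thesis by simp
    qed
    have diam\<delta>: "diameter (A i) \<le> \<delta>" for i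
    proof (cases "i < n")
      case True with diam[OF True] r_le[OF True] show ?thesis by linarith
    qed (use \<delta> in \<open>simp add: A_def\<close>)
    have "hausdorff_premeasure s \<delta> U \<le> (\<Sum>i. diam_pow s (A i))"
      unfolding hausdorff_premeasure_def
    proof (rule INF_lower, rule CollectI, intro conjI allI)
      show "bounded (A i)" for i by (simp add: A_def)
      show "U \<subseteq> (\<Union>i. A i)" using U by (auto simp: A_def)
    qed (rule diam\<delta>)
    also have "\<dots> = (\<Sum>i<n. diam_pow s (A i))"
      by (rule suminf_finite) (auto simp: A_def diam_pow_def)
    also have "\<dots> \<le> (\<Sum>i<n. ennreal (2 powr s * r i powr s))"
    proof (rule sum_mono)
      fix i assume "i \<in> {..<n}"
      then have i: "i < n" by simp
      have "0 \<le> diameter (A i)" by (rule diameter_ge_0) (simp add: A_def)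
      then have "diameter (A i) powr s \<le> (2 * r i) powr s" using diam[OF i] s by (intro powr_mono2) auto
      also have "\<dots> = 2 powr s * r i powr s" using r[OF i] by (simp add: powr_mult)
      finally show "diam_pow s (A i) \<le> ennreal (2 powr s * r i powr s)"
        using s by (auto simp: diam_pow_def intro: ennreal_leI)
    qed
    also have "\<dots> = ennreal (\<Sum>i<n. 2 powr s * r i powr s)" by (rule sum_ennreal) auto
    also have "\<dots> \<le> ennreal e"
    proof -
      have "2 powr s * (\<Sum>i<n. r i powr s) \<le> e" using sum by (simp add: c_def field_simps)
      then show ?thesis by (intro ennreal_leI) (simp add: sum_distrib_left)
    qed
    finally show ?thesis .
  qed
  have "hausdorff_premeasure s \<delta> U \<le> 0" if "0 < \<delta>" for \<delta>
  proof (rule ennreal_le_epsilon)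
    show "hausdorff_premeasure s \<delta> U \<le> 0 + ennreal e" if "0 < e" for e
      using small[OF \<open>0 < \<delta>\<close> that] by simp
  qed
  then have "hausdorff_measure s U \<le> 0"
    unfolding hausdorff_measure_def by (intro SUP_least) auto
  then have "ereal s \<in> ereal ` {s. 0 \<le> s \<and> hausdorff_measure s U < \<infinity>}"
    using s by (intro imageI CollectI conjI) (auto intro: le_less_trans)
  then show ?thesis using False by (simp add: hausdorff_dim_def Inf_lower)
qed

lemma tendsto_powr_at_right:
  fixes d :: real
  assumes "0 \<le> d" "0 < s"
  shows "((\<lambda>x. x powr s) \<longlongrightarrow> d powr s) (at_right d)"
proof -
  have "continuous_on {0..} (\<lambda>x::real. x powr s)"
    using assms by (intro continuous_on_powr' continuous_intros) auto
  then have "((\<lambda>x. x powr s) \<longlongrightarrow> d powr s) (at d within {0..})"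
    by (rule continuous_on_def[THEN iffD1, rule_format]) (use assms in simp)
  then show ?thesis by (rule tendsto_within_subset) (use assms in auto)
qed

lemma powr_right_approx:
  fixes d :: real
  assumes "0 \<le> d" "0 < s" "0 < e"
  obtains r where "d < r" "r powr s < d powr s + e"
proof -
  from tendsto_powr_at_right[OF assms(1,2)] have "\<forall>\<^sub>F x in at_right d. x powr s < d powr s + e"
    by (rule order_tendstoD) (use assms in auto)
  then have "\<forall>\<^sub>F x in at_right d. x powr s < d powr s + e \<and> d < x"
    using eventually_at_right_less by (rule eventually_conj)
  then have "\<exists>x. x powr s < d powr s + e \<and> d < x"
    by (rule eventually_happens'[rotated]) simp
  with that show thesis by blast
qed

text \<open>For some \<open>t < s\<close> the \<open>t\<close>-measure is finite, and at mesh
  \<delta> the \<open>s\<close>-sum is at most \<open>\<delta> powr (s - t)\<close> times the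
  \<open>t\<close>-sum. Compactness makes the cover finite once its sets have been enlarged to open
  balls.\<close>

lemma hausdorff_dim_less_imp_coverable:
  fixes E :: "'a::metric_space set"
  assumes E: "compact E" and s: "0 < s" and dim: "hausdorff_dim E < ereal s" and e: "0 < e"
  shows "coverable s e E"
proof (cases "E = {}")
  case True then show ?thesis using e by (intro coverableI[of "{}"]) auto
next
  case False
  then obtain t where t: "0 \<le> t" "t < s" and fin: "hausdorff_measure t E < \<infinity>"
    using dim by (auto simp: hausdorff_dim_def Inf_less_iff)
  obtain h where h: "hausdorff_measure t E = ennreal h" "0 \<le> h"
    using fin by (cases "hausdorff_measure t E") auto
  \<comment> \<open>Chosen so that \<open>\<delta> powr (s - t) * (h + 1)\<close> equals
    \<open>e / 4\<close>; the enlargement to balls costs at most another \<open>e / 2\<close>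
    through a geometric series.\<close>
  define \<delta> where "\<delta> = (e / (4 * (h + 1))) powr (1 / (s - t))"
  have \<delta>: "0 < \<delta>" using e h by (simp add: \<delta>_def)
  have \<delta>_powr: "\<delta> powr (s - t) * (h + 1) = e / 4"
  proof -
    have "\<delta> powr (s - t) = e / (4 * (h + 1))" using e h t by (simp add: \<delta>_def powr_powr)
    moreover have "h + 1 \<noteq> 0" using h by simp
    ultimately show ?thesis
      by (metis nonzero_mult_divide_mult_cancel_right times_divide_eq_left)
  qed
  have "hausdorff_premeasure t \<delta> E \<le> ennreal h"
    using \<delta> unfolding h(1)[symmetric] hausdorff_measure_def by (intro SUP_upper) auto
  also have "\<dots> < ennreal (h + 1)" using h by (simp add: ennreal_lessI)
  finally obtain A :: "nat \<Rightarrow> 'a set" where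
    A: "\<And>i. bounded (A i)" "\<And>i. diameter (A i) \<le> \<delta>" "E \<subseteq> (\<Union>i. A i)" and
    sum: "(\<Sum>i. diam_pow t (A i)) < ennreal (h + 1)"
    unfolding hausdorff_premeasure_def INF_less_iff by auto
  have diam0: "0 \<le> diameter (A i)" for i by (rule diameter_ge_0[OF A(1)])
  \<comment> \<open>The radii exceed the diameters strictly: an open ball whose radius is the
    diameter can miss points of the set, and is empty for a singleton.\<close>
  have "\<exists>r>diameter (A i). r powr s < diameter (A i) powr s + e / 4 * (1 / 2) ^ i" for i
    using powr_right_approx[OF diam0 s, of "e / 4 * (1 / 2) ^ i"] e by (metis zero_less_divide_iff zero_less_mult_iff zero_less_numeral zero_less_one zero_less_power)
  then obtain r where r: "\<And>i. diameter (A i) < r i"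
    "\<And>i. r i powr s < diameter (A i) powr s + e / 4 * (1 / 2) ^ i" by metis
  have r0: "0 < r i" for i using r(1)[of i] diam0[of i] by linarith
  define z where "z i = (SOME x. x \<in> A i)" for i
  have z: "A i \<subseteq> ball (z i) (r i)" if "A i \<noteq> {}" for i
  proof
    fix x assume x: "x \<in> A i"
    have "z i \<in> A i" unfolding z_def using that by (simp add: some_in_eq)
    then have "dist (z i) x \<le> diameter (A i)" using x by (rule diameter_bounded_bound[OF A(1)])
    with r(1)[of i] show "x \<in> ball (z i) (r i)" by simp
  qed
  have "E \<subseteq> (\<Union>i\<in>{i. A i \<noteq> {}}. ball (z i) (r i))" using A(3) z by blast
  from compactE_image[OF E _ this] obtain I where
    I: "I \<subseteq> {i. A i \<noteq> {}}" "finite I" "E \<subseteq> (\<Union>i\<in>I. ball (z i) (r i))" by auto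
  \<comment> \<open>The case \<open>t = 0\<close> can occur, and then every non-empty set
    contributes 1, as in \<open>diam_pow\<close>.\<close>
  define d where "d i = (if t = 0 then 1 else diameter (A i) powr t)" for i
  have d: "diam_pow t (A i) = ennreal (d i)" "0 \<le> d i" if "i \<in> I" for i
    using that I(1) by (auto simp: d_def diam_pow_def)
  have diam_le: "diameter (A i) powr s \<le> \<delta> powr (s - t) * d i" if "i \<in> I" for i
  proof (cases "diameter (A i) = 0")
    case False
    then have pos: "0 < diameter (A i)" using diam0[of i] by simp
    have "diameter (A i) powr s = diameter (A i) powr (s - t) * diameter (A i) powr t"
      by (simp flip: powr_add)
    also have "\<dots> \<le> \<delta> powr (s - t) * diameter (A i) powr t"
      using A(2)[of i] pos t by (intro mult_right_mono powr_mono2) auto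
    finally show ?thesis using pos by (auto simp: d_def)
  qed (use d[OF that] in simp)
  have "ennreal (\<Sum>i\<in>I. d i) = (\<Sum>i\<in>I. diam_pow t (A i))"
    using d(2) by (subst sum_ennreal[symmetric]) (auto intro!: sum.cong simp: d(1))
  also have "\<dots> \<le> (\<Sum>i. diam_pow t (A i))" by (rule sum_le_suminf) (auto simp: I)
  also note sum
  finally have "(\<Sum>i\<in>I. d i) \<le> h + 1"
    using ennreal_less_iff[of "\<Sum>i\<in>I. d i" "h + 1"] d(2) by (simp add: sum_nonneg del: ennreal_plus)
  then have sum_d: "\<delta> powr (s - t) * (\<Sum>i\<in>I. d i) \<le> e / 4"
    using mult_left_mono[of "\<Sum>i\<in>I. d i" "h + 1" "\<delta> powr (s - t)"] by (simp add: \<delta>_powr)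
  have geom: "(\<Sum>i\<in>I. (1 / 2 :: real) ^ i) \<le> 2"
    using sum_le_suminf[of "\<lambda>i. (1 / 2 :: real) ^ i" I] I(2) suminf_geometric[of "1 / 2 :: real"] by simp
  have "(\<Sum>i\<in>I. r i powr s) \<le> (\<Sum>i\<in>I. \<delta> powr (s - t) * d i + e / 4 * (1 / 2) ^ i)"
    using r(2) diam_le by (intro sum_mono) (meson add_right_mono less_imp_le order_trans)
  also have "\<dots> = \<delta> powr (s - t) * (\<Sum>i\<in>I. d i) + e / 4 * (\<Sum>i\<in>I. (1 / 2) ^ i)"
    by (simp add: sum.distrib sum_distrib_left)
  also have "\<dots> \<le> e / 4 + e / 4 * 2" using sum_d geom e by (intro add_mono mult_left_mono) auto
  also have "\<dots> < e" using e by simp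
  finally show ?thesis using I r0 by (intro coverableI[of I r E z]) auto
qed

section \<open>Bump functions with negligible gaps\<close>

lemma (in mean) sum_disjoint_le_1:
  assumes "finite I" "disjoint_family_on A I"
  shows "(\<Sum>i\<in>I. \<Lambda> (indicator (A i))) \<le> 1"
proof -
  have "(\<Sum>i\<in>I. \<Lambda> (indicator (A i))) = \<Lambda> (\<lambda>x. \<Sum>i\<in>I. indicator (A i) x)"
    by (rule sum[symmetric]) auto
  also have "(\<lambda>x. \<Sum>i\<in>I. indicator (A i) x) = (indicator (\<Union>i\<in>I. A i) :: _ \<Rightarrow> real)"
    by (rule ext) (rule indicator_UN_disjoint[OF assms, symmetric])
  finally show ?thesis using indicator_le_1[of "\<Union>i\<in>I. A i"] by simp
qed

text \<open>Each mean gives total mass at most 1 to \<open>N\<close> disjoint annuli. If every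
  annulus were charged more than \<open>e\<close> by some mean, the masses over all means would
  reach \<open>N * e\<close>, which exceeds \<open>card J\<close>.\<close>

lemma small_annulus:
  fixes z :: "'a::metric_space"
  assumes J: "finite J" "\<And>j. j \<in> J \<Longrightarrow> mean (U j) (\<Lambda> j)" and "a < b" "0 < e"
  shows "\<exists>\<rho> w. a \<le> \<rho> \<and> 0 < w \<and> \<rho> + w \<le> b \<and>
    (\<forall>j\<in>J. \<Lambda> j (indicator {x. \<rho> < dist z x \<and> dist z x < \<rho> + w}) \<le> e)"
proof -
  obtain N :: nat where N: "card J / e < N" using reals_Archimedean2 by blast
  then have "0 < N" using \<open>0 < e\<close> by (metis divide_nonneg_pos gr0I of_nat_0 of_nat_0_le_iff not_le)
  define w where "w = (b - a) / N"
  have w: "0 < w" "N * w = b - a" using assms(3) \<open>0 < N\<close> by (auto simp: w_def)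
  define A where "A l = {x. a + real l * w < dist z x \<and> dist z x < a + real l * w + w}" for l
  have disj: "disjoint_family_on A {..<N}"
  proof -
    have "A l \<inter> A m = {}" if "l < m" for l m
    proof -
      have "real l * w + w \<le> real m * w" using that w mult_right_mono[of "real l + 1" "real m" w]
        by (simp add: distrib_right)
      then show ?thesis by (auto simp: A_def)
    qed
    then show ?thesis unfolding disjoint_family_on_def by (metis Int_commute linorder_neqE_nat)
  qed
  have "\<exists>l<N. \<forall>j\<in>J. \<Lambda> j (indicator (A l)) \<le> e"
  proof (rule ccontr)
    assume "\<not> ?thesis"
    then have *: "\<exists>j\<in>J. e < \<Lambda> j (indicator (A l))" if "l < N" for l using that by (auto simp: not_le)
    have "(\<Sum>l<N. e) \<le> (\<Sum>l<N. \<Sum>j\<in>J. \<Lambda> j (indicator (A l)))"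
    proof (rule sum_mono)
      fix l assume "l \<in> {..<N}"
      then obtain j where j: "j \<in> J" "e < \<Lambda> j (indicator (A l))" using * by auto
      have "\<Lambda> j (indicator (A l)) \<le> (\<Sum>j\<in>J. \<Lambda> j (indicator (A l)))"
        using J j by (intro member_le_sum) (auto intro: mean.indicator_nonneg)
      with j show "e \<le> (\<Sum>j\<in>J. \<Lambda> j (indicator (A l)))" by linarith
    qed
    also have "\<dots> = (\<Sum>j\<in>J. \<Sum>l<N. \<Lambda> j (indicator (A l)))" by (rule sum.swap)
    also have "\<dots> \<le> (\<Sum>j\<in>J. 1)"
      by (intro sum_mono mean.sum_disjoint_le_1[OF J(2)] disj) auto
    finally show False using N \<open>0 < e\<close> by (simp add: field_simps)
  qed
  then obtain l where l: "l < N" "\<And>j. j \<in> J \<Longrightarrow> \<Lambda> j (indicator (A l)) \<le> e" by blast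
  show ?thesis
  proof (rule exI[of _ "a + real l * w"], rule exI[of _ w], intro conjI ballI)
    show "a \<le> a + real l * w" using w by simp
    have "real l * w + w \<le> N * w"
      using l(1) w mult_right_mono[of "real l + 1" "real N" w] by (simp add: distrib_right)
    then show "a + real l * w + w \<le> b" using w by simp
  qed (use w l in \<open>auto simp: A_def\<close>)
qed

text \<open>Since nonnegative bumps sum to at most 1, all others of index below \<open>M\<close>
  vanish where one of them equals 1. The plateaus are thus disjoint, and every linear combination of
  the bumps is constant on each of them.\<close>

definition bump_family :: "real \<Rightarrow> nat \<Rightarrow> (nat \<Rightarrow> 'a::metric_space \<Rightarrow> real) \<Rightarrow> bool" where
  "bump_family \<delta> M b \<longleftrightarrow>
     (\<forall>i. continuous_on UNIV (b i)) \<and> (\<forall>i x. 0 \<le> b i x) \<and> (\<forall>x. (\<Sum>i<M. b i x) \<le> 1) \<and>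
     (\<forall>i<M. \<exists>z. {x. b i x \<noteq> 0} \<subseteq> ball z \<delta>)"

text \<open>With \<open>\<tau> i\<close> as success probabilities, the event that one of
  \<open>M\<close> independent trials succeeds is split according to the first success.\<close>

lemma telescoping_product:
  fixes \<tau> :: "nat \<Rightarrow> real"
  shows "(\<Sum>i<M. \<tau> i * (\<Prod>k<i. 1 - \<tau> k)) = 1 - (\<Prod>k<M. 1 - \<tau> k)"
  by (induction M) (auto simp: algebra_simps)

text \<open>
  The bumps separate disjoint pieces of small diameter; they miss the value 1 only on thin
  annuli, whose radii are chosen by pigeonhole so that the means do not charge them.
\<close>

lemma bump_family_exists:
  fixes K :: "'a::metric_space set"
  assumes K: "compact K" and J: "finite J" "\<And>j. j \<in> J \<Longrightarrow> mean (U j) (\<Lambda> j)" "\<And>j. j \<in> J \<Longrightarrow> U j \<subseteq> K"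
    and "0 < \<delta>" "0 < e"
  obtains M b where "bump_family \<delta> M b"
    "\<And>j. j \<in> J \<Longrightarrow> \<Lambda> j (indicator {x. \<forall>i<M. b i x \<noteq> 1}) \<le> e"
proof -
  have "K \<subseteq> (\<Union>x\<in>K. ball x (\<delta> / 2))" using \<open>0 < \<delta>\<close> by force
  then obtain Z where "Z \<subseteq> K" and Z: "finite Z" "K \<subseteq> (\<Union>x\<in>Z. ball x (\<delta> / 2))"
    by (rule compactE_image[OF K open_ball])
  obtain z where z: "bij_betw z {..<card Z} Z"
    using ex_bij_betw_nat_finite[OF Z(1)] by (auto simp: atLeast0LessThan)
  define M where "M = card Z"
  have cov: "\<exists>i<M. dist (z i) x < \<delta> / 2" if x: "x \<in> K" for x
  proof -
    obtain y where y: "y \<in> Z" "dist y x < \<delta> / 2" using Z x by auto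
    then obtain i where "i \<in> {..<card Z}" "z i = y"
      using bij_betw_imp_surj_on[OF z] by (metis imageE)
    then show ?thesis using y unfolding M_def by auto
  qed
  define P where "P i \<rho> w \<longleftrightarrow> \<delta> / 2 \<le> \<rho> \<and> 0 < w \<and> \<rho> + w \<le> \<delta> \<and>
      (\<forall>j\<in>J. \<Lambda> j (indicator {x. \<rho> < dist (z i) x \<and> dist (z i) x < \<rho> + w}) \<le> e / (M + 1))" for i \<rho> w
  have "\<exists>\<rho> w. P i \<rho> w" for i
    unfolding P_def
  proof (rule small_annulus[of J U \<Lambda> "\<delta> / 2" \<delta> "e / (M + 1)" "z i"])
    show "\<delta> / 2 < \<delta>" "0 < e / (M + 1)" using \<open>0 < \<delta>\<close> \<open>0 < e\<close> by auto
  qed (fact J)+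
  then obtain \<rho> w where "\<And>i. P i (\<rho> i) (w i)" by metis
  then have \<rho>: "\<And>i. \<delta> / 2 \<le> \<rho> i" and w: "\<And>i. 0 < w i" and \<rho>w: "\<And>i. \<rho> i + w i \<le> \<delta>"
    and ann: "\<And>i j. j \<in> J \<Longrightarrow> \<Lambda> j (indicator {x. \<rho> i < dist (z i) x \<and> dist (z i) x < \<rho> i + w i}) \<le> e / (M + 1)"
    unfolding P_def by blast+
  define \<tau> where "\<tau> i x = max 0 (min 1 ((\<rho> i + w i - dist (z i) x) / w i))" for i x
  have \<tau>: "0 \<le> \<tau> i x" "\<tau> i x \<le> 1" for i x by (auto simp: \<tau>_def)
  have \<tau>1: "\<tau> i x = 1" if "dist (z i) x \<le> \<rho> i" for i x
    using that w[of i] by (auto simp: \<tau>_def)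
  have \<tau>0: "\<tau> i x = 0" if "\<rho> i + w i \<le> dist (z i) x" for i x
  proof -
    have "(\<rho> i + w i - dist (z i) x) / w i \<le> 0" using that w[of i] by (intro divide_nonpos_pos) auto
    then show ?thesis by (simp add: \<tau>_def)
  qed
  define b where "b i x = \<tau> i x * (\<Prod>k<i. 1 - \<tau> k x)" for i x
  have "bump_family \<delta> M b"
    unfolding bump_family_def
  proof (intro conjI allI impI)
    show "continuous_on UNIV (b i)" for i
      unfolding b_def \<tau>_def using w by (intro continuous_intros) (auto simp: less_imp_neq[symmetric])
    show "0 \<le> b i x" for i x using \<tau> unfolding b_def by (intro mult_nonneg_nonneg prod_nonneg) auto
    show "(\<Sum>i<M. b i x) \<le> 1" for x
      unfolding b_def telescoping_product using \<tau> by (simp add: prod_nonneg)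
    show "\<exists>y. {x. b i x \<noteq> 0} \<subseteq> ball y \<delta>" if "i < M" for i
    proof (intro exI[of _ "z i"] subsetI)
      fix x assume "x \<in> {x. b i x \<noteq> 0}"
      then have "\<not> \<rho> i + w i \<le> dist (z i) x" using \<tau>0[of i x] by (auto simp: b_def)
      then show "x \<in> ball (z i) \<delta>" using \<rho>w[of i] by simp
    qed
  qed
  moreover have "\<Lambda> j (indicator {x. \<forall>i<M. b i x \<noteq> 1}) \<le> e" if j: "j \<in> J" for j
  proof -
    interpret mean "U j" "\<Lambda> j" by (rule J(2)[OF j])
    have "{x. \<forall>i<M. b i x \<noteq> 1} \<inter> U j \<subseteq> (\<Union>i<M. {x. \<rho> i < dist (z i) x \<and> dist (z i) x < \<rho> i + w i})"
    proof (rule subsetI, rule ccontr)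
      fix x assume "x \<in> {x. \<forall>i<M. b i x \<noteq> 1} \<inter> U j"
        and notin: "x \<notin> (\<Union>i<M. {x. \<rho> i < dist (z i) x \<and> dist (z i) x < \<rho> i + w i})"
      then have x: "\<And>i. i < M \<Longrightarrow> b i x \<noteq> 1" "x \<in> U j" by auto
      have out: "dist (z i) x \<le> \<rho> i \<or> \<rho> i + w i \<le> dist (z i) x" if "i < M" for i
        using notin that by force
      obtain i0 where "i0 < M" "dist (z i0) x < \<delta> / 2" using cov[of x] x J(3)[OF j] by auto
      then have ex: "i0 < M \<and> dist (z i0) x \<le> \<rho> i0" using \<rho>[of i0] by auto
      \<comment> \<open>Outside all annuli each cutoff is 0 or 1, and the first cutoff equal to 1
        yields a bump with value 1.\<close>
      define i where "i = (LEAST i. i < M \<and> dist (z i) x \<le> \<rho> i)"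
      have i: "i < M" "dist (z i) x \<le> \<rho> i" using LeastI[of "\<lambda>i. i < M \<and> dist (z i) x \<le> \<rho> i", OF ex] by (auto simp: i_def)
      have "\<tau> k x = 0" if "k < i" for k
        using not_less_Least[of k "\<lambda>i. i < M \<and> dist (z i) x \<le> \<rho> i"] that i(1) out[of k]
        by (intro \<tau>0) (auto simp: i_def)
      then have "b i x = 1" using \<tau>1[OF i(2)] by (simp add: b_def)
      with x(1)[OF i(1)] show False by simp
    qed
    then have "\<Lambda> j (indicator {x. \<forall>i<M. b i x \<noteq> 1})
        \<le> (\<Sum>i<M. \<Lambda> j (indicator {x. \<rho> i < dist (z i) x \<and> dist (z i) x < \<rho> i + w i}))"
      by (intro indicator_UN_le) auto
    also have "\<dots> \<le> (\<Sum>i<M. e / (M + 1))" by (intro sum_mono ann j)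
    also have "\<dots> \<le> e" using \<open>0 < e\<close> by (simp add: field_simps)
    finally show ?thesis .
  qed
  ultimately show thesis by (rule that)
qed

section \<open>A self-refining kernel\<close>

definition tent :: "real \<Rightarrow> real" where
  "tent t = max 0 (1 - \<bar>t\<bar>)"

lemma tent_bounds: "0 \<le> tent t" "tent t \<le> 1"
  by (auto simp: tent_def)

lemma tent_lipschitz: "\<bar>tent s - tent t\<bar> \<le> \<bar>s - t\<bar>"
  by (auto simp: tent_def)

text \<open>The two-scale relation of the linear B-spline.\<close>

lemma tent_refine: "tent (u + 1) + 2 * tent u + tent (u - 1) = 2 * tent (u / 2)"
  by (auto simp: tent_def max_def abs_if field_simps)

text \<open>The factor \<open>2 ^ n\<close> in each coordinate normalises the integral to 1 at every
  level.\<close>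

definition kern :: "nat \<Rightarrow> real ^ 'd \<Rightarrow> real" where
  "kern n v = (\<Prod>c\<in>UNIV. 2 ^ n * tent (2 ^ n * v $ c))"

definition spin :: "bool \<Rightarrow> real" where
  "spin p = (if p then 1 / 2 else - 1 / 2)"

text \<open>In each coordinate the sum of two fair values \<open>1 / 2\<close> and
  \<open>- 1 / 2\<close> takes -1, 0, 1 with weights 1/4, 1/2, 1/4, the mask of
  \<open>tent_refine\<close>. Two coins realise these weights by a uniform choice from a finite
  set.\<close>

definition spin_vec :: "('d \<Rightarrow> bool \<times> bool) \<Rightarrow> real ^ 'd" where
  "spin_vec a = (\<chi> c. spin (fst (a c)) + spin (snd (a c)))"

lemma kern_altdef: "kern n (v :: real ^ 'd) = (2 ^ n) ^ CARD('d) * (\<Prod>c\<in>UNIV. tent (2 ^ n * v $ c))"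
  by (simp add: kern_def prod.distrib)

lemma kern_nonneg: "0 \<le> kern n v"
  unfolding kern_def by (intro prod_nonneg mult_nonneg_nonneg tent_bounds ballI) auto

lemma kern_le: "kern n (v :: real ^ 'd) \<le> (2 ^ n) ^ CARD('d)"
proof -
  have "(\<Prod>c\<in>UNIV. tent (2 ^ n * v $ c)) \<le> 1" by (intro prod_le_1) (simp add: tent_bounds)
  then show ?thesis unfolding kern_altdef by (intro mult_left_le) auto
qed

lemma kern_support:
  assumes "kern n (v :: real ^ 'd) \<noteq> 0"
  shows "norm v \<le> CARD('d) / 2 ^ n"
proof -
  have "\<bar>v $ c\<bar> \<le> 1 / 2 ^ n" for c
  proof -
    have "tent (2 ^ n * v $ c) \<noteq> 0" using assms by (auto simp: kern_def)
    then show ?thesis by (auto simp: tent_def max_def abs_mult field_simps split: if_splits)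
  qed
  then have "(\<Sum>c\<in>UNIV. \<bar>v $ c\<bar>) \<le> (\<Sum>c\<in>(UNIV :: 'd set). 1 / 2 ^ n)" by (intro sum_mono)
  with norm_le_l1_cart[of v] show ?thesis by simp
qed

lemma kern_lower:
  assumes "norm (v :: real ^ 'd) \<le> 1 / 2 ^ Suc n"
  shows "(1 / 2) ^ CARD('d) \<le> kern n v"
proof -
  have "1 / 2 \<le> 2 ^ n * tent (2 ^ n * v $ c)" for c
  proof -
    have "\<bar>v $ c\<bar> \<le> 1 / 2 ^ Suc n" using component_le_norm_cart[of v c] assms by linarith
    then have "1 / 2 \<le> tent (2 ^ n * v $ c)" by (auto simp: tent_def max_def abs_mult field_simps)
    moreover have "tent (2 ^ n * v $ c) \<le> 2 ^ n * tent (2 ^ n * v $ c)"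
      using tent_bounds[of "2 ^ n * v $ c"] by (intro mult_left_le[THEN order_trans, rotated] mult_le_cancel_right1[THEN iffD2]) (auto simp: mult_le_cancel_right1)
    ultimately show ?thesis by linarith
  qed
  then have "(\<Prod>c\<in>(UNIV :: 'd set). 1 / 2) \<le> kern n v" unfolding kern_def by (intro prod_mono) auto
  then show ?thesis by simp
qed

lemma kern_lipschitz:
  "\<bar>kern n (u :: real ^ 'd) - kern n v\<bar> \<le> (2 ^ n) ^ CARD('d) * (CARD('d) * 2 ^ n) * norm (u - v)"
proof -
  have "\<bar>(\<Prod>c\<in>UNIV. tent (2 ^ n * u $ c)) - (\<Prod>c\<in>UNIV. tent (2 ^ n * v $ c))\<bar>
      \<le> (\<Sum>c\<in>UNIV. \<bar>tent (2 ^ n * u $ c) - tent (2 ^ n * v $ c)\<bar>)"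
    using norm_prod_diff[of UNIV "\<lambda>c. tent (2 ^ n * u $ c)" "\<lambda>c. tent (2 ^ n * v $ c)"]
    by (simp add: tent_bounds)
  also have "\<dots> \<le> (\<Sum>c\<in>(UNIV :: 'd set). 2 ^ n * norm (u - v))"
  proof (rule sum_mono)
    fix c
    have "\<bar>tent (2 ^ n * u $ c) - tent (2 ^ n * v $ c)\<bar> \<le> \<bar>2 ^ n * u $ c - 2 ^ n * v $ c\<bar>"
      by (rule tent_lipschitz)
    also have "\<dots> = 2 ^ n * \<bar>(u - v) $ c\<bar>" by (simp add: abs_mult flip: right_diff_distrib)
    also have "\<dots> \<le> 2 ^ n * norm (u - v)" by (intro mult_left_mono component_le_norm_cart) auto
    finally show "\<bar>tent (2 ^ n * u $ c) - tent (2 ^ n * v $ c)\<bar> \<le> 2 ^ n * norm (u - v)" .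
  qed
  finally have "\<bar>(\<Prod>c\<in>UNIV. tent (2 ^ n * u $ c)) - (\<Prod>c\<in>UNIV. tent (2 ^ n * v $ c))\<bar>
      \<le> CARD('d) * 2 ^ n * norm (u - v)" by simp
  then have "(2 ^ n) ^ CARD('d) * \<bar>(\<Prod>c\<in>UNIV. tent (2 ^ n * u $ c)) - (\<Prod>c\<in>UNIV. tent (2 ^ n * v $ c))\<bar>
      \<le> (2 ^ n) ^ CARD('d) * (CARD('d) * 2 ^ n * norm (u - v))"
    by (rule mult_left_mono) simp
  then show ?thesis
    by (simp add: kern_altdef abs_mult mult.assoc flip: right_diff_distrib)
qed

lemma kern_uniformly_continuous:
  assumes "0 < e"
  obtains r where "0 < r" "\<And>u v :: real ^ 'd. norm (u - v) \<le> r \<Longrightarrow> \<bar>kern n u - kern n v\<bar> \<le> e"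
proof -
  define L :: real where "L = (2 ^ n) ^ CARD('d) * (CARD('d) * 2 ^ n)"
  have L: "0 < L" by (simp add: L_def)
  show thesis
  proof (rule that[of "e / L"])
    fix u v :: "real ^ 'd" assume "norm (u - v) \<le> e / L"
    then have "L * norm (u - v) \<le> e" using L by (simp add: field_simps)
    with kern_lipschitz[of n u v] show "\<bar>kern n u - kern n v\<bar> \<le> e" by (simp add: L_def)
  qed (use L assms in simp)
qed

lemma norm_spin_vec: "norm (spin_vec a :: real ^ 'd) \<le> CARD('d)"
proof -
  have "(\<Sum>c\<in>UNIV. \<bar>(spin_vec a :: real ^ 'd) $ c\<bar>) \<le> (\<Sum>c\<in>(UNIV :: 'd set). 1)"
    by (intro sum_mono) (simp add: spin_vec_def spin_def)
  with norm_le_l1_cart[of "spin_vec a"] show ?thesis by simp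
qed

text \<open>The sum over all rolls factors over the coordinates, and each factor is an instance of
  \<open>tent_refine\<close>. Read as an average: the random shift turns the finer kernel into the
  coarser one.\<close>

lemma kern_refine:
  "(\<Sum>a\<in>UNIV. kern (Suc n) (v - (1 / 2 ^ Suc n) *\<^sub>R spin_vec a)) =
     CARD('d \<Rightarrow> bool \<times> bool) * kern n (v :: real ^ 'd)"
proof -
  define h where "h c p = 2 ^ Suc n * tent (2 ^ Suc n * v $ c - (spin (fst p) + spin (snd p)))"
    for c and p :: "bool \<times> bool"
  have sum_h: "(\<Sum>p\<in>UNIV. h c p) = 4 * (2 ^ n * tent (2 ^ n * v $ c))" for c
  proof -
    have "(\<Sum>p\<in>UNIV. h c p) = 2 ^ Suc n * (tent (2 ^ Suc n * v $ c + 1) + 2 * tent (2 ^ Suc n * v $ c) + tent (2 ^ Suc n * v $ c - 1))"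
      by (simp add: h_def UNIV_Times_UNIV[symmetric] UNIV_bool spin_def sum.cartesian_product[symmetric] algebra_simps del: UNIV_Times_UNIV)
    then show ?thesis unfolding tent_refine by simp
  qed
  have "(\<Sum>a\<in>UNIV. kern (Suc n) (v - (1 / 2 ^ Suc n) *\<^sub>R spin_vec a)) = (\<Sum>a\<in>UNIV. \<Prod>c\<in>UNIV. h c (a c))"
    by (intro sum.cong refl) (simp add: kern_def h_def spin_vec_def right_diff_distrib)
  also have "\<dots> = (\<Prod>c\<in>UNIV. \<Sum>p\<in>UNIV. h c p)"
    using prod_sum_PiE[of UNIV "\<lambda>_. UNIV" h] by (simp add: PiE_UNIV_domain)
  also have "\<dots> = 4 ^ CARD('d) * kern n v" unfolding sum_h by (simp add: kern_def prod.distrib)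
  finally show ?thesis by (simp add: card_fun)
qed

section \<open>Orthogonal sums over independent dice\<close>

definition dice :: "('i \<Rightarrow> 's::finite) measure" where
  "dice = (\<Pi>\<^sub>M i\<in>UNIV. measure_pmf (pmf_of_set UNIV))"

lemma space_dice [simp]: "space dice = UNIV"
  by (simp add: dice_def space_PiM)

lemma prob_space_dice: "prob_space dice"
  unfolding dice_def by (intro prob_space_PiM measure_pmf.prob_space_axioms)

text \<open>A die has finitely many faces, so an event that depends on finitely many dice is a
  finite union of cylinders. The target of \<open>h\<close> is arbitrary, which also covers truth
  values of quantified predicates.\<close>

lemma dice_cylinder:
  fixes h :: "('i \<Rightarrow> 's::finite) \<Rightarrow> 'b"
  assumes I: "finite I" and dep: "\<And>w w'. (\<forall>i\<in>I. w i = w' i) \<Longrightarrow> h w = h w'"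
  shows "{w. h w \<in> S} \<in> sets dice"
proof -
  define T where "T = {t \<in> PiE I (\<lambda>_. UNIV). \<exists>w. h w \<in> S \<and> t = restrict w I}"
  have "finite T" unfolding T_def using finite_PiE[OF I, of "\<lambda>_. UNIV :: 's set"] by simp
  have "{w. h w \<in> S} = (\<Union>t\<in>T. {w \<in> space dice. \<forall>i\<in>I. w i = t i})"
  proof (intro equalityI subsetI)
    fix w assume "w \<in> {w. h w \<in> S}"
    then show "w \<in> (\<Union>t\<in>T. {w \<in> space dice. \<forall>i\<in>I. w i = t i})"
      by (intro UN_I[of "restrict w I"]) (auto simp: T_def)
  next
    fix w assume "w \<in> (\<Union>t\<in>T. {w \<in> space dice. \<forall>i\<in>I. w i = t i})"
    then obtain w' where "h w' \<in> S" "\<forall>i\<in>I. w i = w' i" by (auto simp: T_def)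
    then show "w \<in> {w. h w \<in> S}" using dep[of w w'] by simp
  qed
  also have "\<dots> \<in> sets dice"
  proof (intro sets.finite_UN \<open>finite T\<close> sets.sets_Collect_finite_All I)
    fix t i
    have "(\<lambda>w. w i) \<in> measurable dice (measure_pmf (pmf_of_set UNIV))"
      unfolding dice_def by (rule measurable_component_singleton) simp
    then have "(\<lambda>w. w i) -` {t i} \<inter> space dice \<in> sets dice" by (rule measurable_sets) simp
    then show "{w \<in> space dice. w i = t i} \<in> sets dice" by (simp add: vimage_def)
  qed
  finally show ?thesis .
qed

lemma dice_measurable:
  fixes h :: "('i \<Rightarrow> 's::finite) \<Rightarrow> 'b"
  assumes "finite I" "\<And>w w'. (\<forall>i\<in>I. w i = w' i) \<Longrightarrow> h w = h w'" "space M = UNIV"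
  shows "h \<in> measurable dice M"
  using dice_cylinder[of I h, OF assms(1,2)] assms(3)
  by (auto simp: measurable_def vimage_def)

text \<open>Replacing one coordinate by an independent fair roll preserves the law, so an integral
  may be averaged over that coordinate. This takes the place of conditional expectation.\<close>

lemma dice_resample:
  fixes h :: "('i \<Rightarrow> 's::finite) \<Rightarrow> real"
  assumes h [measurable]: "h \<in> borel_measurable dice" and bound: "\<And>w. \<bar>h w\<bar> \<le> B"
  shows "(\<integral>w. h w \<partial>dice) = (\<Sum>a\<in>UNIV. \<integral>w. h (w(c := a)) \<partial>dice) / CARD('s)"
proof -
  let ?M = "measure_pmf (pmf_of_set (UNIV :: 's set))"
  interpret D: prob_space "dice :: ('i \<Rightarrow> 's) measure" by (rule prob_space_dice)
  interpret P: pair_prob_space ?M "dice :: ('i \<Rightarrow> 's) measure" ..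
  have eq: "distr (?M \<Otimes>\<^sub>M dice) dice (\<lambda>(x, X). X(c := x)) = (dice :: ('i \<Rightarrow> 's) measure)"
    using distr_pair_PiM_eq_PiM[of UNIV "\<lambda>_. ?M" c,
        OF measure_pmf.prob_space_axioms measure_pmf.prob_space_axioms]
    unfolding dice_def insert_UNIV .
  have meas: "(\<lambda>(x, X). X(c := x)) \<in> measurable (?M \<Otimes>\<^sub>M dice) (dice :: ('i \<Rightarrow> 's) measure)"
    using measurable_fun_upd[of UNIV UNIV c "\<lambda>p. snd p" "?M \<Otimes>\<^sub>M dice" "\<lambda>_. ?M" "\<lambda>p. fst p"]
    by (auto simp: dice_def case_prod_unfold)
  have hm: "(\<lambda>(x, w). h (w(c := x))) \<in> borel_measurable (?M \<Otimes>\<^sub>M dice)"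
    using measurable_compose[OF meas h] by (simp add: case_prod_unfold)
  have "integrable (?M \<Otimes>\<^sub>M dice) (\<lambda>(x, w). h (w(c := x)))"
    using bound by (intro P.integrable_const_bound[where B = B] hm) (auto simp: case_prod_unfold)
  then have "(\<integral>x. (\<integral>w. h (w(c := x)) \<partial>dice) \<partial>?M) = (\<integral>p. (\<lambda>(x, w). h (w(c := x))) p \<partial>(?M \<Otimes>\<^sub>M dice))"
    by (rule P.integral_fst)
  also have "\<dots> = (\<integral>w. h w \<partial>distr (?M \<Otimes>\<^sub>M dice) dice (\<lambda>(x, X). X(c := x)))"
    using integral_distr[OF meas h] by (simp add: case_prod_unfold)
  finally show ?thesis unfolding eq by (simp add: integral_pmf_of_set)
qed

text \<open>Die \<open>c k\<close> affects no term other than \<open>Y k\<close>, so averaging over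
  it kills every mixed product and only the squares remain. The terms may share all their remaining
  dice: they are orthogonal without being independent.\<close>

lemma orthogonal_second_moment:
  fixes Y :: "'k \<Rightarrow> ('i \<Rightarrow> 's::finite) \<Rightarrow> real"
  assumes J: "finite J" and meas: "\<And>k. k \<in> J \<Longrightarrow> Y k \<in> borel_measurable dice"
    and bound: "\<And>k w. k \<in> J \<Longrightarrow> \<bar>Y k w\<bar> \<le> m k"
    and indep: "\<And>k l w a. k \<in> J \<Longrightarrow> l \<in> J \<Longrightarrow> k \<noteq> l \<Longrightarrow> Y l (w(c k := a)) = Y l w"
    and centered: "\<And>k w. k \<in> J \<Longrightarrow> (\<Sum>a\<in>UNIV. Y k (w(c k := a))) = 0"
  shows "(\<integral>w. (\<Sum>k\<in>J. Y k w)\<^sup>2 \<partial>dice) \<le> (\<Sum>k\<in>J. (m k)\<^sup>2)"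
proof -
  interpret D: prob_space "dice :: ('i \<Rightarrow> 's) measure" by (rule prob_space_dice)
  note [measurable] = meas
  have prod_bound: "\<bar>Y k w * Y l w\<bar> \<le> m k * m l" if "k \<in> J" "l \<in> J" for k l w
    using bound[OF that(1), of w] bound[OF that(2), of w] unfolding abs_mult by (intro mult_mono) auto
  have int: "integrable dice (\<lambda>w. Y k w * Y l w)" if "k \<in> J" "l \<in> J" for k l
    by (rule D.integrable_const_bound[where B = "m k * m l"]) (use that prod_bound meas in auto)
  have off: "(\<integral>w. Y k w * Y l w \<partial>dice) = 0" if kl: "k \<in> J" "l \<in> J" "k \<noteq> l" for k l
  proof -
    have eq: "Y k (w(c k := a)) * Y l (w(c k := a)) = Y k (w(c k := a)) * Y l w" for w a
      using indep[OF kl] by simp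
    have upd: "(\<lambda>w. w(c k := a)) \<in> measurable dice (dice :: ('i \<Rightarrow> 's) measure)" for a
      using measurable_fun_upd[of UNIV UNIV "c k" "\<lambda>w. w" dice "\<lambda>_. measure_pmf (pmf_of_set (UNIV :: 's set))" "\<lambda>_. a"]
      by (simp add: dice_def)
    have int': "integrable dice (\<lambda>w. Y k (w(c k := a)) * Y l w)" for a
    proof (rule D.integrable_const_bound[where B = "m k * m l"])
      show "(\<lambda>w. Y k (w(c k := a)) * Y l w) \<in> borel_measurable dice"
        using measurable_compose[OF upd meas[OF kl(1)]] meas[OF kl(2)] by simp
      show "AE w in dice. norm (Y k (w(c k := a)) * Y l w) \<le> m k * m l"
        using prod_bound[OF kl(1,2)] unfolding eq[symmetric] by (intro AE_I2) auto
    qed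
    have "(\<integral>w. Y k w * Y l w \<partial>dice) =
        (\<Sum>a\<in>UNIV. \<integral>w. Y k (w(c k := a)) * Y l w \<partial>dice) / CARD('s)"
      unfolding eq[symmetric]
      by (rule dice_resample[where B = "m k * m l"]) (use kl prod_bound meas in auto)
    also have "(\<Sum>a\<in>UNIV. \<integral>w. Y k (w(c k := a)) * Y l w \<partial>dice)
        = (\<integral>w. (\<Sum>a\<in>UNIV. Y k (w(c k := a)) * Y l w) \<partial>dice)"
      using int' by (intro Bochner_Integration.integral_sum[symmetric]) auto
    also have "\<dots> = 0" using centered[OF kl(1)] by (simp flip: sum_distrib_right)
    finally show ?thesis by simp
  qed
  have "(\<integral>w. (\<Sum>k\<in>J. Y k w)\<^sup>2 \<partial>dice) = (\<integral>w. (\<Sum>k\<in>J. \<Sum>l\<in>J. Y k w * Y l w) \<partial>dice)"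
    by (simp add: power2_eq_square sum_product)
  also have "\<dots> = (\<Sum>k\<in>J. \<integral>w. (\<Sum>l\<in>J. Y k w * Y l w) \<partial>dice)"
    using int by (intro Bochner_Integration.integral_sum Bochner_Integration.integrable_sum) auto
  also have "\<dots> = (\<Sum>k\<in>J. \<Sum>l\<in>J. \<integral>w. Y k w * Y l w \<partial>dice)"
    using int by (intro sum.cong refl Bochner_Integration.integral_sum) auto
  also have "\<dots> = (\<Sum>k\<in>J. \<integral>w. Y k w * Y k w \<partial>dice)"
  proof (intro sum.cong refl)
    fix k assume k: "k \<in> J"
    have "(\<Sum>l\<in>J. \<integral>w. Y k w * Y l w \<partial>dice) = (\<Sum>l\<in>J. if l = k then \<integral>w. Y k w * Y k w \<partial>dice else 0)"
      using off[OF k] by (intro sum.cong) auto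
    then show "(\<Sum>l\<in>J. \<integral>w. Y k w * Y l w \<partial>dice) = (\<integral>w. Y k w * Y k w \<partial>dice)"
      using J k by simp
  qed
  also have "\<dots> \<le> (\<Sum>k\<in>J. (m k)\<^sup>2)"
  proof (intro sum_mono)
    fix k assume k: "k \<in> J"
    have "(\<integral>w. Y k w * Y k w \<partial>dice) \<le> (\<integral>w. (m k)\<^sup>2 \<partial>(dice :: ('i \<Rightarrow> 's) measure))"
      using prod_bound[OF k k] int[OF k k]
      by (intro integral_mono) (auto simp: power2_eq_square intro: order_trans[OF abs_ge_self])
    then show "(\<integral>w. Y k w * Y k w \<partial>dice) \<le> (m k)\<^sup>2" using D.prob_space by simp
  qed
  finally show ?thesis .
qed

lemma orthogonal_deviation:
  fixes Y :: "'k \<Rightarrow> ('i \<Rightarrow> 's::finite) \<Rightarrow> real"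
  assumes J: "finite J" and meas: "\<And>k. k \<in> J \<Longrightarrow> Y k \<in> borel_measurable dice"
    and bound: "\<And>k w. k \<in> J \<Longrightarrow> \<bar>Y k w\<bar> \<le> m k"
    and indep: "\<And>k l w a. k \<in> J \<Longrightarrow> l \<in> J \<Longrightarrow> k \<noteq> l \<Longrightarrow> Y l (w(c k := a)) = Y l w"
    and centered: "\<And>k w. k \<in> J \<Longrightarrow> (\<Sum>a\<in>UNIV. Y k (w(c k := a))) = 0"
    and \<eta>: "0 < \<eta>"
  shows "measure dice {w. \<eta> \<le> \<bar>\<Sum>k\<in>J. Y k w\<bar>} \<le> (\<Sum>k\<in>J. (m k)\<^sup>2) / \<eta>\<^sup>2"
proof -
  interpret D: prob_space "dice :: ('i \<Rightarrow> 's) measure" by (rule prob_space_dice)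
  note [measurable] = meas
  have le: "\<bar>\<Sum>k\<in>J. Y k w\<bar> \<le> (\<Sum>k\<in>J. m k)" for w
    using bound by (intro order_trans[OF sum_abs] sum_mono) auto
  have int: "integrable dice (\<lambda>w. (\<Sum>k\<in>J. Y k w)\<^sup>2)"
  proof (rule D.integrable_const_bound[where B = "(\<Sum>k\<in>J. m k)\<^sup>2"])
    show "AE w in dice. norm ((\<Sum>k\<in>J. Y k w)\<^sup>2) \<le> (\<Sum>k\<in>J. m k)\<^sup>2"
      using le by (intro AE_I2) (auto intro: power2_le_iff_abs_le[THEN iffD2] order_trans[OF abs_ge_zero le])
  qed measurable
  have "{w. \<eta> \<le> \<bar>\<Sum>k\<in>J. Y k w\<bar>} = {w \<in> space dice. \<eta>\<^sup>2 \<le> (\<Sum>k\<in>J. Y k w)\<^sup>2}"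
    using \<eta> by (auto simp: abs_le_square_iff[symmetric])
  also have "measure dice \<dots> \<le> (\<integral>w. (\<Sum>k\<in>J. Y k w)\<^sup>2 \<partial>dice) / \<eta>\<^sup>2"
    by (rule integral_Markov_inequality_measure[OF int, where A = "{}"]) (use \<eta> in auto)
  also have "\<dots> \<le> (\<Sum>k\<in>J. (m k)\<^sup>2) / \<eta>\<^sup>2"
    using orthogonal_second_moment[of J Y m c, OF J meas bound indep centered]
    by (intro divide_right_mono) auto
  finally show ?thesis .
qed

section \<open>The random field and its occupation densities\<close>

lemma bounded_fun_on_cmult:
  "bounded_fun_on U f \<Longrightarrow> bounded_fun_on U (\<lambda>x. c * f x)"
  by (rule bounded_fun_on_mult[OF bounded_fun_on_const])

lemma (in mean) abs_le:
  assumes "bounded_fun_on U f" "bounded_fun_on U g" "\<And>x. x \<in> U \<Longrightarrow> \<bar>f x\<bar> \<le> g x"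
  shows "\<bar>\<Lambda> f\<bar> \<le> \<Lambda> g"
proof -
  have le: "f x \<le> g x" "- 1 * f x \<le> g x" if "x \<in> U" for x using assms(3)[OF that] by auto
  have "\<Lambda> f \<le> \<Lambda> g" by (rule mono) (use assms le in auto)
  moreover have "\<Lambda> (\<lambda>x. - 1 * f x) \<le> \<Lambda> g"
    by (rule mono[OF bounded_fun_on_cmult[OF assms(1)] assms(2) le(2)])
  ultimately show ?thesis using scale[OF assms(1), of "-1"] by auto
qed

type_synonym 'd rolls = "nat \<times> nat \<Rightarrow> 'd \<Rightarrow> bool \<times> bool"

text \<open>
  The level-\<open>n\<close> term of the random field is constant on each piece, so that shifting by it turns
  the kernel at scale \<open>2^-(n+1)\<close> into the kernel at scale \<open>2^-n\<close> on average. The numbers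
  \<open>\<eta> n\<close> bound the fluctuation of the occupation density at level \<open>n\<close>, and the pieces of
  level \<open>n\<close> have diameter at most \<open>2 * \<delta> n\<close>.
\<close>

locale random_field =
  fixes K :: "'a::metric_space set" and U Z :: "nat \<Rightarrow> 'a set"
    and \<Lambda> :: "nat \<Rightarrow> ('a \<Rightarrow> real) \<Rightarrow> real" and \<sigma> s C :: "nat \<Rightarrow> real"
    and M :: "nat \<Rightarrow> nat" and b :: "nat \<Rightarrow> nat \<Rightarrow> 'a \<Rightarrow> real" and \<delta> \<eta> \<mu> :: "nat \<Rightarrow> real"
    and T T0 :: "nat \<Rightarrow> (real ^ 'd) set"
  assumes mean: "mean (U j) (\<Lambda> j)" and compact_Z: "compact (Z j)"
    and U_subset: "U j \<subseteq> Z j" and Z_subset: "Z j \<subseteq> K"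
    and s_pos: "0 < s j" and s_less: "s j < \<sigma> j" and C_pos: "0 < C j"
    and frostman: "0 < r \<Longrightarrow> \<Lambda> j (indicator (ball x r)) \<le> C j * r powr \<sigma> j"
    and bump: "bump_family (\<delta> n) (M n) (b n)"
    and gap: "j \<le> n \<Longrightarrow> (2 ^ n) ^ CARD('d) * \<Lambda> j (indicator {x. \<forall>i<M n. b n i x \<noteq> 1}) \<le> \<eta> n"
    and gap': "j \<le> n \<Longrightarrow> \<Lambda> j (indicator {x. \<forall>i<M n. b n i x \<noteq> 1}) \<le> 1 / 2 ^ (n + 2)"
    and piece_small: "j \<le> n \<Longrightarrow> i < M n \<Longrightarrow> \<Lambda> j (indicator {x. b n i x = 1}) \<le> \<mu> n"
    and finite_T: "finite (T n)"
    and prob_small: "real (Suc n * (1 + (\<Sum>k<n. M k)) * card (T n)) * (((2 ^ Suc n) ^ CARD('d))\<^sup>2 * \<mu> n / (\<eta> n)\<^sup>2) \<le> (1 / 2) ^ n"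
    and net: "norm y \<le> real (Suc n) \<Longrightarrow> \<exists>y'\<in>T n. \<forall>v. \<bar>kern n (y - v) - kern n (y' - v)\<bar> \<le> \<eta> n / 2 \<and>
       \<bar>kern (Suc n) (y - v) - kern (Suc n) (y' - v)\<bar> \<le> \<eta> n / 2"
    and \<delta>_pos: "0 < \<delta> n" and \<delta>_le: "\<delta> n \<le> (1 / 2) ^ n"
    and \<delta>_small: "(2 ^ (n + 2)) ^ CARD('d) * \<delta> n powr (1 / (n + 1)) \<le> 1"
    and \<eta>_pos: "0 < \<eta> n" and \<eta>_half: "2 * \<eta> (Suc n) \<le> \<eta> n"
    and \<eta>_small: "6 * \<eta> (Suc n) * M n \<le> \<delta> n ^ n"
    and T0: "finite (T0 n)" "T0 n \<subseteq> cball 0 (real n)"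
       "norm y \<le> real n \<Longrightarrow> \<exists>t\<in>T0 n. norm (t - y) \<le> 1 / 2 ^ Suc n"
    and \<eta>_T0: "card (T0 n) * (48 * \<eta> n) \<le> (1 / 2) ^ CARD('d)"
begin

sublocale mean "U j" "\<Lambda> j" for j by (rule mean)

lemma b_cont: "continuous_on A (b n i)" and b_nonneg: "0 \<le> b n i x" and b_sum: "(\<Sum>i<M n. b n i x) \<le> 1"
  using bump[of n] continuous_on_subset[of UNIV "b n i" A] by (auto simp: bump_family_def)

definition step :: "nat \<Rightarrow> 'd rolls \<Rightarrow> 'a \<Rightarrow> real ^ 'd" where
  "step n w x = (1 / 2 ^ Suc n) *\<^sub>R (\<Sum>i<M n. b n i x *\<^sub>R spin_vec (w (n, i)))"

definition field :: "'d rolls \<Rightarrow> 'a \<Rightarrow> real ^ 'd" where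
  "field w x = (\<Sum>n. step n w x)"

definition partial :: "nat \<Rightarrow> 'd rolls \<Rightarrow> 'a \<Rightarrow> real ^ 'd" where
  "partial n w x = (\<Sum>k<n. step k w x)"

lemma norm_step: "norm (step n w x) \<le> CARD('d) / 2 ^ Suc n"
proof -
  have "norm (\<Sum>i<M n. b n i x *\<^sub>R (spin_vec (w (n, i)) :: real ^ 'd)) \<le> (\<Sum>i<M n. b n i x * CARD('d))"
    by (intro order_trans[OF norm_sum] sum_mono) (simp add: b_nonneg mult_left_mono norm_spin_vec)
  also have "\<dots> \<le> 1 * real CARD('d)"
    unfolding sum_distrib_right[symmetric] by (intro mult_right_mono b_sum) auto
  finally show ?thesis by (simp add: step_def divide_right_mono)
qed

lemma summable_bound: "summable (\<lambda>n. CARD('d) / 2 ^ Suc n :: real)"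
  using summable_mult[OF summable_geometric[of "1 / 2 :: real"], of "CARD('d) / 2"]
  by (simp add: power_one_over field_simps)

lemma summable_step: "summable (\<lambda>n. step n w x)"
  by (rule summable_comparison_test'[OF summable_bound norm_step])

lemma norm_tail: "norm (field w x - partial n w x) \<le> CARD('d) / 2 ^ n"
proof -
  have *: "(\<lambda>k. CARD('d) / 2 ^ Suc (k + n) :: real) sums (CARD('d) / 2 ^ n)"
  proof -
    have "CARD('d) / 2 ^ n * (1 / 2) ^ Suc k = (CARD('d) / 2 ^ Suc (k + n) :: real)" for k
      by (simp add: power_add power_divide)
    then show ?thesis using sums_mult[OF power_half_series, of "CARD('d) / 2 ^ n"] by simp
  qed
  have "field w x - partial n w x = (\<Sum>k. step (k + n) w x)"
    unfolding field_def partial_def by (subst suminf_minus_initial_segment[OF summable_step]) simp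
  also have "norm \<dots> \<le> (\<Sum>k. CARD('d) / 2 ^ Suc (k + n) :: real)"
    by (rule norm_suminf_le[OF norm_step sums_summable[OF *]])
  finally show ?thesis using sums_unique[OF *] by simp
qed

lemma norm_partial: "norm (partial n w x) \<le> CARD('d)"
proof -
  have "norm (partial n w x) \<le> (\<Sum>k<n. CARD('d) / 2 ^ Suc k)"
    unfolding partial_def by (intro order_trans[OF norm_sum] sum_mono norm_step)
  also have "\<dots> = CARD('d) * (1 - 1 / 2 ^ n)"
    by (induction n) (auto simp: field_simps)
  also have "\<dots> \<le> real CARD('d) * 1" by (intro mult_left_mono) auto
  finally show ?thesis by simp
qed

lemma continuous_partial: "continuous_on A (partial n w)"
  unfolding partial_def step_def by (intro continuous_intros b_cont)

lemma uniform_limit_field: "uniform_limit A (\<lambda>n. partial n w) (field w) sequentially"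
  unfolding uniform_limit_iff
proof (intro allI impI)
  fix e :: real assume "0 < e"
  have "(\<lambda>n. CARD('d) / 2 ^ n :: real) \<longlonglongrightarrow> 0"
    by (rule LIMSEQ_divide_realpow_zero) simp
  then have "\<forall>\<^sub>F n in sequentially. CARD('d) / 2 ^ n < e" using \<open>0 < e\<close> by (rule order_tendstoD)
  then show "\<forall>\<^sub>F n in sequentially. \<forall>x\<in>A. dist (partial n w x) (field w x) < e"
    by eventually_elim (auto simp: dist_norm norm_minus_commute intro: le_less_trans[OF norm_tail])
qed

lemma continuous_field: "continuous_on A (field w)"
  by (rule uniform_limit_theorem[OF _ uniform_limit_field]) (auto simp: continuous_partial)

definition piece :: "nat \<Rightarrow> nat \<Rightarrow> 'a set" where
  "piece n i = {x. b n i x = 1}"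

text \<open>The levels start at \<open>j\<close> because level \<open>k\<close> controls the gaps
  only for the means of index at most \<open>k\<close>; each level thus serves finitely many
  means.\<close>

definition good :: "nat \<Rightarrow> nat \<Rightarrow> 'a set" where
  "good j n = {x. \<forall>k. j \<le> k \<and> k < n \<longrightarrow> (\<exists>i<M k. b k i x = 1)}"

lemma b_eq_0: 
  assumes "x \<in> piece n i" "i < M n" "k < M n" "k \<noteq> i"
  shows "b n k x = 0"
proof -
  have "b n i x + b n k x = (\<Sum>l\<in>{i, k}. b n l x)" using assms by simp
  also have "\<dots> \<le> (\<Sum>l<M n. b n l x)" using assms by (intro sum_mono2) (auto simp: b_nonneg)
  finally show ?thesis using b_sum[of n x] b_nonneg[of n k x] assms(1) by (simp add: piece_def)
qed

lemma disjoint_pieces: "disjoint_family_on (piece n) {..<M n}"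
proof -
  have "piece n i \<inter> piece n k = {}" if "i < M n" "k < M n" "i \<noteq> k" for i k
    using b_eq_0[of _ n i k] that by (auto simp: piece_def)
  then show ?thesis by (auto simp: disjoint_family_on_def)
qed

lemma step_on_piece:
  assumes "x \<in> piece n i" "i < M n"
  shows "step n w x = (1 / 2 ^ Suc n) *\<^sub>R spin_vec (w (n, i))"
proof -
  have "(\<Sum>k<M n. b n k x *\<^sub>R spin_vec (w (n, k))) = (\<Sum>k<M n. if k = i then (spin_vec (w (n, i)) :: real ^ 'd) else 0)"
    using b_eq_0[OF assms] assms by (intro sum.cong) (auto simp: piece_def)
  then show ?thesis using assms(2) by (simp add: step_def)
qed

lemma partial_cong:
  assumes "\<And>k i. k < n \<Longrightarrow> i < M k \<Longrightarrow> w (k, i) = w' (k, i)"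
  shows "partial n w x = partial n w' x"
  unfolding partial_def step_def using assms by (intro sum.cong refl) (auto intro!: sum.cong)

lemma good_Suc: "j \<le> n \<Longrightarrow> good j (Suc n) = good j n \<inter> (\<Union>i<M n. piece n i)"
  by (auto simp: good_def piece_def less_Suc_eq)

section \<open>Occupation densities for a fixed map\<close>

context
  fixes f :: "'a \<Rightarrow> real ^ 'd"
begin

text \<open>\<open>kern n\<close> approximates a point mass, so this is roughly the
  \<open>\<Lambda> j\<close>-mass of the part of \<open>Q\<close> mapped into a window of size
  \<open>1 / 2 ^ n\<close> at \<open>y\<close>, divided by the volume of the window.\<close>

definition dens :: "nat \<Rightarrow> nat \<Rightarrow> 'a set \<Rightarrow> real ^ 'd \<Rightarrow> 'd rolls \<Rightarrow> real" where
  "dens j n Q y w = \<Lambda> j (\<lambda>x. indicator (Q \<inter> good j n) x * kern n (y - (f x + partial n w x)))"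

text \<open>The martingale difference contributed by piece \<open>i\<close>, on which the step of
  level \<open>n\<close> is a single vector determined by roll \<open>(n, i)\<close>.\<close>

definition fluct :: "nat \<Rightarrow> nat \<Rightarrow> 'a set \<Rightarrow> real ^ 'd \<Rightarrow> nat \<Rightarrow> 'd rolls \<Rightarrow> real" where
  "fluct j n Q y i w = \<Lambda> j (\<lambda>x. indicator (Q \<inter> good j n \<inter> piece n i) x *
     (kern (Suc n) (y - (f x + partial n w x) - (1 / 2 ^ Suc n) *\<^sub>R spin_vec (w (n, i))) - kern n (y - (f x + partial n w x))))"

lemma bounded_kern: "bounded_fun_on A (\<lambda>x. indicator (B x) (g x) * kern n (h x :: real ^ 'd))"
  by (rule bounded_fun_onI[where B = "(2 ^ n) ^ CARD('d)"])
     (simp add: indicator_def kern_nonneg kern_le)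

lemma kern_Suc_diff_le: "\<bar>kern (Suc n) (u :: real ^ 'd) - kern n (v :: real ^ 'd)\<bar> \<le> (2 ^ Suc n) ^ CARD('d)"
proof -
  have "((2 :: real) ^ n) ^ CARD('d) \<le> (2 ^ Suc n) ^ CARD('d)" by (intro power_mono) auto
  with kern_le[of n v] kern_le[of "Suc n" u] kern_nonneg[of n v] kern_nonneg[of "Suc n" u]
  show ?thesis by linarith
qed

lemma bounded_kern_diff:
  "bounded_fun_on A (\<lambda>x. indicator B x * (kern (Suc n) (h x :: real ^ 'd) - kern n (h' x :: real ^ 'd)))"
  by (rule bounded_fun_onI[where B = "(2 ^ Suc n) ^ CARD('d)"])
     (use kern_Suc_diff_le in \<open>auto simp: indicator_def\<close>)

lemma dens_le: "dens j n Q y w \<le> (2 ^ n) ^ CARD('d) * \<Lambda> j (indicator Q)"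
proof -
  have "dens j n Q y w \<le> \<Lambda> j (\<lambda>x. (2 ^ n) ^ CARD('d) * indicator Q x)"
    unfolding dens_def
    by (rule mono[OF bounded_kern bounded_fun_on_cmult[OF bounded_fun_on_indicator]])
       (auto simp: indicator_def kern_le)
  then show ?thesis using scale[of j "indicator Q" "(2 ^ n) ^ CARD('d)"] by simp
qed

lemma dens_UN_le:
  assumes "finite I" and sub: "\<And>x. x \<in> U j \<Longrightarrow> x \<in> Q \<Longrightarrow> x \<in> good j n \<Longrightarrow>
    kern n (y - (f x + partial n w x)) \<noteq> 0 \<Longrightarrow> \<exists>i\<in>I. x \<in> P i"
  shows "dens j n Q y w \<le> (\<Sum>i\<in>I. dens j n (P i) y w)"
proof -
  have "dens j n Q y w \<le> \<Lambda> j (\<lambda>x. \<Sum>i\<in>I. indicator (P i \<inter> good j n) x * kern n (y - (f x + partial n w x)))"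
    unfolding dens_def
  proof (rule mono[OF bounded_kern bounded_fun_on_sum[OF bounded_kern]])
    fix x assume "x \<in> U j"
    let ?k = "kern n (y - (f x + partial n w x))"
    show "indicator (Q \<inter> good j n) x * ?k \<le> (\<Sum>i\<in>I. indicator (P i \<inter> good j n) x * ?k)"
    proof (cases "x \<in> Q \<inter> good j n \<and> ?k \<noteq> 0")
      case True
      then obtain i where i: "i \<in> I" "x \<in> P i" using sub[OF \<open>x \<in> U j\<close>] by blast
      have "indicator (P i \<inter> good j n) x * ?k \<le> (\<Sum>i\<in>I. indicator (P i \<inter> good j n) x * ?k)"
        using assms(1) i by (intro member_le_sum) (auto simp: kern_nonneg)
      then show ?thesis using True i by simp
    next
      case False
      then show ?thesis by (auto simp: indicator_def kern_nonneg intro!: sum_nonneg)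
    qed
  qed
  also have "\<dots> = (\<Sum>i\<in>I. dens j n (P i) y w)"
    unfolding dens_def by (rule sum) (rule bounded_kern)
  finally show ?thesis .
qed

text \<open>Halfway between two levels: the new gaps are already removed, but the kernel is still
  the old one. This separates the loss in the gaps from the random fluctuation.\<close>

definition carried :: "nat \<Rightarrow> nat \<Rightarrow> 'a set \<Rightarrow> real ^ 'd \<Rightarrow> 'd rolls \<Rightarrow> real" where
  "carried j n Q y w = \<Lambda> j (\<lambda>x. indicator (Q \<inter> good j (Suc n)) x * kern n (y - (f x + partial n w x)))"

lemma sum_fluct:
  assumes "j \<le> n"
  shows "(\<Sum>i<M n. fluct j n Q y i w) = dens j (Suc n) Q y w - carried j n Q y w"
proof -
  have "(\<Sum>i<M n. fluct j n Q y i w) = \<Lambda> j (\<lambda>x. \<Sum>i<M n. indicator (Q \<inter> good j n \<inter> piece n i) x *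
     (kern (Suc n) (y - (f x + partial n w x) - (1 / 2 ^ Suc n) *\<^sub>R spin_vec (w (n, i))) - kern n (y - (f x + partial n w x))))"
    unfolding fluct_def by (rule sum[symmetric]) (rule bounded_kern_diff)
  also have "\<dots> = \<Lambda> j (\<lambda>x. indicator (Q \<inter> good j (Suc n)) x * kern (Suc n) (y - (f x + partial (Suc n) w x)) -
      indicator (Q \<inter> good j (Suc n)) x * kern n (y - (f x + partial n w x)))"
  proof (rule cong)
    fix x
    let ?t = "\<lambda>i. indicator (Q \<inter> good j n \<inter> piece n i) x *
      (kern (Suc n) (y - (f x + partial n w x) - (1 / 2 ^ Suc n) *\<^sub>R spin_vec (w (n, i))) - kern n (y - (f x + partial n w x)))"
    show "(\<Sum>i<M n. ?t i) =
      indicator (Q \<inter> good j (Suc n)) x * kern (Suc n) (y - (f x + partial (Suc n) w x)) -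
      indicator (Q \<inter> good j (Suc n)) x * kern n (y - (f x + partial n w x))"
    proof (cases "\<exists>i<M n. x \<in> piece n i")
      case True
      then obtain i where i: "i < M n" "x \<in> piece n i" by blast
      have "x \<notin> piece n k" if "k < M n" "k \<noteq> i" for k
        using b_eq_0[OF i(2,1) that] by (simp add: piece_def)
      then have "(\<Sum>k<M n. ?t k) = (\<Sum>k<M n. if k = i then ?t i else 0)"
        by (intro sum.cong) auto
      also have "\<dots> = ?t i" using i by simp
      finally show ?thesis
        using i step_on_piece[OF i(2,1), of w] good_Suc[OF assms]
        by (auto simp: partial_def indicator_def diff_diff_eq add.assoc)
    qed (auto simp: good_Suc[OF assms])
  qed (intro bounded_fun_on_sum bounded_kern_diff)
  also have "\<dots> = dens j (Suc n) Q y w - carried j n Q y w"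
    unfolding dens_def carried_def by (intro diff bounded_kern)
  finally show ?thesis .
qed

lemma carried_diff:
  assumes "j \<le> n"
  shows "\<bar>carried j n Q y w - dens j n Q y w\<bar> \<le> \<eta> n"
proof -
  let ?bad = "{x. \<forall>i<M n. b n i x \<noteq> 1}"
  have "\<bar>carried j n Q y w - dens j n Q y w\<bar> \<le> \<Lambda> j (\<lambda>x. (2 ^ n) ^ CARD('d) * indicator ?bad x)"
    unfolding carried_def dens_def
    by (subst diff[symmetric, OF bounded_kern bounded_kern],
        rule abs_le[OF bounded_fun_on_diff[OF bounded_kern bounded_kern]
          bounded_fun_on_cmult[OF bounded_fun_on_indicator]])
       (auto simp: good_Suc[OF assms] piece_def indicator_def kern_nonneg kern_le)
  also have "\<dots> = (2 ^ n) ^ CARD('d) * \<Lambda> j (indicator ?bad)"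
    using scale[of j "indicator ?bad" "(2 ^ n) ^ CARD('d)"] by simp
  also have "\<dots> \<le> \<eta> n" by (rule gap[OF assms])
  finally show ?thesis .
qed

lemma fluct_dep:
  assumes "\<forall>p\<in>Sigma {..n} (\<lambda>k. {..<M k}). w p = w' p" "i < M n"
  shows "fluct j n Q y i w = fluct j n Q y i w'"
proof -
  have "partial n w x = partial n w' x" for x
    by (rule partial_cong) (use assms in auto)
  moreover have "w (n, i) = w' (n, i)" using assms by auto
  ultimately show ?thesis by (simp add: fluct_def)
qed

lemma fluct_bound:
  "\<bar>fluct j n Q y i w\<bar> \<le> (2 ^ Suc n) ^ CARD('d) * \<Lambda> j (indicator (piece n i))"
proof -
  have "\<bar>fluct j n Q y i w\<bar> \<le> \<Lambda> j (\<lambda>x. (2 ^ Suc n) ^ CARD('d) * indicator (piece n i) x)"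
    unfolding fluct_def
    by (rule abs_le[OF bounded_kern_diff bounded_fun_on_cmult[OF bounded_fun_on_indicator]])
       (use kern_Suc_diff_le in \<open>auto simp: indicator_def\<close>)
  then show ?thesis using scale[of j "indicator (piece n i)" "(2 ^ Suc n) ^ CARD('d)"] by simp
qed

lemma partial_upd: "partial n (w((n, i) := a)) = partial n w"
  by (rule ext, rule partial_cong) auto

text \<open>\<open>partial n\<close> does not see roll \<open>(n, i)\<close>, so
  \<open>kern_refine\<close> applies at each point separately, whatever the value of
  \<open>f\<close> there.\<close>

lemma fluct_centered: "(\<Sum>a\<in>UNIV. fluct j n Q y i (w((n, i) := a))) = 0"
proof -
  let ?u = "\<lambda>x. y - (f x + partial n w x)"
  have "(\<Sum>a\<in>UNIV. fluct j n Q y i (w((n, i) := a))) =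
    \<Lambda> j (\<lambda>x. \<Sum>a\<in>UNIV. indicator (Q \<inter> good j n \<inter> piece n i) x *
      (kern (Suc n) (?u x - (1 / 2 ^ Suc n) *\<^sub>R spin_vec a) - kern n (?u x)))"
    unfolding fluct_def partial_upd fun_upd_same by (rule sum[symmetric]) (rule bounded_kern_diff)
  also have "(\<lambda>x. \<Sum>a\<in>UNIV. indicator (Q \<inter> good j n \<inter> piece n i) x *
      (kern (Suc n) (?u x - (1 / 2 ^ Suc n) *\<^sub>R spin_vec a) - kern n (?u x))) = (\<lambda>x. 0)"
    by (rule ext) (simp add: sum_subtractf kern_refine del: power_Suc flip: sum_distrib_left)
  finally show ?thesis unfolding zero .
qed

text \<open>The variance is at most the squared kernel bound times the sum of the squared piece
  masses. These masses are at most \<open>\<mu> n\<close> and add up to at most 1, which leaves one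
  factor \<open>\<mu> n\<close>. The bound involves neither \<open>f\<close> nor \<open>Q\<close>
  nor \<open>y\<close>.\<close>

lemma fluct_deviation:
  assumes "j \<le> n"
  shows "measure dice {w. \<eta> n \<le> \<bar>\<Sum>i<M n. fluct j n Q y i w\<bar>} \<le> ((2 ^ Suc n) ^ CARD('d))\<^sup>2 * \<mu> n / (\<eta> n)\<^sup>2"
proof -
  let ?m = "\<lambda>i. (2 ^ Suc n) ^ CARD('d) * \<Lambda> j (indicator (piece n i))"
  have "measure dice {w. \<eta> n \<le> \<bar>\<Sum>i<M n. fluct j n Q y i w\<bar>} \<le> (\<Sum>i<M n. (?m i)\<^sup>2) / (\<eta> n)\<^sup>2"
  proof (rule orthogonal_deviation[where c = "\<lambda>i. (n, i)"])
    show "fluct j n Q y i \<in> borel_measurable dice" if "i \<in> {..<M n}" for i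
      by (rule dice_measurable[of "Sigma {..n} (\<lambda>k. {..<M k})"]) (use that fluct_dep in auto)
    show "fluct j n Q y l (w((n, k) := a)) = fluct j n Q y l w" if "k \<noteq> l" for k l w a
      using that by (simp add: fluct_def partial_upd)
  qed (use fluct_bound fluct_centered \<eta>_pos in auto)
  also have "(\<Sum>i<M n. (?m i)\<^sup>2) \<le> ((2 ^ Suc n) ^ CARD('d))\<^sup>2 * \<mu> n"
  proof -
    have "(\<Sum>i<M n. (\<Lambda> j (indicator (piece n i)))\<^sup>2) \<le> (\<Sum>i<M n. \<mu> n * \<Lambda> j (indicator (piece n i)))"
      unfolding power2_eq_square piece_def
      by (intro sum_mono mult_right_mono piece_small[OF assms] indicator_nonneg) auto
    also have "\<dots> = \<mu> n * (\<Sum>i<M n. \<Lambda> j (indicator (piece n i)))" by (simp add: sum_distrib_left)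
    also have "\<dots> \<le> \<mu> n"
    \<comment> \<open>Without pieces the gap would carry the whole mass 1, against
      \<open>gap'\<close>. If there is a piece, its mass shows that \<open>\<mu> n\<close> is
      nonnegative.\<close>
    proof (cases "M n = 0")
      case True
      show ?thesis
      proof (rule ccontr)
        assume "\<not> ?thesis"
        have "j \<le> n \<Longrightarrow> \<Lambda> j (indicator UNIV) \<le> 1 / 2 ^ (n + 2)" using gap'[of j n] True by simp
        moreover have "\<Lambda> j (indicator UNIV) = 1" using one[of j] by (simp add: indicator_def)
        moreover have "1 / 2 ^ (n + 2) < (1 :: real)" using one_less_power[of "2 :: real" "n + 2"] by simp
        ultimately show False using assms by simp
      qed
    next
      case False
      have "0 \<le> \<mu> n"
        using order_trans[OF indicator_nonneg piece_small[OF assms, of 0]] False by simp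
      then show ?thesis by (intro mult_left_le sum_disjoint_le_1 disjoint_pieces) auto
    qed
    finally have "(\<Sum>i<M n. (\<Lambda> j (indicator (piece n i)))\<^sup>2) \<le> \<mu> n" .
    then have "((2 ^ Suc n) ^ CARD('d))\<^sup>2 * (\<Sum>i<M n. (\<Lambda> j (indicator (piece n i)))\<^sup>2) \<le> ((2 ^ Suc n) ^ CARD('d))\<^sup>2 * \<mu> n"
      by (rule mult_left_mono) simp
    then show ?thesis by (simp add: power_mult_distrib sum_distrib_left)
  qed
  finally show ?thesis by (simp add: divide_right_mono)
qed

text \<open>\<open>UNIV\<close> serves the lower bound for the total density; the pieces of earlier
  levels serve the upper bound on small balls.\<close>

definition tests :: "nat \<Rightarrow> 'a set set" where
  "tests n = insert UNIV ((\<lambda>(k, i). piece k i) ` Sigma {..<n} (\<lambda>k. {..<M k}))"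

lemma finite_tests: "finite (tests n)" and card_tests: "card (tests n) \<le> 1 + (\<Sum>k<n. M k)"
proof -
  let ?S = "Sigma {..<n} (\<lambda>k. {..<M k})"
  show "finite (tests n)" by (simp add: tests_def)
  have "card (tests n) \<le> Suc (card ((\<lambda>(k, i). piece k i) ` ?S))" unfolding tests_def by (rule card_insert_le_m1) auto
  also have "\<dots> \<le> Suc (card ?S)" by (intro Suc_le_mono[THEN iffD2] card_image_le) auto
  finally show "card (tests n) \<le> 1 + (\<Sum>k<n. M k)" by simp
qed

definition bad_event :: "nat \<Rightarrow> 'd rolls set" where
  "bad_event n = (\<Union>(j, Q, y)\<in>{..n} \<times> tests n \<times> T n. {w. \<eta> n \<le> \<bar>\<Sum>i<M n. fluct j n Q y i w\<bar>})"

lemma sets_fluct: "{w. \<eta> n \<le> \<bar>\<Sum>i<M n. fluct j n Q y i w\<bar>} \<in> sets dice"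
proof -
  have "{w. (\<Sum>i<M n. fluct j n Q y i w) \<in> {t. \<eta> n \<le> \<bar>t\<bar>}} \<in> sets dice"
    by (rule dice_cylinder[of "Sigma {..n} (\<lambda>k. {..<M k})"])
       (auto intro!: sum.cong fluct_dep)
  then show ?thesis by simp
qed

lemma sets_bad_event: "bad_event n \<in> sets dice"
  unfolding bad_event_def by (intro sets.finite_UN) (auto simp: finite_tests finite_T sets_fluct)

lemma measure_bad_event: "measure dice (bad_event n) \<le> (1 / 2) ^ n"
proof -
  interpret D: prob_space "dice :: 'd rolls measure" by (rule prob_space_dice)
  let ?I = "{..n} \<times> tests n \<times> T n"
  let ?p = "((2 ^ Suc n) ^ CARD('d))\<^sup>2 * \<mu> n / (\<eta> n)\<^sup>2"
  have "measure dice (bad_event n) \<le> (\<Sum>(j, Q, y)\<in>?I. measure dice {w. \<eta> n \<le> \<bar>\<Sum>i<M n. fluct j n Q y i w\<bar>})"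
    unfolding bad_event_def case_prod_unfold
    by (rule D.finite_measure_subadditive_finite) (auto simp: finite_tests finite_T sets_fluct)
  also have "\<dots> \<le> (\<Sum>q\<in>?I. ?p)" 
    by (intro sum_mono) (auto intro: fluct_deviation simp del: power_Suc)
  also have "\<dots> = real (card ?I) * ?p" by simp
  also have "\<dots> \<le> real (Suc n * (1 + (\<Sum>k<n. M k)) * card (T n)) * ?p"
  proof (intro mult_right_mono of_nat_mono)
    have "card ?I = Suc n * card (tests n) * card (T n)"
      by (simp add: card_cartesian_product mult.assoc del: mult_Suc)
    also have "\<dots> \<le> Suc n * (1 + (\<Sum>k<n. M k)) * card (T n)"
      by (intro mult_le_mono card_tests le_refl)
    finally show "card ?I \<le> Suc n * (1 + (\<Sum>k<n. M k)) * card (T n)" .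
    have "0 \<le> measure dice {w. \<eta> n \<le> \<bar>\<Sum>i<M n. fluct 0 n UNIV 0 i w\<bar>}" by simp
    also have "\<dots> \<le> ?p" by (rule fluct_deviation) simp
    finally show "0 \<le> ?p" .
  qed
  also have "\<dots> \<le> (1 / 2) ^ n" by (rule prob_small)
  finally show ?thesis .
qed

text \<open>Borel-Cantelli. The exceptional null set depends on \<open>f\<close>, which prevalence
  allows.\<close>

lemma AE_eventually_good: "AE w in dice. \<forall>\<^sub>F n in sequentially. w \<notin> bad_event n"
proof -
  interpret D: prob_space "dice :: 'd rolls measure" by (rule prob_space_dice)
  have "summable (\<lambda>n. measure dice (bad_event n))"
    by (rule summable_comparison_test'[OF summable_geometric[of "1 / 2 :: real"], of 0])
       (auto simp: measure_bad_event)
  then have "AE w in dice. \<forall>\<^sub>F n in sequentially. w \<in> space dice - bad_event n"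
    by (intro borel_cantelli_AE1 sets_bad_event) (auto simp: D.emeasure_finite less_top[symmetric])
  then show ?thesis by simp
qed

end

end

section \<open>From densities to fibres\<close>

text \<open>Off \<open>W\<close> the distance of \<open>F\<close> to \<open>y\<close> has a positive
  minimum. Hence an open cover of a fibre still works for nearby maps; this serves both the
  truncations of the field and openness in the space of maps.\<close>

lemma compact_fibre_gap:
  fixes F :: "'a::metric_space \<Rightarrow> 'b::real_normed_vector"
  assumes "compact Z" "continuous_on Z F" "open W" and sub: "{x \<in> Z. F x = y} \<subseteq> W"
  obtains e where "0 < e" "\<And>x. x \<in> Z - W \<Longrightarrow> e \<le> norm (F x - y)"
proof (cases "Z - W = {}")
  case True
  then show thesis by (intro that[of 1]) auto
next
  case False
  have comp: "compact (Z - W)" by (rule compact_diff[OF assms(1,3)])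
  have cont: "continuous_on (Z - W) (\<lambda>x. norm (F x - y))"
    using continuous_on_subset[OF assms(2), of "Z - W"] by (intro continuous_intros) auto
  obtain x0 where x0: "x0 \<in> Z - W" "\<forall>x\<in>Z - W. norm (F x0 - y) \<le> norm (F x - y)"
    using continuous_attains_inf[OF comp False cont] by blast
  moreover have "F x0 \<noteq> y" using x0(1) sub by blast
  ultimately show thesis by (intro that[of "norm (F x0 - y)"]) auto
qed

context random_field
begin

lemma power_\<delta>_le:
  assumes "s j \<le> real n" "\<delta> n \<le> r"
  shows "\<delta> n ^ n \<le> r powr s j"
proof -
  have "\<delta> n \<le> 1" using \<delta>_le[of n] power_le_one[of "1 / 2 :: real" n] by linarith
  have "\<delta> n ^ n = \<delta> n powr real n" using \<delta>_pos[of n] by (simp add: powr_realpow)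
  also have "\<dots> \<le> \<delta> n powr s j" using \<delta>_pos[of n] \<open>\<delta> n \<le> 1\<close> assms(1) by (intro powr_mono') auto
  also have "\<dots> \<le> r powr s j" using \<delta>_pos[of n] assms(2) s_pos[of j] by (intro powr_mono2) auto
  finally show ?thesis .
qed

lemma \<delta>_tendsto_0: "\<delta> \<longlonglongrightarrow> 0"
proof (rule tendsto_sandwich)
  show "\<forall>\<^sub>F n in sequentially. 0 \<le> \<delta> n"
    by (intro always_eventually allI less_imp_le \<delta>_pos)
  show "\<forall>\<^sub>F n in sequentially. \<delta> n \<le> (1 / 2) ^ n" using \<delta>_le by auto
qed (auto intro: LIMSEQ_power_zero)

text \<open>The numbers \<open>\<delta> n\<close> decay without a controlled ratio, so a radius can
  only be located between two consecutive scales.\<close>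

lemma find_scale:
  assumes "0 < r" "r < \<delta> N1"
  obtains N where "N1 \<le> N" "\<delta> (Suc N) \<le> r" "r < \<delta> N"
proof -
  have "\<forall>\<^sub>F n in sequentially. \<delta> n < r" using \<delta>_tendsto_0 assms(1) by (rule order_tendstoD)
  then obtain n0 where "\<And>n. n \<ge> n0 \<Longrightarrow> \<delta> n < r" by (auto simp: eventually_sequentially)
  then have ex: "\<exists>n. N1 \<le> n \<and> \<delta> (Suc n) \<le> r" by (intro exI[of _ "max n0 N1"]) (auto intro: less_imp_le)
  define N where "N = (LEAST n. N1 \<le> n \<and> \<delta> (Suc n) \<le> r)"
  have N: "N1 \<le> N" "\<delta> (Suc N) \<le> r" using LeastI_ex[OF ex] by (auto simp: N_def)
  have "r < \<delta> N"
  proof (cases "N = N1")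
    case False
    then obtain N' where "N = Suc N'" "N1 \<le> N'" using N(1) by (cases N) auto
    then show ?thesis using not_less_Least[of N' "\<lambda>n. N1 \<le> n \<and> \<delta> (Suc n) \<le> r"] by (auto simp: N_def)
  qed (use assms in simp)
  with N show thesis by (rule that)
qed

lemma good_mass:
  assumes "j \<le> n"
  shows "1 / 2 \<le> \<Lambda> j (indicator (good j n))"
proof -
  let ?bad = "\<lambda>k. {x. \<forall>i<M k. b k i x \<noteq> 1}"
  have "\<Lambda> j (indicator (- good j n)) \<le> (\<Sum>k\<in>{j..<n}. \<Lambda> j (indicator (?bad k)))"
    by (rule indicator_UN_le) (auto simp: good_def)
  also have "\<dots> \<le> (\<Sum>k\<in>{j..<n}. 1 / 2 ^ (k + 2))" by (intro sum_mono gap') auto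
  also have "\<dots> \<le> (\<Sum>k<n. 1 / 2 ^ (k + 2))" by (intro sum_mono2) auto
  also have "\<dots> = 1 / 2 - 1 / 2 ^ Suc n" by (induction n) (auto simp: field_simps)
  also have "\<dots> \<le> 1 / 2" by simp
  finally have "\<Lambda> j (indicator (- good j n)) \<le> 1 / 2" .
  moreover have "\<Lambda> j (\<lambda>x. indicator (good j n) x + indicator (- good j n) x) = \<Lambda> j (\<lambda>x. 1)"
    by (rule cong[OF bounded_fun_on_add[OF bounded_fun_on_indicator bounded_fun_on_indicator]])
       (auto simp: indicator_def)
  then have "\<Lambda> j (indicator (good j n)) + \<Lambda> j (indicator (- good j n)) = 1"
    using add[of j "indicator (good j n)" "indicator (- good j n)"] one[of j] by simp
  ultimately show ?thesis by linarith
qed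

context
  fixes f :: "'a \<Rightarrow> real ^ 'd" and w :: "'d rolls"
begin

lemma dens_Suc_diff:
  assumes "j \<le> n" "w \<notin> bad_event f n" "norm y \<le> real (Suc n)" "Q \<in> tests n"
  shows "\<bar>dens f j (Suc n) Q y w - dens f j n Q y w\<bar> \<le> 3 * \<eta> n"
proof -
  obtain y' where y': "y' \<in> T n" and
    ker: "\<And>v. \<bar>kern n (y - v) - kern n (y' - v)\<bar> \<le> \<eta> n / 2"
    "\<And>v. \<bar>kern (Suc n) (y - v) - kern (Suc n) (y' - v)\<bar> \<le> \<eta> n / 2"
    using net[OF assms(3)] by blast
  have \<eta>2: "0 \<le> \<eta> n / 2" using \<eta>_pos[of n] by simp
  have 1: "\<bar>dens f j (Suc n) Q y w - dens f j (Suc n) Q y' w\<bar> \<le> \<eta> n / 2"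
    unfolding dens_def
    by (rule abs_diff_le[OF bounded_kern bounded_kern]) (use ker(2) \<eta>2 in \<open>auto simp: indicator_def\<close>)
  have 2: "\<bar>carried f j n Q y w - carried f j n Q y' w\<bar> \<le> \<eta> n / 2"
    unfolding carried_def
    by (rule abs_diff_le[OF bounded_kern bounded_kern]) (use ker(1) \<eta>2 in \<open>auto simp: indicator_def\<close>)
  have 3: "\<bar>dens f j (Suc n) Q y' w - carried f j n Q y' w\<bar> < \<eta> n"
    using assms(1,2,4) y' unfolding bad_event_def
    by (auto simp: not_le simp flip: sum_fluct[OF assms(1)])
  \<comment> \<open>Budget: two moves to the net point at \<open>\<eta> n / 2\<close> each, one
    fluctuation and one gap loss at \<open>\<eta> n\<close> each.\<close>
  show ?thesis using 1 2 3 carried_diff[OF assms(1), of f Q y w] by linarith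
qed

text \<open>The bound telescopes: \<open>2 * \<eta> (Suc k) \<le> \<eta> k\<close> gives
  \<open>3 * \<eta> k \<le> 6 * \<eta> k - 6 * \<eta> (Suc k)\<close>.\<close>

lemma dens_diff:
  assumes good: "\<And>k. n \<le> k \<Longrightarrow> w \<notin> bad_event f k" and "j \<le> n" "norm y \<le> real (Suc n)" "Q \<in> tests n"
  shows "\<bar>dens f j (n + m) Q y w - dens f j n Q y w\<bar> \<le> 6 * \<eta> n - 6 * \<eta> (n + m)"
proof (induction m)
  case (Suc m)
  have "tests n \<subseteq> tests (n + m)" by (auto simp: tests_def)
  then have "\<bar>dens f j (Suc (n + m)) Q y w - dens f j (n + m) Q y w\<bar> \<le> 3 * \<eta> (n + m)"
    using assms by (intro dens_Suc_diff) auto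
  with Suc \<eta>_half[of "n + m"] show ?case by simp
qed simp

lemma dens_diff_le:
  assumes good: "\<And>k. n \<le> k \<Longrightarrow> w \<notin> bad_event f k" and "j \<le> n" "norm y \<le> real (Suc n)" "Q \<in> tests n" "n \<le> m"
  shows "\<bar>dens f j m Q y w - dens f j n Q y w\<bar> \<le> 6 * \<eta> n"
  using dens_diff[OF assms(1-4), of "m - n"] \<eta>_pos[of m] assms(5) by simp

text \<open>Pieces of level \<open>N + 1\<close> are no larger than about \<open>r\<close> and are
  test sets from level \<open>N + 2\<close> on, so their densities stay within
  \<open>6 * \<eta> (N + 2)\<close> of the value at that level. There the trivial bound loses
  \<open>(2 ^ (N + 2)) ^ CARD('d)\<close>, which the surplus exponent
  \<open>\<sigma> j - s j\<close> pays for. The result is uniform in \<open>m\<close>.\<close>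

lemma dens_ball_le:
  assumes good: "\<And>k. Suc N \<le> k \<Longrightarrow> w \<notin> bad_event f k" and "j \<le> N" "norm y \<le> real N"
    and r: "\<delta> (Suc N) \<le> r" "r < \<delta> N" and exps: "1 / (real N + 1) \<le> \<sigma> j - s j" "s j \<le> real N"
    and m: "Suc (Suc N) \<le> m"
  shows "dens f j m (ball x r) y w \<le> (C j * 3 powr \<sigma> j + 1) * r powr s j"
proof -
  have r0: "0 < r" using r(1) \<delta>_pos[of "Suc N"] by linarith
  define I where "I = {i. i < M (Suc N) \<and> piece (Suc N) i \<inter> ball x r \<noteq> {}}"
  have fin: "finite I" by (simp add: I_def)
  have "dens f j m (ball x r) y w \<le> (\<Sum>i\<in>I. dens f j m (piece (Suc N) i) y w)"
  proof (rule dens_UN_le[OF fin])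
    fix u assume "u \<in> ball x r" "u \<in> good j m"
    then obtain i where "i < M (Suc N)" "u \<in> piece (Suc N) i"
      using m \<open>j \<le> N\<close> by (auto simp: good_def piece_def dest!: spec[of _ "Suc N"])
    moreover from this \<open>u \<in> ball x r\<close> have "piece (Suc N) i \<inter> ball x r \<noteq> {}" by blast
    ultimately show "\<exists>i\<in>I. u \<in> piece (Suc N) i" by (auto simp: I_def)
  qed
  also have "\<dots> \<le> (\<Sum>i\<in>I. (2 ^ Suc (Suc N)) ^ CARD('d) * \<Lambda> j (indicator (piece (Suc N) i)) + 6 * \<eta> (Suc (Suc N)))"
  proof (rule sum_mono)
    fix i assume "i \<in> I"
    then have "piece (Suc N) i \<in> tests (Suc (Suc N))" by (force simp: I_def tests_def)
    then have "\<bar>dens f j m (piece (Suc N) i) y w - dens f j (Suc (Suc N)) (piece (Suc N) i) y w\<bar> \<le> 6 * \<eta> (Suc (Suc N))"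
      using assms by (intro dens_diff_le) auto
    with dens_le[of f j "Suc (Suc N)" "piece (Suc N) i" y w]
    show "dens f j m (piece (Suc N) i) y w \<le> (2 ^ Suc (Suc N)) ^ CARD('d) * \<Lambda> j (indicator (piece (Suc N) i)) + 6 * \<eta> (Suc (Suc N))"
      by linarith
  qed
  also have "\<dots> = (2 ^ Suc (Suc N)) ^ CARD('d) * (\<Sum>i\<in>I. \<Lambda> j (indicator (piece (Suc N) i))) + card I * (6 * \<eta> (Suc (Suc N)))"
    by (simp add: sum.distrib sum_distrib_left)
  also have "\<dots> \<le> C j * 3 powr \<sigma> j * r powr s j + r powr s j"
  proof (rule add_mono)
    have sub: "piece (Suc N) i \<subseteq> ball x (3 * r)" if i: "i \<in> I" for i
    proof
      fix p assume p: "p \<in> piece (Suc N) i"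
      obtain q where q: "q \<in> piece (Suc N) i" "q \<in> ball x r" using i by (auto simp: I_def)
      obtain z where z: "{x. b (Suc N) i x \<noteq> 0} \<subseteq> ball z (\<delta> (Suc N))"
        using bump[of "Suc N"] i unfolding bump_family_def I_def by blast
      have "b (Suc N) i p \<noteq> 0" "b (Suc N) i q \<noteq> 0" using p q(1) by (auto simp: piece_def)
      then have "p \<in> ball z (\<delta> (Suc N))" "q \<in> ball z (\<delta> (Suc N))" using z by blast+
      then have "dist z p < \<delta> (Suc N)" "dist z q < \<delta> (Suc N)" by auto
      then show "p \<in> ball x (3 * r)"
        using q(2) r(1) dist_triangle[of x p q] dist_triangle[of q p z] by (simp add: dist_commute)
    qed
    have "(\<Sum>i\<in>I. \<Lambda> j (indicator (piece (Suc N) i))) = \<Lambda> j (\<lambda>u. \<Sum>i\<in>I. indicator (piece (Suc N) i) u)"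
      by (rule sum[symmetric]) auto
    also have "(\<lambda>u. \<Sum>i\<in>I. indicator (piece (Suc N) i) u) = (indicator (\<Union>i\<in>I. piece (Suc N) i) :: _ \<Rightarrow> real)"
    proof
      have "disjoint_family_on (piece (Suc N)) I"
        by (rule disjoint_family_on_mono[OF _ disjoint_pieces]) (auto simp: I_def)
      then show "(\<Sum>i\<in>I. indicator (piece (Suc N) i) u) = (indicator (\<Union>i\<in>I. piece (Suc N) i) u :: real)" for u
        by (rule indicator_UN_disjoint[OF fin, symmetric])
    qed
    also have "\<Lambda> j (indicator (\<Union>i\<in>I. piece (Suc N) i)) \<le> \<Lambda> j (indicator (ball x (3 * r)))"
      using sub by (intro indicator_subset) blast
    also have "\<dots> \<le> C j * (3 * r) powr \<sigma> j" using r0 by (intro frostman) simp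
    finally have "(2 ^ Suc (Suc N)) ^ CARD('d) * (\<Sum>i\<in>I. \<Lambda> j (indicator (piece (Suc N) i)))
        \<le> (2 ^ Suc (Suc N)) ^ CARD('d) * (C j * (3 * r) powr \<sigma> j)"
      by (rule mult_left_mono) simp
    also have "(3 * r) powr \<sigma> j = 3 powr \<sigma> j * (r powr s j * r powr (\<sigma> j - s j))"
      using r0 by (simp add: powr_mult flip: powr_add)
    also have "(2 ^ Suc (Suc N)) ^ CARD('d) * (C j * (3 powr \<sigma> j * (r powr s j * r powr (\<sigma> j - s j))))
        = C j * 3 powr \<sigma> j * r powr s j * ((2 ^ (N + 2)) ^ CARD('d) * r powr (\<sigma> j - s j))"
      by simp
    \<comment> \<open>As \<open>r < \<delta> N\<close> and the surplus exponent is at least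
      \<open>1 / (N + 1)\<close>, the condition \<open>\<delta>_small\<close> bounds exactly this
      product.\<close>
    also have "\<dots> \<le> C j * 3 powr \<sigma> j * r powr s j * 1"
    proof (rule mult_left_mono)
      have "\<delta> N \<le> 1" using \<delta>_le[of N] power_le_one[of "1 / 2 :: real" N] by linarith
      have "r powr (\<sigma> j - s j) \<le> \<delta> N powr (\<sigma> j - s j)"
        using r r0 s_less[of j] by (intro powr_mono2) auto
      also have "\<dots> \<le> \<delta> N powr (1 / (real N + 1))"
        using \<delta>_pos[of N] \<open>\<delta> N \<le> 1\<close> exps(1) by (intro powr_mono') (auto simp: add.commute)
      finally have "(2 ^ (N + 2)) ^ CARD('d) * r powr (\<sigma> j - s j) \<le> (2 ^ (N + 2)) ^ CARD('d) * \<delta> N powr (1 / (real N + 1))"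
        by (rule mult_left_mono) simp
      with \<delta>_small[of N] show "(2 ^ (N + 2)) ^ CARD('d) * r powr (\<sigma> j - s j) \<le> 1" by linarith
    qed (use C_pos[of j] in simp)
    finally show "(2 ^ Suc (Suc N)) ^ CARD('d) * (\<Sum>i\<in>I. \<Lambda> j (indicator (piece (Suc N) i))) \<le> C j * 3 powr \<sigma> j * r powr s j"
      by simp
    \<comment> \<open>The errors of at most \<open>M (Suc N)\<close> pieces are absorbed by
      \<open>\<eta>_small\<close>; the exponent in \<open>\<delta> (Suc N) ^ Suc N\<close> exceeds
      \<open>s j\<close>, so this power lies below \<open>r powr s j\<close>.\<close>
    have "card I \<le> card {..<M (Suc N)}" by (intro card_mono) (auto simp: I_def)
    then have "real (card I) * (6 * \<eta> (Suc (Suc N))) \<le> real (M (Suc N)) * (6 * \<eta> (Suc (Suc N)))"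
      using \<eta>_pos[of "Suc (Suc N)"] by (intro mult_right_mono) auto
    also have "\<dots> \<le> \<delta> (Suc N) ^ Suc N" using \<eta>_small[of "Suc N"] by (simp add: mult_ac)
    also have "\<dots> \<le> r powr s j" using exps r by (intro power_\<delta>_le) auto
    finally show "real (card I) * (6 * \<eta> (Suc (Suc N))) \<le> r powr s j" .
  qed
  finally show ?thesis by (simp add: algebra_simps)
qed

text \<open>The kernels centred at \<open>T0 n\<close> add up to at least
  \<open>(1 / 2) ^ CARD('d)\<close> at every good point of \<open>U j\<close>, so the densities at
  these centres add up to at least half of that. By \<open>\<eta>_T0\<close> one of them must be
  large.\<close>

lemma dens_large:
  assumes "j \<le> n" and bound: "\<And>x. x \<in> K \<Longrightarrow> norm (f x) + CARD('d) \<le> real n"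
  obtains t where "norm t \<le> real n" "24 * \<eta> n \<le> dens f j n UNIV t w"
proof -
  let ?k = "\<lambda>t x. kern n (t - (f x + partial n w x))"
  have ne: "T0 n \<noteq> {}" using T0(3)[of 0 n] by auto
  have "(1 / 2) ^ CARD('d) * (1 / 2) \<le> (1 / 2) ^ CARD('d) * \<Lambda> j (indicator (good j n))"
    using good_mass[OF assms(1)] by (rule mult_left_mono) simp
  also have "\<dots> = \<Lambda> j (\<lambda>x. (1 / 2) ^ CARD('d) * indicator (good j n) x)"
    by (rule scale[symmetric]) simp
  also have "\<dots> \<le> \<Lambda> j (\<lambda>x. \<Sum>t\<in>T0 n. indicator (UNIV \<inter> good j n) x * ?k t x)"
  proof (rule mono[OF bounded_fun_on_cmult[OF bounded_fun_on_indicator] bounded_fun_on_sum[OF bounded_kern]])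
    fix x assume "x \<in> U j"
    then have "x \<in> K" using U_subset[of j] Z_subset[of j] by blast
    then have "norm (f x + partial n w x) \<le> real n"
      using bound norm_partial[of n w x] norm_triangle_ineq[of "f x" "partial n w x"] by fastforce
    then obtain t where t: "t \<in> T0 n" "norm (t - (f x + partial n w x)) \<le> 1 / 2 ^ Suc n" using T0(3) by blast
    have "(1 / 2) ^ CARD('d) * indicator (good j n) x \<le> indicator (UNIV \<inter> good j n) x * ?k t x"
      using kern_lower[OF t(2)] by (auto simp: indicator_def)
    also have "\<dots> \<le> (\<Sum>t\<in>T0 n. indicator (UNIV \<inter> good j n) x * ?k t x)"
      using T0(1) t(1) by (intro member_le_sum) (auto simp: kern_nonneg)
    finally show "(1 / 2) ^ CARD('d) * indicator (good j n) x \<le> (\<Sum>t\<in>T0 n. indicator (UNIV \<inter> good j n) x * ?k t x)" .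
  qed
  also have "\<dots> = (\<Sum>t\<in>T0 n. dens f j n UNIV t w)"
    unfolding dens_def by (rule sum) (rule bounded_kern)
  finally have sum: "(1 / 2) ^ CARD('d) * (1 / 2) \<le> (\<Sum>t\<in>T0 n. dens f j n UNIV t w)" .
  have "\<exists>t\<in>T0 n. 24 * \<eta> n \<le> dens f j n UNIV t w"
  proof (rule ccontr)
    assume "\<not> ?thesis"
    then have "(\<Sum>t\<in>T0 n. dens f j n UNIV t w) < (\<Sum>t\<in>T0 n. 24 * \<eta> n)"
      using T0(1) ne by (intro sum_strict_mono) (auto simp: not_le)
    also have "\<dots> = card (T0 n) * (48 * \<eta> n) * (1 / 2)" by simp
    also have "\<dots> \<le> (1 / 2) ^ CARD('d) * (1 / 2)" using \<eta>_T0[of n] by (rule mult_right_mono) simp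
    finally show False using sum by linarith
  qed
  with T0(2)[of n] that show thesis by auto
qed

text \<open>The kernel lives within \<open>CARD('d) / 2 ^ m\<close>, and the truncated field is off
  by no more than that; for large \<open>m\<close> the total is below the gap supplied by
  \<open>compact_fibre_gap\<close>.\<close>

lemma support_in_open:
  assumes f: "continuous_on K f" and "open W" and sub: "{x \<in> Z j. f x + field w x = y} \<subseteq> W"
  shows "\<forall>\<^sub>F m in sequentially. \<forall>x\<in>U j. kern m (y - (f x + partial m w x)) \<noteq> 0 \<longrightarrow> x \<in> W"
proof -
  let ?F = "\<lambda>x. f x + field w x"
  have "continuous_on (Z j) ?F"
    using continuous_on_subset[OF f Z_subset] continuous_field by (intro continuous_intros)
  from compact_fibre_gap[OF compact_Z this \<open>open W\<close> sub] obtain e where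
    e: "0 < e" "\<And>x. x \<in> Z j - W \<Longrightarrow> e \<le> norm (y - ?F x)" by (metis norm_minus_commute)
  have "(\<lambda>n. (2 * CARD('d)) / 2 ^ n :: real) \<longlonglongrightarrow> 0"
    by (rule LIMSEQ_divide_realpow_zero) simp
  then have "\<forall>\<^sub>F m in sequentially. (2 * CARD('d)) / 2 ^ m < e" using e(1) by (rule order_tendstoD)
  then show ?thesis
  proof eventually_elim
    case (elim m)
    show ?case
    proof (intro ballI impI, rule ccontr)
      fix x assume x: "x \<in> U j" "kern m (y - (f x + partial m w x)) \<noteq> 0" "x \<notin> W"
      have "e \<le> norm (y - ?F x)" using e(2) x U_subset[of j] by blast
      also have "y - ?F x = (y - (f x + partial m w x)) - (field w x - partial m w x)" by simp
      also have "norm \<dots> \<le> CARD('d) / 2 ^ m + CARD('d) / 2 ^ m"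
        using kern_support[OF x(2)] norm_tail[of w x m] norm_triangle_ineq4 by (metis (no_types, lifting) add_mono order_trans)
      also have "\<dots> < e" using elim by simp
      finally show False by simp
    qed
  qed
qed

text \<open>A mass distribution argument at a finite level: the balls of a cheap cover carry density
  at most \<open>A\<close> times their cost, but for large \<open>m\<close> they carry the whole
  density at \<open>y\<close>, which is at least \<open>\<eta> n\<close>.\<close>

lemma fibres_not_coverable:
  assumes f: "continuous_on K f" and K: "compact K"
    and good: "\<forall>\<^sub>F n in sequentially. w \<notin> bad_event f n"
  shows "\<exists>y0. \<exists>\<rho>>0. \<exists>\<epsilon>>0. \<forall>y\<in>ball y0 \<rho>. \<not> coverable (s j) \<epsilon> {x \<in> Z j. f x + field w x = y}"
proof -
  obtain n1 where n1: "\<And>n. n1 \<le> n \<Longrightarrow> w \<notin> bad_event f n" using good by (auto simp: eventually_sequentially)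
  have "bounded (f ` K)" using compact_imp_bounded[OF compact_continuous_image[OF f K]] .
  then obtain R where R: "\<And>x. x \<in> K \<Longrightarrow> norm (f x) \<le> R" by (auto simp: bounded_iff)
  obtain n where n: "n1 + j + nat \<lceil>\<bar>R\<bar> + CARD('d)\<rceil> = n" by blast
  have "norm (f x) + CARD('d) \<le> real n" if "x \<in> K" for x
  proof -
    have "norm (f x) + CARD('d) \<le> \<bar>R\<bar> + CARD('d)" using R[OF that] by linarith
    also have "\<dots> \<le> real (nat \<lceil>\<bar>R\<bar> + CARD('d)\<rceil>)" by (rule real_nat_ceiling_ge)
    also have "\<dots> \<le> real n" using n by simp
    finally show ?thesis .
  qed
  moreover have "j \<le> n" using n by simp
  ultimately obtain t where t: "norm t \<le> real n" "24 * \<eta> n \<le> dens f j n UNIV t w"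
    using dens_large by blast
  obtain \<rho>' where \<rho>': "0 < \<rho>'" "\<And>u v :: real ^ 'd. norm (u - v) \<le> \<rho>' \<Longrightarrow> \<bar>kern n u - kern n v\<bar> \<le> \<eta> n"
    using kern_uniformly_continuous[OF \<eta>_pos[of n], of n] by blast
  define \<rho> where "\<rho> = min 1 \<rho>'"
  have \<rho>: "0 < \<rho>" using \<rho>' by (simp add: \<rho>_def)
  have norm_y: "norm y \<le> real (Suc n)" if "y \<in> ball t \<rho>" for y
    using that t(1) norm_triangle_sub[of y t] by (simp add: \<rho>_def dist_norm norm_minus_commute)
  \<comment> \<open>Of the \<open>24 * \<eta> n\<close> available at \<open>t\<close>, the move to
    \<open>y\<close> loses at most one \<open>\<eta> n\<close> and all later levels together at most
    six.\<close>
  have lower: "\<eta> n \<le> dens f j m UNIV y w" if y: "y \<in> ball t \<rho>" and "n \<le> m" for y m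
  proof -
    have "\<bar>dens f j n UNIV y w - dens f j n UNIV t w\<bar> \<le> \<eta> n"
      unfolding dens_def
    proof (rule abs_diff_le[OF bounded_kern bounded_kern])
      fix x
      have "\<bar>kern n (y - (f x + partial n w x)) - kern n (t - (f x + partial n w x))\<bar> \<le> \<eta> n"
        using y by (intro \<rho>') (auto simp: \<rho>_def dist_norm norm_minus_commute)
      then show "\<bar>indicator (UNIV \<inter> good j n) x * kern n (y - (f x + partial n w x)) -
          indicator (UNIV \<inter> good j n) x * kern n (t - (f x + partial n w x))\<bar> \<le> \<eta> n"
        using \<eta>_pos[of n] by (auto simp: indicator_def)
    qed
    moreover have "\<bar>dens f j m UNIV y w - dens f j n UNIV y w\<bar> \<le> 6 * \<eta> n"
      using \<open>j \<le> n\<close> n norm_y[OF y] that(2) by (intro dens_diff_le n1) (auto simp: tests_def)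
    ultimately show ?thesis using t(2) \<eta>_pos[of n] by linarith
  qed
  \<comment> \<open>From \<open>N1\<close> on no bad event occurs, and \<open>norm y\<close>,
    \<open>s j\<close> and the reciprocal of \<open>\<sigma> j - s j\<close> are all bounded by the
    level, as \<open>dens_ball_le\<close> requires.\<close>
  obtain N1 where N1: "n1 + j + Suc n + nat \<lceil>s j\<rceil> + nat \<lceil>1 / (\<sigma> j - s j)\<rceil> = N1" by blast
  define A where "A = C j * 3 powr \<sigma> j + 1"
  have A: "0 < A" using C_pos[of j] by (simp add: A_def add_nonneg_pos)
  \<comment> \<open>The second bound forces every radius of a cover below
    \<open>\<delta> N1\<close>; the first keeps \<open>A\<close> times the cost below
    \<open>\<eta> n\<close>.\<close>
  define \<epsilon> where "\<epsilon> = min (\<eta> n / A) (\<delta> N1 powr s j)"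
  have \<epsilon>: "0 < \<epsilon>" using A \<eta>_pos[of n] \<delta>_pos[of N1] by (simp add: \<epsilon>_def)
  have "\<not> coverable (s j) \<epsilon> {x \<in> Z j. f x + field w x = y}" if y: "y \<in> ball t \<rho>" for y
  proof
    assume "coverable (s j) \<epsilon> {x \<in> Z j. f x + field w x = y}"
    then obtain l :: nat and z r where r: "\<And>i. i < l \<Longrightarrow> 0 < r i"
      and cov: "{x \<in> Z j. f x + field w x = y} \<subseteq> (\<Union>i<l. ball (z i) (r i))"
      and sum: "(\<Sum>i<l. r i powr s j) < \<epsilon>" by (auto simp: coverable_def)
    have "\<exists>N\<ge>N1. \<delta> (Suc N) \<le> r i \<and> r i < \<delta> N" if "i < l" for i
    proof -
      have "r i powr s j \<le> (\<Sum>i<l. r i powr s j)" using that by (intro member_le_sum) auto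
      also have "\<dots> < \<delta> N1 powr s j" using sum by (simp add: \<epsilon>_def)
      finally have "r i < \<delta> N1"
        using s_pos[of j] \<delta>_pos[of N1] by (meson less_imp_le not_less powr_mono2)
      then show ?thesis using find_scale[OF r[OF that]] by metis
    qed
    then obtain N where N: "\<And>i. i < l \<Longrightarrow> N1 \<le> N i" "\<And>i. i < l \<Longrightarrow> \<delta> (Suc (N i)) \<le> r i"
      "\<And>i. i < l \<Longrightarrow> r i < \<delta> (N i)" by metis
    have "\<forall>\<^sub>F m in sequentially. \<forall>x\<in>U j. kern m (y - (f x + partial m w x)) \<noteq> 0 \<longrightarrow> x \<in> (\<Union>i<l. ball (z i) (r i))"
      by (rule support_in_open[OF f _ cov]) auto
    then obtain m0 where m0: "\<And>m x. m0 \<le> m \<Longrightarrow> x \<in> U j \<Longrightarrow> kern m (y - (f x + partial m w x)) \<noteq> 0 \<Longrightarrow>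
        x \<in> (\<Union>i<l. ball (z i) (r i))"
      by (auto simp: eventually_sequentially)
    define m where "m = m0 + n + (\<Sum>i<l. Suc (Suc (N i)))"
    have N_le: "Suc (Suc (N i)) \<le> m" if "i < l" for i
      using member_le_sum[of i "{..<l}" "\<lambda>i. Suc (Suc (N i))"] that by (simp add: m_def)
    have "\<eta> n \<le> dens f j m UNIV y w" by (rule lower[OF y]) (simp add: m_def)
    also have "\<dots> \<le> (\<Sum>i<l. dens f j m (ball (z i) (r i)) y w)"
      by (rule dens_UN_le) (use m0[of m] in \<open>auto simp: m_def\<close>)
    also have "\<dots> \<le> (\<Sum>i<l. A * r i powr s j)"
    proof (rule sum_mono)
      fix i assume "i \<in> {..<l}"
      then have i: "i < l" by simp
      have "1 / (\<sigma> j - s j) \<le> real N1"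
        using real_nat_ceiling_ge[of "1 / (\<sigma> j - s j)"] N1 by linarith
      then have "1 / (\<sigma> j - s j) \<le> real (N i) + 1" using N(1)[OF i] by linarith
      then have "1 / (real (N i) + 1) \<le> \<sigma> j - s j" using s_less[of j] by (simp add: field_simps)
      moreover have "s j \<le> real (N i)"
        using real_nat_ceiling_ge[of "s j"] N1 N(1)[OF i] by linarith
      moreover have "norm y \<le> real (N i)" using norm_y[OF y] N1 N(1)[OF i] by linarith
      moreover have "w \<notin> bad_event f k" if "Suc (N i) \<le> k" for k
        by (rule n1) (use that N1 N(1)[OF i] in linarith)
      ultimately show "dens f j m (ball (z i) (r i)) y w \<le> A * r i powr s j"
        unfolding A_def using N(1)[OF i] N1
        by (intro dens_ball_le[OF _ _ _ N(2)[OF i] N(3)[OF i] _ _ N_le[OF i]]) auto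
    qed
    also have "\<dots> = A * (\<Sum>i<l. r i powr s j)" by (simp add: sum_distrib_left)
    also have "\<dots> < A * \<epsilon>" using sum A by simp
    also have "\<dots> \<le> A * (\<eta> n / A)" using A by (intro mult_left_mono) (auto simp: \<epsilon>_def)
    finally show False using A by simp
  qed
  with \<rho> \<epsilon> show ?thesis by blast
qed

end

end

section \<open>Choice of the parameters of the field\<close>

lemma finite_net:
  fixes R :: real
  assumes "0 < e"
  obtains T :: "'b::euclidean_space set" where "finite T" "T \<subseteq> cball 0 R"
    "\<And>y. norm y \<le> R \<Longrightarrow> \<exists>t\<in>T. norm (t - y) \<le> e"
proof -
  have "cball 0 R \<subseteq> (\<Union>x\<in>cball (0 :: 'b) R. ball x e)" using assms by force
  then obtain T where T: "T \<subseteq> cball (0 :: 'b) R" "finite T" "cball 0 R \<subseteq> (\<Union>x\<in>T. ball x e)"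
    by (rule compactE_image[OF compact_cball open_ball])
  show thesis
  proof (rule that[OF T(2,1)])
    fix y :: 'b assume "norm y \<le> R"
    then have "y \<in> (\<Union>x\<in>T. ball x e)" using T(3) by (auto simp: subset_iff)
    then show "\<exists>t\<in>T. norm (t - y) \<le> e" by (auto simp: dist_norm intro: less_imp_le)
  qed
qed

lemma kern_net:
  assumes "0 < e"
  shows "\<exists>T. finite T \<and> (\<forall>y :: real ^ 'd. norm y \<le> real (Suc n) \<longrightarrow> (\<exists>y'\<in>T. \<forall>v.
    \<bar>kern n (y - v) - kern n (y' - v)\<bar> \<le> e / 2 \<and> \<bar>kern (Suc n) (y - v) - kern (Suc n) (y' - v)\<bar> \<le> e / 2))"
proof -
  have "0 < e / 2" using assms by simp
  from kern_uniformly_continuous[OF this, of n] obtain r where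
    r: "0 < r" "\<And>u v :: real ^ 'd. norm (u - v) \<le> r \<Longrightarrow> \<bar>kern n u - kern n v\<bar> \<le> e / 2" by blast
  from kern_uniformly_continuous[OF \<open>0 < e / 2\<close>, of "Suc n"] obtain r' where
    r': "0 < r'" "\<And>u v :: real ^ 'd. norm (u - v) \<le> r' \<Longrightarrow> \<bar>kern (Suc n) u - kern (Suc n) v\<bar> \<le> e / 2" by blast
  obtain T where T: "finite T" "\<And>y :: real ^ 'd. norm y \<le> real (Suc n) \<Longrightarrow> \<exists>t\<in>T. norm (t - y) \<le> min r r'"
    using finite_net[of "min r r'" "real (Suc n)"] r(1) r'(1) by (metis min_less_iff_conj)
  show ?thesis
  proof (intro exI[of _ T] conjI allI impI T(1))
    fix y :: "real ^ 'd" assume "norm y \<le> real (Suc n)"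
    from T(2)[OF this] obtain t where t: "t \<in> T" "norm (y - t) \<le> min r r'"
      by (auto simp: norm_minus_commute)
    show "\<exists>y'\<in>T. \<forall>v. \<bar>kern n (y - v) - kern n (y' - v)\<bar> \<le> e / 2 \<and> \<bar>kern (Suc n) (y - v) - kern (Suc n) (y' - v)\<bar> \<le> e / 2"
      using t by (intro bexI[of _ t] allI conjI r(2) r'(2)) auto
  qed
qed

lemma eventually_powr_small:
  assumes "0 < a" "0 < e" "0 < c"
  shows "\<forall>\<^sub>F x in at_right 0. c * x powr a \<le> (e :: real)"
proof -
  from tendsto_powr_at_right[OF order_refl assms(1)] have "\<forall>\<^sub>F x in at_right 0. x powr a < e / c"
    by (rule order_tendstoD) (use assms in auto)
  then show ?thesis by eventually_elim (use assms in \<open>simp add: field_simps\<close>)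
qed

text \<open>The order of choice resolves the mutual dependence of the parameters: the threshold
  \<open>\<eta> n\<close> determines the net and with it the admissible piece mass, this determines
  \<open>\<delta> n\<close>, and only then the bumps and their number \<open>M n\<close> are known.
  The next threshold may depend on \<open>M n\<close> and \<open>\<delta> n\<close>.\<close>

lemma random_field_exists:
  fixes K :: "'a::metric_space set"
  assumes K: "compact K" and mean: "\<And>j. mean (U j) (\<Lambda> j)" and Z: "\<And>j. compact (Z j)"
    and UZ: "\<And>j. U j \<subseteq> Z j" and ZK: "\<And>j. Z j \<subseteq> K"
    and s: "\<And>j. 0 < s j" "\<And>j. s j < \<sigma> j" and C: "\<And>j. 0 < C j"
    and frostman: "\<And>j x r. 0 < r \<Longrightarrow> \<Lambda> j (indicator (ball x r)) \<le> C j * r powr \<sigma> j"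
  shows "\<exists>M b \<delta> \<eta> \<mu> (T :: nat \<Rightarrow> (real ^ 'd) set) T0. random_field K U Z \<Lambda> \<sigma> s C M b \<delta> \<eta> \<mu> T T0"
proof -
  let ?d = "CARD('d)"
  have "\<exists>T0. finite T0 \<and> T0 \<subseteq> cball (0 :: real ^ 'd) (real n) \<and>
      (\<forall>y. norm y \<le> real n \<longrightarrow> (\<exists>t\<in>T0. norm (t - y) \<le> 1 / 2 ^ Suc n))" for n
    by (rule finite_net[where e = "1 / 2 ^ Suc n" and R = "real n"]) auto
  then obtain T0 :: "nat \<Rightarrow> (real ^ 'd) set" where T0: "\<And>n. finite (T0 n)" "\<And>n. T0 n \<subseteq> cball 0 (real n)"
    "\<And>n y. norm y \<le> real n \<Longrightarrow> \<exists>t\<in>T0 n. norm (t - y) \<le> 1 / 2 ^ Suc n" by metis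
  define netp where "netp n e T \<longleftrightarrow> finite T \<and> (\<forall>y :: real ^ 'd. norm y \<le> real (Suc n) \<longrightarrow> (\<exists>y'\<in>T. \<forall>v.
    \<bar>kern n (y - v) - kern n (y' - v)\<bar> \<le> e / 2 \<and> \<bar>kern (Suc n) (y - v) - kern (Suc n) (y' - v)\<bar> \<le> e / 2))"
    for n and e :: real and T
  define TT where "TT n e = (SOME T. netp n e T)" for n e
  have TT: "netp n e (TT n e)" if "0 < e" for n e
    unfolding TT_def by (rule someI_ex) (use kern_net[OF that] in \<open>simp add: netp_def\<close>)
  define cap :: "nat \<Rightarrow> real" where "cap n = (1 / 2) ^ ?d / (48 * (card (T0 n) + 1))" for n
  have cap: "0 < cap n" for n by (simp add: cap_def add_nonneg_pos)
  \<comment> \<open>The condition \<open>prob_small\<close> solved for the piece mass, with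
    \<open>S\<close> standing for a bound on one plus the number of earlier pieces. The summand 1
    next to the cardinality avoids division by 0.\<close>
  define \<mu> :: "nat \<Rightarrow> real \<Rightarrow> nat \<Rightarrow> real" where "\<mu> n e S = (1 / 2) ^ n * e\<^sup>2 /
      (real (Suc n * S * (card (TT n e) + 1)) * ((2 ^ Suc n) ^ ?d)\<^sup>2)" for n e S
  \<comment> \<open>\<open>S\<close> is part of the state because the union bound of a level counts
    the pieces of all earlier levels, whereas dependent choice sees only the preceding
    state.\<close>
  define level :: "nat \<Rightarrow> real \<times> nat \<times> nat \<times> (nat \<Rightarrow> 'a \<Rightarrow> real) \<times> real \<Rightarrow> bool" where
    "level n = (\<lambda>(e, S, M, b, \<delta>). 0 < e \<and> e \<le> cap n \<and> 0 < S \<and> bump_family \<delta> M b \<and>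
      (\<forall>j\<le>n. (2 ^ n) ^ ?d * \<Lambda> j (indicator {x. \<forall>i<M. b i x \<noteq> 1}) \<le> e) \<and>
      (\<forall>j\<le>n. \<Lambda> j (indicator {x. \<forall>i<M. b i x \<noteq> 1}) \<le> 1 / 2 ^ (n + 2)) \<and>
      (\<forall>j\<le>n. C j * \<delta> powr \<sigma> j \<le> \<mu> n e S) \<and>
      0 < \<delta> \<and> \<delta> \<le> (1 / 2) ^ n \<and> (2 ^ (n + 2)) ^ ?d * \<delta> powr (1 / (real n + 1)) \<le> 1)" for n
  define link :: "nat \<Rightarrow> real \<times> nat \<times> nat \<times> (nat \<Rightarrow> 'a \<Rightarrow> real) \<times> real \<Rightarrow> real \<times> nat \<times> nat \<times> (nat \<Rightarrow> 'a \<Rightarrow> real) \<times> real \<Rightarrow> bool" where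
    "link n = (\<lambda>(e, S, M, b, \<delta>) (e', S', M', b', \<delta>'). S' = S + M \<and> 2 * e' \<le> e \<and> 6 * e' * M \<le> \<delta> ^ n)" for n
  have level_exists: "\<exists>M b \<delta>. level n (e, S, M, b, \<delta>)" if e: "0 < e" "e \<le> cap n" and S: "0 < S" for n e S
  proof -
    have \<mu>0: "0 < \<mu> n e S" unfolding \<mu>_def
    proof (intro divide_pos_pos mult_pos_pos)
      show "0 < real (Suc n * S * (card (TT n e) + 1))" unfolding of_nat_0_less_iff using S by simp
    qed (use e in auto)
    have "\<forall>\<^sub>F \<delta> in at_right 0. (\<forall>j\<in>{..n}. C j * \<delta> powr \<sigma> j \<le> \<mu> n e S)"
      by (intro eventually_ball_finite ballI eventually_powr_small \<mu>0 C) (auto intro: less_trans s)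
    moreover have "\<forall>\<^sub>F \<delta> in at_right 0. (2 ^ (n + 2)) ^ ?d * \<delta> powr (1 / (real n + 1)) \<le> (1 :: real)"
      by (rule eventually_powr_small) auto
    moreover have "\<forall>\<^sub>F \<delta> in at_right 0. \<delta> < (1 / 2 :: real) ^ n"
      by (rule order_tendstoD(2)[OF tendsto_ident_at]) simp
    moreover have "\<forall>\<^sub>F \<delta> in at_right 0. (0 :: real) < \<delta>" by (rule eventually_at_right_less)
    ultimately have "\<forall>\<^sub>F \<delta> in at_right 0. (\<forall>j\<in>{..n}. C j * \<delta> powr \<sigma> j \<le> \<mu> n e S) \<and>
        (2 ^ (n + 2)) ^ ?d * \<delta> powr (1 / (real n + 1)) \<le> 1 \<and> \<delta> < (1 / 2) ^ n \<and> 0 < \<delta>"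
      by eventually_elim blast
    then obtain \<delta> where \<delta>: "\<forall>j\<in>{..n}. C j * \<delta> powr \<sigma> j \<le> \<mu> n e S"
      "(2 ^ (n + 2)) ^ ?d * \<delta> powr (1 / (real n + 1)) \<le> 1" "\<delta> < (1 / 2) ^ n" "0 < \<delta>"
      using eventually_happens'[OF trivial_limit_at_right_real] by blast
    define h :: real where "h = min (e / (2 ^ n) ^ ?d) (1 / 2 ^ (n + 2))"
    have "0 < h" using e by (simp add: h_def)
    have "\<exists>M b. bump_family \<delta> M b \<and> (\<forall>j\<in>{..n}. \<Lambda> j (indicator {x. \<forall>i<M. b i x \<noteq> 1}) \<le> h)"
      by (rule bump_family_exists[OF K, of "{..n}" U \<Lambda> \<delta> h])
         (use mean order_trans[OF UZ ZK] \<delta>(4) \<open>0 < h\<close> in auto)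
    then obtain M b where Mb: "bump_family \<delta> M b" "\<And>j. j \<le> n \<Longrightarrow> \<Lambda> j (indicator {x. \<forall>i<M. b i x \<noteq> 1}) \<le> h" by auto
    have "(2 ^ n) ^ ?d * \<Lambda> j (indicator {x. \<forall>i<M. b i x \<noteq> 1}) \<le> e" if "j \<le> n" for j
    proof -
      have "\<Lambda> j (indicator {x. \<forall>i<M. b i x \<noteq> 1}) \<le> e / (2 ^ n) ^ ?d"
        using Mb(2)[OF that] by (simp add: h_def)
      then show ?thesis by (simp add: field_simps)
    qed
    then have "level n (e, S, M, b, \<delta>)"
      using e S Mb \<delta> by (auto simp: level_def h_def)
    then show ?thesis by blast
  qed
  have "\<exists>st. \<forall>n. level n (st n) \<and> link n (st n) (st (Suc n))"
  proof (rule dependent_nat_choice)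
    show "\<exists>x. level 0 x" using level_exists[OF cap order_refl zero_less_one, of 0] by blast
    fix x n assume "level n x"
    obtain e S M b \<delta> where x: "x = (e, S, M, b, \<delta>)" by (cases x)
    \<comment> \<open>The three bounds provide, in this order, \<open>\<eta>_T0\<close>,
      \<open>\<eta>_half\<close> and \<open>\<eta>_small\<close>.\<close>
    define e' where "e' = min (cap (Suc n)) (min (e / 2) (\<delta> ^ n / (6 * (M + 1))))"
    have pos: "0 < e" "0 < \<delta>" "0 < S" using \<open>level n x\<close> by (auto simp: x level_def)
    have "0 < \<delta> ^ n / (6 * (M + 1))" using pos by (simp add: add_nonneg_pos)
    then have "0 < e'" using cap[of "Suc n"] pos by (simp add: e'_def)
    moreover have "e' \<le> e / 2" "e' \<le> cap (Suc n)" unfolding e'_def by linarith+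
    ultimately have e': "0 < e'" "e' \<le> cap (Suc n)" "2 * e' \<le> e" by auto
    have "e' \<le> \<delta> ^ n / (6 * (M + 1))" by (simp add: e'_def)
    then have "e' * (6 * (M + 1)) \<le> \<delta> ^ n" by (simp add: pos_le_divide_eq add_nonneg_pos)
    moreover have "6 * e' * M \<le> e' * (6 * (M + 1))" using e'(1) by (simp add: algebra_simps)
    ultimately have "6 * e' * M \<le> \<delta> ^ n" by linarith
    moreover obtain M' b' \<delta>' where "level (Suc n) (e', S + M, M', b', \<delta>')"
      using level_exists[OF e'(1,2), of "S + M"] pos by auto
    ultimately show "\<exists>y. level (Suc n) y \<and> link n x y"
      using e'(3) by (intro exI[of _ "(e', S + M, M', b', \<delta>')"]) (simp add: link_def x)
  qed
  then obtain st where st: "\<And>n. level n (st n)" "\<And>n. link n (st n) (st (Suc n))" by blast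
  define \<eta> where "\<eta> n = fst (st n)" for n
  define S where "S n = fst (snd (st n))" for n
  define M where "M n = fst (snd (snd (st n)))" for n
  define b where "b n = fst (snd (snd (snd (st n))))" for n
  define \<delta> where "\<delta> n = snd (snd (snd (snd (st n))))" for n
  have st_eq: "st n = (\<eta> n, S n, M n, b n, \<delta> n)" for n
    by (simp add: \<eta>_def S_def M_def b_def \<delta>_def)
  note lev = st(1)[unfolded st_eq level_def prod.case]
  note lin = st(2)[unfolded st_eq link_def prod.case]
  have S_eq: "1 + (\<Sum>k<n. M k) \<le> S n" for n
  proof (induction n)
    case 0 show ?case using lev[of 0] by simp
  next
    case (Suc n) then show ?case using lin[of n] by simp
  qed
  have "random_field K U Z \<Lambda> \<sigma> s C M b \<delta> \<eta> (\<lambda>n. \<mu> n (\<eta> n) (S n)) (\<lambda>n. TT n (\<eta> n)) T0"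
  proof (rule random_field.intro)
    fix n
    show "bump_family (\<delta> n) (M n) (b n)" using lev[of n] by blast
    show "(2 ^ n) ^ ?d * \<Lambda> j (indicator {x. \<forall>i<M n. b n i x \<noteq> 1}) \<le> \<eta> n" if "j \<le> n" for j
      using lev[of n] that by blast
    show "\<Lambda> j (indicator {x. \<forall>i<M n. b n i x \<noteq> 1}) \<le> 1 / 2 ^ (n + 2)" if "j \<le> n" for j
      using lev[of n] that by blast
    show "\<Lambda> j (indicator {x. b n i x = 1}) \<le> \<mu> n (\<eta> n) (S n)" if j: "j \<le> n" and i: "i < M n" for i j
    proof -
      interpret mean "U j" "\<Lambda> j" by (rule mean)
      obtain z where z: "{x. b n i x \<noteq> 0} \<subseteq> ball z (\<delta> n)"
        using lev[of n] i unfolding bump_family_def by blast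
      have "\<Lambda> j (indicator {x. b n i x = 1}) \<le> \<Lambda> j (indicator (ball z (\<delta> n)))"
        using z by (intro indicator_subset) auto
      also have "\<dots> \<le> C j * \<delta> n powr \<sigma> j" using lev[of n] by (intro frostman) blast
      also have "\<dots> \<le> \<mu> n (\<eta> n) (S n)" using lev[of n] j by blast
      finally show ?thesis .
    qed
    show \<eta>0: "0 < \<eta> n" using lev[of n] by blast
    note net = TT[OF \<eta>0, of n, unfolded netp_def]
    show "finite (TT n (\<eta> n))" using net by blast
    show "\<exists>y'\<in>TT n (\<eta> n). \<forall>v. \<bar>kern n (y - v) - kern n (y' - v)\<bar> \<le> \<eta> n / 2 \<and>
       \<bar>kern (Suc n) (y - v) - kern (Suc n) (y' - v)\<bar> \<le> \<eta> n / 2" if "norm y \<le> real (Suc n)" for y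
      using net that by blast
    let ?c = "card (TT n (\<eta> n))"
    have S0: "0 < S n" using lev[of n] by blast
    have "((2 ^ Suc n) ^ ?d)\<^sup>2 * \<mu> n (\<eta> n) (S n) / (\<eta> n)\<^sup>2 = (1 / 2) ^ n / real (Suc n * S n * (?c + 1))"
      using \<eta>0 by (simp add: \<mu>_def)
    moreover have "real (Suc n * (1 + (\<Sum>k<n. M k)) * ?c) \<le> real (Suc n * S n * (?c + 1))"
      using S_eq[of n] by (intro of_nat_mono mult_le_mono) auto
    then have "real (Suc n * (1 + (\<Sum>k<n. M k)) * ?c) * ((1 / 2) ^ n / real (Suc n * S n * (?c + 1)))
       \<le> real (Suc n * S n * (?c + 1)) * ((1 / 2) ^ n / real (Suc n * S n * (?c + 1)))"
      by (rule mult_right_mono) simp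
    moreover have "real (Suc n * S n * (?c + 1)) * ((1 / 2) ^ n / real (Suc n * S n * (?c + 1))) = (1 / 2) ^ n"
    proof -
      have "0 < Suc n * S n * (?c + 1)" using S0 by simp
      then have "0 < real (Suc n * S n * (?c + 1))" unfolding of_nat_0_less_iff .
      moreover have "X * (a / X) = a" if "0 < X" for X a :: real using that by simp
      ultimately show ?thesis by blast
    qed
    ultimately show "real (Suc n * (1 + (\<Sum>k<n. M k)) * ?c) * (((2 ^ Suc n) ^ ?d)\<^sup>2 * \<mu> n (\<eta> n) (S n) / (\<eta> n)\<^sup>2) \<le> (1 / 2) ^ n"
      by simp
    show "0 < \<delta> n" "\<delta> n \<le> (1 / 2) ^ n" "(2 ^ (n + 2)) ^ ?d * \<delta> n powr (1 / (real n + 1)) \<le> 1"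
      using lev[of n] by blast+
    show "2 * \<eta> (Suc n) \<le> \<eta> n" "6 * \<eta> (Suc n) * M n \<le> \<delta> n ^ n" using lin[of n] by blast+
    have "\<eta> n \<le> cap n" using lev[of n] by blast
    then have "\<eta> n * (48 * (card (T0 n) + 1)) \<le> (1 / 2) ^ ?d"
      unfolding cap_def by (simp add: pos_le_divide_eq add_nonneg_pos)
    moreover have "card (T0 n) * (48 * \<eta> n) \<le> \<eta> n * (48 * (card (T0 n) + 1))"
      using \<eta>0 by (simp add: algebra_simps)
    ultimately show "card (T0 n) * (48 * \<eta> n) \<le> (1 / 2) ^ ?d" by linarith
  qed (use mean Z UZ ZK s C frostman T0 in auto)
  then show ?thesis by blast
qed

section \<open>Prevalence in the space of continuous maps\<close>

lemma C_spaceD: "compact K \<Longrightarrow> f \<in> C_space K \<Longrightarrow> continuous_on K f"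
  by (simp add: C_space_compact)

lemma C_space_eqI:
  assumes "compact K" "f \<in> C_space K" "g \<in> C_space K" "\<And>x. x \<in> K \<Longrightarrow> f x = g x"
  shows "f = g"
  using assms by (intro extensionalityI[of f K g]) (auto simp: C_space_compact)

lemma restrict_in_C_space: "compact K \<Longrightarrow> continuous_on K f \<Longrightarrow> restrict f K \<in> C_space K"
  by (auto simp: C_space_compact cong: continuous_on_cong)

lemma C_mdist_le_iff:
  fixes f g :: "'a::metric_space \<Rightarrow> 'b::real_normed_vector"
  assumes "K \<noteq> {}" "f \<in> C_space K" "g \<in> C_space K"
  shows "mdist (C_metric K) f g \<le> e \<longleftrightarrow> (\<forall>x\<in>K. norm (f x - g x) \<le> e)"
  using cfunspace_mdist_le[of f "top_of_set K" euclidean_metric g e] assms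
  by (simp add: C_space_def C_metric_def dist_norm)

text \<open>Openness in terms of pointwise estimates. The empty \<open>K\<close> is a case of its
  own: the pointwise form of the distance is available for non-empty sets, and on the empty set any
  two maps coincide.\<close>

lemma openin_C_topology:
  fixes W :: "('a::metric_space \<Rightarrow> 'b::real_normed_vector) set"
  assumes K: "compact K"
  shows "openin (C_topology K) W \<longleftrightarrow>
    W \<subseteq> C_space K \<and> (\<forall>f\<in>W. \<exists>e>0. \<forall>g\<in>C_space K. (\<forall>x\<in>K. norm (f x - g x) \<le> e) \<longrightarrow> g \<in> W)"
proof -
  let ?m = "C_metric K :: ('a \<Rightarrow> 'b) metric"
  interpret Metric_space "mspace ?m" "mdist ?m" by (rule Metric_space_mspace_mdist)
  have op: "openin (C_topology K) W \<longleftrightarrow> W \<subseteq> C_space K \<and> (\<forall>f. f \<in> W \<longrightarrow> (\<exists>r>0. mball f r \<subseteq> W))"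
    unfolding C_topology_def mtopology_of_def openin_mtopology C_space_def ..
  show ?thesis
  proof (cases "K = {}")
    case True
    have eq: "f = g" if "f \<in> C_space K" "g \<in> C_space K" for f g :: "'a \<Rightarrow> 'b"
      using C_space_eqI[OF K that] True by simp
    have sub: "mball f r \<subseteq> C_space K" for f r
      unfolding C_space_def by (rule mball_subset_mspace)
    show ?thesis unfolding op
    proof (intro conj_cong refl iffI ballI allI impI)
      fix f assume W: "W \<subseteq> C_space K" "f \<in> W"
      then have W_eq: "g \<in> W" if "g \<in> C_space K" for g using eq[OF that] by blast
      then show "\<exists>e>0. \<forall>g\<in>C_space K. (\<forall>x\<in>K. norm (f x - g x) \<le> e) \<longrightarrow> g \<in> W"
        by (intro exI[of _ 1]) auto
      show "\<exists>r>0. mball f r \<subseteq> W"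
        using W_eq sub[of f 1] by (intro exI[of _ 1]) auto
    qed
  next
    case False
    note le = C_mdist_le_iff[OF False]
    show ?thesis unfolding op
    proof (intro conj_cong refl iffI ballI allI impI)
      fix f assume W: "W \<subseteq> C_space K" and "\<forall>f. f \<in> W \<longrightarrow> (\<exists>r>0. mball f r \<subseteq> W)" "f \<in> W"
      then obtain r where r: "0 < r" "mball f r \<subseteq> W" by blast
      show "\<exists>e>0. \<forall>g\<in>C_space K. (\<forall>x\<in>K. norm (f x - g x) \<le> e) \<longrightarrow> g \<in> W"
      proof (intro exI[of _ "r / 2"] conjI ballI impI)
        fix g assume g: "g \<in> C_space K" "\<forall>x\<in>K. norm (f x - g x) \<le> r / 2"
        then have "mdist ?m f g \<le> r / 2" using le W \<open>f \<in> W\<close> by blast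
        then have "g \<in> mball f r" using r g(1) W \<open>f \<in> W\<close> by (auto simp: mball_def C_space_def)
        then show "g \<in> W" using r by blast
      qed (use r in simp)
    next
      fix f assume W: "W \<subseteq> C_space K" and "f \<in> W"
        and "\<forall>f\<in>W. \<exists>e>0. \<forall>g\<in>C_space K. (\<forall>x\<in>K. norm (f x - g x) \<le> e) \<longrightarrow> g \<in> W"
      then obtain e where e: "0 < e" "\<And>g. g \<in> C_space K \<Longrightarrow> (\<forall>x\<in>K. norm (f x - g x) \<le> e) \<Longrightarrow> g \<in> W" by blast
      have "mball f e \<subseteq> W"
      proof
        fix g assume g: "g \<in> mball f e"
        then have "g \<in> C_space K" "mdist ?m f g \<le> e" by (auto simp: mball_def C_space_def)
        then show "g \<in> W" using e(2) le[of f g e] W \<open>f \<in> W\<close> by blast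
      qed
      then show "\<exists>r>0. mball f r \<subseteq> W" using e by blast
    qed
  qed
qed

definition C_borel :: "'a::metric_space set \<Rightarrow> ('a \<Rightarrow> 'b::real_normed_vector) measure" where
  "C_borel K = sigma (C_space K) {W. openin (C_topology K) W}"

lemma C_open_subset: "{W. openin (C_topology K) W} \<subseteq> Pow (C_space K)"
proof
  fix W assume "W \<in> {W. openin (C_topology K) W}"
  then have "openin (C_topology K) W" by simp
  from openin_subset[OF this] show "W \<in> Pow (C_space K)" by (simp add: topspace_C_topology)
qed

lemma space_C_borel [simp]: "space (C_borel K) = C_space K"
  unfolding C_borel_def by (rule space_measure_of[OF C_open_subset])

lemma sets_C_borel: "sets (C_borel K) = borel_sets_of (C_topology K)"
  unfolding C_borel_def borel_sets_of_def topspace_C_topology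
  by (rule sets_measure_of[OF C_open_subset])

lemma C_borel_open: "openin (C_topology K) W \<Longrightarrow> W \<in> sets (C_borel K)"
  unfolding sets_C_borel borel_sets_of_def by (rule sigma_sets.Basic) simp

lemma measurable_C_borel:
  fixes g :: "'w \<Rightarrow> 'a::metric_space \<Rightarrow> 'b::real_normed_vector"
  assumes "\<And>w. w \<in> space P \<Longrightarrow> g w \<in> C_space K"
    "\<And>W. openin (C_topology K) W \<Longrightarrow> {w \<in> space P. g w \<in> W} \<in> sets P"
  shows "g \<in> measurable P (C_borel K)"
  unfolding C_borel_def
proof (rule measurable_measure_of)
  show "{W. openin (C_topology K) W} \<subseteq> Pow (C_space K)" by (rule C_open_subset)
  show "g \<in> space P \<rightarrow> C_space K" using assms(1) by auto
  fix W :: "('a \<Rightarrow> 'b) set" assume "W \<in> {W. openin (C_topology K) W}"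
  then show "g -` W \<inter> space P \<in> sets P"
    using assms(2)[of W] by (simp add: vimage_def Int_def conj_commute)
qed

definition C_neg :: "'a set \<Rightarrow> ('a \<Rightarrow> 'b::real_normed_vector) \<Rightarrow> 'a \<Rightarrow> 'b" where
  "C_neg K f = (\<lambda>x\<in>K. - f x)"

lemma C_neg_closed: "compact K \<Longrightarrow> f \<in> C_space K \<Longrightarrow> C_neg K f \<in> C_space K"
  unfolding C_neg_def by (intro restrict_in_C_space continuous_intros C_spaceD)

lemma C_add_neg:
  assumes "compact K" "f \<in> C_space K" "g \<in> C_space K"
  shows "C_add K (C_add K f g) (C_neg K g) = f" "C_add K (C_add K f (C_neg K g)) g = f"
proof -
  note closed = C_add_closed[OF assms(1)] C_neg_closed[OF assms(1,3)] assms(2,3)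
  show "C_add K (C_add K f g) (C_neg K g) = f"
    by (rule C_space_eqI[OF assms(1)], intro closed, rule assms(2)) (simp add: C_add_def C_neg_def)
  show "C_add K (C_add K f (C_neg K g)) g = f"
    by (rule C_space_eqI[OF assms(1)], intro closed, rule assms(2)) (simp add: C_add_def C_neg_def)
qed

lemma C_add_measurable:
  fixes x :: "'a::metric_space \<Rightarrow> 'b::real_normed_vector"
  assumes K: "compact K" and x: "x \<in> C_space K"
  shows "(\<lambda>h. C_add K h x) \<in> measurable (C_borel K) (C_borel K)"
proof (rule measurable_C_borel)
  show "C_add K h x \<in> C_space K" if "h \<in> space (C_borel K)" for h
    using that K x by (auto intro: C_add_closed)
  fix W :: "('a \<Rightarrow> 'b) set" assume W: "openin (C_topology K) W"
  have "openin (C_topology K) {h \<in> C_space K. C_add K h x \<in> W}"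
    unfolding openin_C_topology[OF K]
  proof (intro conjI ballI)
    fix f assume f: "f \<in> {h \<in> C_space K. C_add K h x \<in> W}"
    then obtain e where e: "0 < e"
      "\<And>g. g \<in> C_space K \<Longrightarrow> (\<forall>u\<in>K. norm (C_add K f x u - g u) \<le> e) \<Longrightarrow> g \<in> W"
      using W unfolding openin_C_topology[OF K] by blast
    show "\<exists>e>0. \<forall>g\<in>C_space K. (\<forall>u\<in>K. norm (f u - g u) \<le> e) \<longrightarrow> g \<in> {h \<in> C_space K. C_add K h x \<in> W}"
    proof (intro exI[of _ e] conjI ballI impI CollectI e(1))
      fix g assume "g \<in> C_space K" "\<forall>u\<in>K. norm (f u - g u) \<le> e"
      then show "C_add K g x \<in> W" using x K by (intro e(2) C_add_closed) (auto simp: C_add_def)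
    qed
  qed auto
  then show "{h \<in> space (C_borel K). C_add K h x \<in> W} \<in> sets (C_borel K)"
    by (simp add: C_borel_open)
qed

text \<open>The witness is the law of \<open>g\<close>. The translate by \<open>x\<close> of the
  complement of \<open>A'\<close> is null because almost surely the sum of -x and \<open>g\<close>
  lies in \<open>A'\<close>, which is the hypothesis \<open>AE\<close> at f = -x. The Borel set
  \<open>A'\<close> stands in for \<open>A\<close>, whose Borel measurability is left open.\<close>

lemma prevalent_in_random:
  fixes g :: "'w \<Rightarrow> 'a::metric_space \<Rightarrow> 'b::real_normed_vector"
  assumes K: "compact K" and P: "prob_space P" and g: "g \<in> measurable P (C_borel K)"
    and A': "A' \<in> sets (C_borel K)" "A' \<subseteq> A" "A \<subseteq> C_space K"
    and AE: "\<And>f. f \<in> C_space K \<Longrightarrow> AE w in P. C_add K f (g w) \<in> A'"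
  shows "prevalent_in (C_topology K) (C_add K) A"
proof -
  let ?B = "C_space K - A'" and ?\<nu> = "distr P (C_borel K) g"
  have B: "?B \<in> sets (C_borel K)" using sets.compl_sets[OF A'(1)] by simp
  have "(\<lambda>b. C_add K b x) ` ?B \<in> null_sets ?\<nu>" if x: "x \<in> C_space K" for x
  proof -
    let ?E = "{h \<in> C_space K. C_add K h (C_neg K x) \<in> ?B}"
    have nx: "C_neg K x \<in> C_space K" by (rule C_neg_closed[OF K x])
    have eq: "(\<lambda>b. C_add K b x) ` ?B = ?E"
    proof (intro equalityI subsetI)
      fix h assume "h \<in> (\<lambda>b. C_add K b x) ` ?B"
      then show "h \<in> ?E" using C_add_neg(1)[OF K _ x] C_add_closed[OF K _ x] by auto
    next
      fix h assume "h \<in> ?E"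
      then show "h \<in> (\<lambda>b. C_add K b x) ` ?B"
        using C_add_neg(2)[OF K _ x, of h] by (intro image_eqI[of _ _ "C_add K h (C_neg K x)"]) auto
    qed
    have E: "?E \<in> sets (C_borel K)"
      using measurable_sets[OF C_add_measurable[OF K nx] B] by (simp add: vimage_def Int_def conj_commute)
    have comm: "C_add K h (C_neg K x) = C_add K (C_neg K x) h" for h
      by (simp add: C_add_def add.commute)
    have "AE w in P. g w \<notin> ?E"
      using AE[OF nx] by eventually_elim (simp add: comm)
    then have "emeasure P (g -` ?E \<inter> space P) = 0"
      using AE_iff_null_sets[OF measurable_sets[OF g E]] by (auto simp: null_sets_def)
    then show ?thesis using E by (simp add: eq null_sets_def emeasure_distr[OF g])
  qed
  moreover have "prob_space ?\<nu>" by (rule prob_space.prob_space_distr[OF P g])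
  moreover have "C_space K - A \<subseteq> ?B" using A' by blast
  ultimately show ?thesis
    unfolding prevalent_in_def shy_in_def topspace_C_topology
    using A'(3) B by (intro conjI exI[of _ ?B] exI[of _ ?\<nu>] ballI) (auto simp: sets_C_borel)
qed

lemma coverable_mono: "coverable s e E \<Longrightarrow> e \<le> e' \<Longrightarrow> coverable s e' E"
  unfolding coverable_def by (elim exE conjE, intro exI conjI) auto

text \<open>The complementary condition is open for any \<open>V\<close>: a finite ball cover of the
  fibre over one \<open>y\<close> also covers the fibre over the same \<open>y\<close> of every
  nearby map.\<close>

lemma sets_not_coverable_fibres:
  fixes V :: "'b::real_normed_vector set"
  assumes K: "compact K" and Z: "compact Z" "Z \<subseteq> K"
  shows "{f \<in> C_space K. \<forall>y\<in>V. \<not> coverable s e {x \<in> Z. f x = y}} \<in> sets (C_borel K)"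
proof -
  have "openin (C_topology K) {f \<in> C_space K. \<exists>y\<in>V. coverable s e {x \<in> Z. f x = y}}"
    unfolding openin_C_topology[OF K]
  proof (intro conjI ballI)
    fix f assume "f \<in> {f \<in> C_space K. \<exists>y\<in>V. coverable s e {x \<in> Z. f x = y}}"
    then obtain y where f: "f \<in> C_space K" and y: "y \<in> V" "coverable s e {x \<in> Z. f x = y}" by auto
    from y(2) obtain n :: nat and z r where cov: "\<forall>i<n. 0 < r i" "{x \<in> Z. f x = y} \<subseteq> (\<Union>i<n. ball (z i) (r i))"
      "(\<Sum>i<n. r i powr s) < e" by (auto simp: coverable_def)
    let ?W = "\<Union>i<n. ball (z i) (r i)"
    obtain e0 where e0: "0 < e0" "\<And>x. x \<in> Z - ?W \<Longrightarrow> e0 \<le> norm (f x - y)"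
      using compact_fibre_gap[OF Z(1) continuous_on_subset[OF C_spaceD[OF K f] Z(2)] _ cov(2)] by blast
    show "\<exists>e0>0. \<forall>g\<in>C_space K. (\<forall>x\<in>K. norm (f x - g x) \<le> e0) \<longrightarrow>
        g \<in> {f \<in> C_space K. \<exists>y\<in>V. coverable s e {x \<in> Z. f x = y}}"
    proof (intro exI[of _ "e0 / 2"] conjI ballI impI CollectI bexI[OF _ y(1)])
      fix g assume g: "\<forall>x\<in>K. norm (f x - g x) \<le> e0 / 2"
      have "{x \<in> Z. g x = y} \<subseteq> ?W"
      proof (rule subsetI, rule ccontr)
        fix x assume x: "x \<in> {x \<in> Z. g x = y}" "x \<notin> ?W"
        then have "norm (f x - y) \<le> e0 / 2" using g Z by auto
        moreover have "e0 \<le> norm (f x - y)" using x by (intro e0(2)) blast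
        ultimately show False using e0(1) by linarith
      qed
      then show "coverable s e {x \<in> Z. g x = y}" using cov(1,3) unfolding coverable_def by blast
    qed (use e0 in auto)
  qed auto
  then have "C_space K - {f \<in> C_space K. \<exists>y\<in>V. coverable s e {x \<in> Z. f x = y}} \<in> sets (C_borel K)"
    using sets.compl_sets[OF C_borel_open] by fastforce
  moreover have "C_space K - {f \<in> C_space K. \<exists>y\<in>V. coverable s e {x \<in> Z. f x = y}} =
      {f \<in> C_space K. \<forall>y\<in>V. \<not> coverable s e {x \<in> Z. f x = y}}" by auto
  ultimately show ?thesis by simp
qed

text \<open>The field lies in an open set exactly if, for some \<open>n\<close>, that set contains
  all maps within \<open>CARD('d) / 2 ^ n\<close> of \<open>partial n\<close>. Each of these
  conditions involves finitely many rolls, so the event is a countable union of measurable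
  ones.\<close>

lemma (in random_field) field_measurable:
  assumes K: "compact K"
  shows "(\<lambda>w. restrict (field w) K) \<in> measurable dice (C_borel K)"
proof (rule measurable_C_borel)
  show "restrict (field w) K \<in> C_space K" for w
    by (intro restrict_in_C_space K continuous_field)
  fix W :: "('a \<Rightarrow> real ^ 'd) set" assume W: "openin (C_topology K) W"
  let ?h = "\<lambda>n w. \<forall>g\<in>C_space K. (\<forall>x\<in>K. norm (partial n w x - g x) \<le> CARD('d) / 2 ^ n) \<longrightarrow> g \<in> W"
  have "{w \<in> space dice. restrict (field w) K \<in> W} = (\<Union>n. {w. ?h n w \<in> {True}})"
  proof (intro equalityI subsetI)
    fix w assume "w \<in> {w \<in> space dice. restrict (field w) K \<in> W}"
    then obtain e where e: "0 < e"
      "\<And>g. g \<in> C_space K \<Longrightarrow> (\<forall>x\<in>K. norm (restrict (field w) K x - g x) \<le> e) \<Longrightarrow> g \<in> W"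
      using W unfolding openin_C_topology[OF K] by blast
    have "(\<lambda>n. (2 * CARD('d)) / 2 ^ n :: real) \<longlonglongrightarrow> 0"
      by (rule LIMSEQ_divide_realpow_zero) simp
    then have "\<forall>\<^sub>F n in sequentially. (2 * CARD('d)) / 2 ^ n < e" using e(1) by (rule order_tendstoD)
    then obtain n where n: "(2 * CARD('d)) / 2 ^ n < e" by (meson eventually_happens' sequentially_bot)
    have "?h n w"
    proof (intro ballI impI e(2))
      fix g x assume g: "\<forall>x\<in>K. norm (partial n w x - g x) \<le> CARD('d) / 2 ^ n" and x: "x \<in> K"
      have "norm (field w x - g x) \<le> norm (field w x - partial n w x) + norm (partial n w x - g x)"
        using norm_triangle_ineq[of "field w x - partial n w x" "partial n w x - g x"] by simp
      also have "\<dots> \<le> CARD('d) / 2 ^ n + CARD('d) / 2 ^ n"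
        using g x by (intro add_mono norm_tail) auto
      also have "\<dots> \<le> e" using n by simp
      finally show "norm (restrict (field w) K x - g x) \<le> e" using x by simp
    qed
    then show "w \<in> (\<Union>n. {w. ?h n w \<in> {True}})" by blast
  next
    fix w assume "w \<in> (\<Union>n. {w. ?h n w \<in> {True}})"
    then obtain n where n: "?h n w" by blast
    have "restrict (field w) K \<in> W"
      by (rule n[rule_format, OF restrict_in_C_space[OF K continuous_field]])
         (use norm_tail[of w _ n] in \<open>simp add: norm_minus_commute\<close>)
    then show "w \<in> {w \<in> space dice. restrict (field w) K \<in> W}" by simp
  qed
  also have "\<dots> \<in> sets dice"
  proof (intro sets.countable_UN'' countableI_type)
    fix n
    show "{w. ?h n w \<in> {True}} \<in> sets dice"
    proof (rule dice_cylinder[of "Sigma {..<n} (\<lambda>k. {..<M k})" "?h n"])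
      fix w w' :: "'d rolls"
      assume "\<forall>p\<in>Sigma {..<n} (\<lambda>k. {..<M k}). w p = w' p"
      then have "partial n w = partial n w'" by (intro ext partial_cong) auto
      then show "?h n w = ?h n w'" by simp
    qed simp
  qed
  finally show "{w \<in> space dice. restrict (field w) K \<in> W} \<in> sets dice" .
qed

lemma prevalent_not_coverable:
  fixes K :: "'a::metric_space set" and Z :: "nat \<Rightarrow> 'a set" and s \<sigma> :: "nat \<Rightarrow> real"
    and A :: "('a \<Rightarrow> real ^ 'd) set"
  assumes K: "compact K" and Z: "\<And>j. compact (Z j)" "\<And>j. Z j \<subseteq> K"
    and U: "\<And>j. U j \<subseteq> Z j" "\<And>j. ereal (s j) < hausdorff_dim (U j)" and s: "\<And>j. 0 < s j"
    and A: "A \<subseteq> C_space K" "\<And>f. f \<in> C_space K \<Longrightarrow>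
       (\<And>j. \<exists>y0. \<exists>\<rho>>0. \<exists>\<epsilon>>0. \<forall>y\<in>ball y0 \<rho>. \<not> coverable (s j) \<epsilon> {x \<in> Z j. f x = y}) \<Longrightarrow> f \<in> A"
  shows "prevalent_in (C_topology K) (C_add K) A"
proof -
  have "\<exists>\<sigma> \<Lambda> C. s j < \<sigma> \<and> mean (U j) \<Lambda> \<and> 0 < C \<and> (\<forall>x r. 0 < r \<longrightarrow> \<Lambda> (indicator (ball x r)) \<le> C * r powr \<sigma>)" for j
  proof -
    obtain \<sigma> where \<sigma>: "ereal (s j) < ereal \<sigma>" "ereal \<sigma> < hausdorff_dim (U j)"
      using ereal_dense2[OF U(2)] by blast
    then have "0 < \<sigma>" using s[of j] by simp
    have "\<exists>c>0. \<not> coverable \<sigma> c (U j)"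
    proof (rule ccontr)
      assume "\<not> ?thesis"
      then have "hausdorff_dim (U j) \<le> ereal \<sigma>"
        by (intro coverable_imp_hausdorff_dim_le \<open>0 < \<sigma>\<close>) blast
      with \<sigma>(2) show False by simp
    qed
    then obtain c where c: "0 < c" "\<not> coverable \<sigma> c (U j)" by blast
    have "bounded (U j)"
      using compact_imp_bounded[OF K] U(1)[of j] Z(2)[of j] by (meson bounded_subset)
    from frostman_mean[OF this c] \<sigma>(1) show ?thesis by (metis ereal_less_eq(3) less_le_not_le)
  qed
  then obtain \<sigma> \<Lambda> C where fr: "\<And>j. s j < \<sigma> j" "\<And>j. mean (U j) (\<Lambda> j)" "\<And>j. 0 < C j"
    "\<And>j x r. 0 < r \<Longrightarrow> \<Lambda> j (indicator (ball x r)) \<le> C j * r powr \<sigma> j" by metis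
  obtain M b \<delta> \<eta> \<mu> and T T0 :: "nat \<Rightarrow> (real ^ 'd) set" where "random_field K U Z \<Lambda> \<sigma> s C M b \<delta> \<eta> \<mu> T T0"
    using random_field_exists[of K U \<Lambda> Z s \<sigma> C, OF K fr(2) Z(1) U(1) Z(2) s fr(1) fr(3) fr(4)] by blast
  then interpret random_field K U Z \<Lambda> \<sigma> s C M b \<delta> \<eta> \<mu> T T0 .
  obtain D :: "(real ^ 'd) set" where D: "countable D" "\<And>W. open W \<Longrightarrow> W \<noteq> {} \<Longrightarrow> \<exists>d\<in>D. d \<in> W"
    using countable_dense_exists by blast
  \<comment> \<open>Centre, radius and content bound are restricted to countably many values, so
    that the conclusion becomes a Borel condition.\<close>
  define G where "G j y k = {f \<in> C_space K. \<forall>y\<in>ball y (1 / real (Suc k)). \<not> coverable (s j) (1 / real (Suc k)) {x \<in> Z j. f x = y}}"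
    for j k and y :: "real ^ 'd"
  define A' where "A' = (\<Inter>j. \<Union>y\<in>D. \<Union>k. G j y k)"
  show ?thesis
  proof (rule prevalent_in_random[OF K prob_space_dice field_measurable[OF K]])
    show "A' \<in> sets (C_borel K)"
      unfolding A'_def G_def
      by (intro sets.countable_INT' sets.countable_UN'' image_subsetI D(1) countableI_type UNIV_not_empty
          sets_not_coverable_fibres K Z)
    show "A' \<subseteq> A"
    proof
      fix f assume f: "f \<in> A'"
      show "f \<in> A"
      proof (rule A(2))
        show "f \<in> C_space K" using f by (auto simp: A'_def G_def)
        fix j
        have "\<exists>y\<in>D. \<exists>k. f \<in> G j y k" using f by (auto simp: A'_def)
        then obtain y k where "f \<in> G j y k" by blast
        then show "\<exists>y0. \<exists>\<rho>>0. \<exists>\<epsilon>>0. \<forall>y\<in>ball y0 \<rho>. \<not> coverable (s j) \<epsilon> {x \<in> Z j. f x = y}"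
          unfolding G_def
          by (intro exI[of _ y] exI[of _ "1 / real (Suc k)"] conjI) auto
      qed
    qed
    show "A \<subseteq> C_space K" by (rule A(1))
    fix f :: "'a \<Rightarrow> real ^ 'd" assume f: "f \<in> C_space K"
    note cont = C_spaceD[OF K f]
    show "AE w in dice. C_add K f (restrict (field w) K) \<in> A'"
      using AE_eventually_good[of f]
    proof eventually_elim
      case (elim w)
      let ?F = "C_add K f (restrict (field w) K)"
      have F: "?F \<in> C_space K" by (intro C_add_closed K f restrict_in_C_space continuous_field)
      have "\<exists>y\<in>D. \<exists>k. ?F \<in> G j y k" for j
      proof -
        obtain y0 \<rho> \<epsilon> where \<rho>: "0 < \<rho>" "0 < \<epsilon>"
          "\<And>y. y \<in> ball y0 \<rho> \<Longrightarrow> \<not> coverable (s j) \<epsilon> {x \<in> Z j. f x + field w x = y}"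
          using fibres_not_coverable[OF cont K elim, of j] by blast
        \<comment> \<open>Half of \<rho> is spent on moving the centre into the dense set; the other
          half bounds the new radius.\<close>
        obtain k where k: "1 / real (Suc k) < min (\<rho> / 2) \<epsilon>"
          using reals_Archimedean[of "min (\<rho> / 2) \<epsilon>"] \<rho> by (auto simp: inverse_eq_divide)
        obtain y1 where y1: "y1 \<in> D" "y1 \<in> ball y0 (\<rho> / 2)" using D(2)[of "ball y0 (\<rho> / 2)"] \<rho> by auto
        have "\<not> coverable (s j) (1 / real (Suc k)) {x \<in> Z j. ?F x = y}" if y: "y \<in> ball y1 (1 / real (Suc k))" for y
        proof -
          have "y \<in> ball y0 \<rho>"
            using y y1(2) k dist_triangle[of y0 y y1] unfolding mem_ball by linarith
          moreover have "{x \<in> Z j. ?F x = y} = {x \<in> Z j. f x + field w x = y}"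
            using Z(2)[of j] by (auto simp: C_add_def)
          moreover have "1 / real (Suc k) \<le> \<epsilon>" using k by simp
          ultimately show ?thesis using \<rho>(3)[of y] coverable_mono[of "s j" "1 / real (Suc k)" _ \<epsilon>] by auto
        qed
        then have "?F \<in> G j y1 k" using F by (auto simp: G_def)
        with y1(1) show ?thesis by blast
      qed
      then show ?case by (auto simp: A'_def)
    qed
  qed
qed

section \<open>Generic fibres\<close>

lemma compact_nets:
  fixes K :: "'a::metric_space set"
  assumes "compact K"
  obtains N where "\<And>n::nat. finite (N n)" "\<And>n. N n \<subseteq> K" "\<And>n. K \<subseteq> (\<Union>z\<in>N n. ball z (1 / real (Suc n)))"
proof -
  have "\<exists>N. finite N \<and> N \<subseteq> K \<and> K \<subseteq> (\<Union>z\<in>N. ball z (1 / real (Suc n)))" for n :: nat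
  proof -
    have "K \<subseteq> (\<Union>z\<in>K. ball z (1 / real (Suc n)))" by force
    then obtain N where "N \<subseteq> K" "finite N" "K \<subseteq> (\<Union>z\<in>N. ball z (1 / real (Suc n)))"
      by (rule compactE_image[OF assms open_ball])
    then show ?thesis by blast
  qed
  with that show thesis by metis
qed

text \<open>For each net, accuracy and table of values in a countable dense set, one compatible map
  is picked. Two maps compatible with the same data differ by at most four times the accuracy: twice
  on the net and twice by the common modulus of continuity.\<close>

lemma C_space_separable:
  fixes K :: "'a::metric_space set"
  assumes K: "compact K"
  obtains D :: "('a \<Rightarrow> 'b::euclidean_space) set" where "countable D" "D \<subseteq> C_space K"
    "\<And>f e. f \<in> C_space K \<Longrightarrow> 0 < e \<Longrightarrow> \<exists>g\<in>D. \<forall>x\<in>K. norm (f x - g x) \<le> e"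
proof -
  obtain N where N: "\<And>n::nat. finite (N n)" "\<And>n. N n \<subseteq> K" "\<And>n. K \<subseteq> (\<Union>z\<in>N n. ball z (1 / real (Suc n)))"
    using compact_nets[OF K] by blast
  obtain Q :: "'b set" where Q: "countable Q" "\<And>W. open W \<Longrightarrow> W \<noteq> {} \<Longrightarrow> \<exists>d\<in>Q. d \<in> W"
    using countable_dense_exists by blast
  define compat where "compat n k h f \<longleftrightarrow> f \<in> C_space K \<and> (\<forall>z\<in>N n. norm (f z - h z) \<le> 1 / real (Suc k)) \<and>
    (\<forall>x\<in>K. \<forall>z\<in>K. dist x z < 1 / real (Suc n) \<longrightarrow> norm (f x - f z) \<le> 1 / real (Suc k))"
    for n k :: nat and h f :: "'a \<Rightarrow> 'b"
  define I where "I = (SIGMA n:UNIV. SIGMA k:(UNIV :: nat set). {h \<in> PiE (N n) (\<lambda>_. Q). \<exists>f. compat n k h f})"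
  define D where "D = (\<lambda>(n, k, h). SOME f. compat n k h f) ` I"
  have pick: "compat n k h (SOME f. compat n k h f)" if "(n, k, h) \<in> I" for n k h
  proof -
    have "\<exists>f. compat n k h f" using that by (simp add: I_def)
    then show ?thesis by (rule someI_ex)
  qed
  show thesis
  proof
    have "countable {h \<in> PiE (N n) (\<lambda>_. Q). \<exists>f. compat n k h f}" for n k
      by (rule countable_subset[OF _ countable_PiE[OF N(1) Q(1)]]) auto
    then show "countable D" unfolding D_def I_def by (intro countable_image countable_SIGMA) auto
    show "D \<subseteq> C_space K" using pick by (auto simp: D_def compat_def)
    fix f :: "'a \<Rightarrow> 'b" and e :: real assume f: "f \<in> C_space K" and e: "0 < e"
    obtain k :: nat where k: "1 / real (Suc k) < e / 4"
      using reals_Archimedean[of "e / 4"] e by (auto simp: inverse_eq_divide)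
    have "uniformly_continuous_on K f"
      by (rule compact_uniformly_continuous[OF C_spaceD[OF K f] K])
    then obtain d where d: "0 < d" "\<And>x z. x \<in> K \<Longrightarrow> z \<in> K \<Longrightarrow> dist x z < d \<Longrightarrow> dist (f x) (f z) < 1 / real (Suc k)"
      unfolding uniformly_continuous_on_def by (metis of_nat_0_less_iff zero_less_Suc zero_less_divide_1_iff)
    obtain n :: nat where n: "1 / real (Suc n) < d"
      using reals_Archimedean[OF d(1)] by (auto simp: inverse_eq_divide)
    have "\<exists>q\<in>Q. norm (f z - q) \<le> 1 / real (Suc k)" for z
      using Q(2)[of "ball (f z) (1 / real (Suc k))"] by (force simp: dist_norm)
    then obtain q where q: "\<And>z. q z \<in> Q" "\<And>z. norm (f z - q z) \<le> 1 / real (Suc k)" by metis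
    let ?h = "restrict q (N n)"
    have "compat n k ?h f"
      using f q(2) d(2) n by (force simp: compat_def dist_norm)
    then have I: "(n, k, ?h) \<in> I" using q(1) by (auto simp: I_def)
    let ?g = "SOME f. compat n k ?h f"
    have g: "compat n k ?h ?g" by (rule pick[OF I])
    show "\<exists>g\<in>D. \<forall>x\<in>K. norm (f x - g x) \<le> e"
    proof (intro bexI[of _ ?g] ballI)
      fix x assume x: "x \<in> K"
      then obtain z where z: "z \<in> N n" "dist x z < 1 / real (Suc n)" using N(3)[of n] by (auto simp: dist_commute)
      then have zK: "z \<in> K" using N(2) by blast
      have "norm (f x - f z) \<le> 1 / real (Suc k)" using d(2)[OF x zK] z n by (simp add: dist_norm)
      moreover have "norm (f z - q z) \<le> 1 / real (Suc k)" by (rule q(2))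
      moreover have "norm (?g z - q z) \<le> 1 / real (Suc k)" using g z by (auto simp: compat_def)
      moreover have "norm (?g x - ?g z) \<le> 1 / real (Suc k)" using g x z zK by (auto simp: compat_def)
      ultimately have "dist (f x) (f z) + dist (f z) (q z) + (dist (q z) (?g z) + dist (?g z) (?g x)) \<le> 4 * (1 / real (Suc k))"
        by (simp add: dist_norm norm_minus_commute)
      moreover have "dist (f x) (?g x) \<le> dist (f x) (f z) + dist (f z) (q z) + (dist (q z) (?g z) + dist (?g z) (?g x))"
        using dist_triangle[of "f x" "q z" "f z"] dist_triangle[of "q z" "?g x" "?g z"] dist_triangle[of "f x" "?g x" "q z"] by linarith
      ultimately show "norm (f x - ?g x) \<le> e" using k unfolding dist_norm by linarith
    next
      show "?g \<in> D" unfolding D_def using I by (intro image_eqI[of _ _ "(n, k, ?h)"]) auto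
    qed
  qed
qed

section \<open>Non-shy open sets and generic values\<close>

text \<open>The translates of \<open>W\<close> by a countable dense set cover the whole space; if
  all were null, a probability measure would vanish.\<close>

lemma open_not_shy:
  fixes W :: "('a::metric_space \<Rightarrow> 'b::euclidean_space) set"
  assumes K: "compact K" and W: "openin (C_topology K) W" "W \<noteq> {}"
  shows "\<not> shy_in (C_topology K) (C_add K) W"
proof
  assume "shy_in (C_topology K) (C_add K) W"
  then obtain B \<nu> where B: "B \<in> borel_sets_of (C_topology K)" "W \<subseteq> B" and \<nu>: "prob_space \<nu>" "space \<nu> = C_space K"
    and null: "\<And>x. x \<in> C_space K \<Longrightarrow> (\<lambda>b. C_add K b x) ` B \<in> null_sets \<nu>"
    unfolding shy_in_def topspace_C_topology by blast
  obtain D :: "('a \<Rightarrow> 'b) set" where D: "countable D" "D \<subseteq> C_space K"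
    "\<And>f e. f \<in> C_space K \<Longrightarrow> 0 < e \<Longrightarrow> \<exists>g\<in>D. \<forall>x\<in>K. norm (f x - g x) \<le> e"
    using C_space_separable[OF K] by blast
  obtain f where f: "f \<in> W" using W(2) by blast
  obtain e where e: "0 < e" "\<And>g. g \<in> C_space K \<Longrightarrow> (\<forall>x\<in>K. norm (f x - g x) \<le> e) \<Longrightarrow> g \<in> W"
    and WC: "W \<subseteq> C_space K"
    using W(1) f unfolding openin_C_topology[OF K] by blast
  have fC: "f \<in> C_space K" using f WC by blast
  have "(\<Union>d\<in>D. (\<lambda>b. C_add K b d) ` B) \<in> null_sets \<nu>"
    by (rule null_sets_UN'[OF D(1)]) (use D(2) null in blast)
  moreover have "space \<nu> \<subseteq> (\<Union>d\<in>D. (\<lambda>b. C_add K b d) ` B)"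
  proof
    fix h assume "h \<in> space \<nu>"
    then have h: "h \<in> C_space K" using \<nu> by simp
    \<comment> \<open>If \<open>d\<close> is close to h - f, then h - d is close to \<open>f\<close>
      and hence lies in \<open>W\<close>.\<close>
    have "C_add K h (C_neg K f) \<in> C_space K" by (intro C_add_closed C_neg_closed K h fC)
    then obtain d where d: "d \<in> D" "\<And>x. x \<in> K \<Longrightarrow> norm (C_add K h (C_neg K f) x - d x) \<le> e"
      using D(3) e(1) by blast
    have dC: "d \<in> C_space K" using d(1) D(2) by blast
    have "C_add K h (C_neg K d) \<in> W"
    proof (rule e(2))
      show "C_add K h (C_neg K d) \<in> C_space K" by (intro C_add_closed C_neg_closed K h dC)
      show "\<forall>x\<in>K. norm (f x - C_add K h (C_neg K d) x) \<le> e"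
      proof
        fix x assume x: "x \<in> K"
        have "f x - C_add K h (C_neg K d) x = - (C_add K h (C_neg K f) x - d x)"
          using x by (simp add: C_add_def C_neg_def)
        then show "norm (f x - C_add K h (C_neg K d) x) \<le> e" using d(2)[OF x] by (simp only: norm_minus_cancel)
      qed
    qed
    then have "C_add K h (C_neg K d) \<in> B" using B(2) by blast
    then have "h \<in> (\<lambda>b. C_add K b d) ` B"
      using C_add_neg(2)[OF K h dC] by (metis image_eqI)
    with d(1) show "h \<in> (\<Union>d\<in>D. (\<lambda>b. C_add K b d) ` B)" by blast
  qed
  ultimately have "emeasure \<nu> (space \<nu>) = 0" using null_sets_subset[OF _ sets.top] by blast
  then show False using prob_space.emeasure_space_1[OF \<nu>(1)] by simp
qed

lemma shy_in_subset: "shy_in G add A \<Longrightarrow> A' \<subseteq> A \<Longrightarrow> shy_in G add A'"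
  unfolding shy_in_def by (elim exE conjE, intro exI conjI) auto

text \<open>Baire's theorem in the closed set \<open>S\<close>. Speaking of a meager set that
  contains the open piece avoids passing to subsets of meager sets.\<close>

lemma compact_open_not_meager:
  fixes S :: "'b::euclidean_space set"
  assumes S: "compact S" and W: "open W" "x \<in> S \<inter> W"
  shows "\<not> (\<exists>A. meager_in (top_of_set S) A \<and> S \<inter> W \<subseteq> A)"
proof
  assume "\<exists>A. meager_in (top_of_set S) A \<and> S \<inter> W \<subseteq> A"
  then obtain N :: "nat \<Rightarrow> 'b set" where N: "\<And>n. nowhere_dense_in (top_of_set S) (N n)" "S \<inter> W \<subseteq> (\<Union>n. N n)"
    by (auto simp: meager_in_def)
  define T where "T n = S - (top_of_set S) closure_of (N n)" for n
  have "S \<subseteq> closure (\<Inter> (range T))"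
  proof (rule Baire)
    show "closed S" using S by (rule compact_imp_closed)
    show "countable (range T)" by simp
    fix A assume "A \<in> range T"
    then obtain n where A: "A = T n" by blast
    have "openin (top_of_set S) (topspace (top_of_set S) - (top_of_set S) closure_of (N n))"
      by (intro openin_diff openin_topspace closedin_closure_of)
    then have op: "openin (top_of_set S) (T n)" by (simp add: T_def)
    have "S \<subseteq> closure (T n)"
    proof
      fix u assume u: "u \<in> S"
      show "u \<in> closure (T n)"
      proof (rule ccontr)
        assume "u \<notin> closure (T n)"
        define V where "V = S \<inter> - closure (T n)"
        have "V \<subseteq> (top_of_set S) closure_of (N n)"
          using closure_subset[of "T n"] by (auto simp: V_def T_def)
        moreover have "openin (top_of_set S) V" unfolding V_def by (intro openin_open_Int) auto
        ultimately have "V \<subseteq> (top_of_set S) interior_of ((top_of_set S) closure_of (N n))"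
          by (rule interior_of_maximal)
        then have "V = {}" using N(1)[of n] by (simp add: nowhere_dense_in_def)
        then show False using u \<open>u \<notin> closure (T n)\<close> by (auto simp: V_def)
      qed
    qed
    with op A show "openin (top_of_set S) A \<and> S \<subseteq> closure A" by simp
  qed
  then have "W \<inter> (\<Inter> (range T)) \<noteq> {}"
    using W open_Int_closure_eq_empty[of W "\<Inter> (range T)"] by blast
  then obtain u where u: "u \<in> W" "\<And>n. u \<in> T n" by blast
  then have "u \<in> S" by (auto simp: T_def)
  then obtain n where n: "u \<in> N n" using N(2) u(1) by blast
  have "N n \<subseteq> (top_of_set S) closure_of (N n)"
    using N(1)[of n] by (intro closure_of_subset) (simp add: nowhere_dense_in_def)
  with n u(2)[of n] show False by (auto simp: T_def)
qed

text \<open>The exceptional values split into the sets \<open>B t\<close> with \<open>t\<close>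
  rational. If the closure of \<open>B t\<close> had interior, a small closed ball of
  \<open>K\<close> would be mapped into that interior, and \<open>fib\<close> for this ball gives an
  open set of values none of which belongs to \<open>B t\<close>.\<close>

lemma comeager_fibres:
  fixes K :: "'a::metric_space set" and f :: "'a \<Rightarrow> 'b::euclidean_space"
  assumes K: "compact K" and f: "continuous_on K f"
    and N: "\<And>n::nat. N n \<subseteq> K" "\<And>n. K \<subseteq> (\<Union>z\<in>N n. ball z (1 / real (Suc n)))"
    and fib: "\<And>z n t. z \<in> N n \<Longrightarrow> t \<in> \<rat> \<Longrightarrow> 0 < t \<Longrightarrow> ereal t < hausdorff_dim K \<Longrightarrow>
      \<exists>y0. \<exists>\<rho>>0. \<exists>\<epsilon>>0. \<forall>y\<in>ball y0 \<rho>. \<not> coverable t \<epsilon> {x \<in> K \<inter> cball z (1 / real (Suc n)). f x = y}"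
  shows "comeager_in (top_of_set (f ` K)) {y \<in> f ` K. hausdorff_dim {x \<in> K. f x = y} = hausdorff_dim K}"
proof -
  let ?fib = "\<lambda>y. {x \<in> K. f x = y}" and ?X = "top_of_set (f ` K)"
  define B where "B t = {y \<in> f ` K. 0 < t \<and> ereal t < hausdorff_dim K \<and> hausdorff_dim (?fib y) < ereal t}" for t
  have nowhere: "nowhere_dense_in ?X (B t)" if t: "t \<in> \<rat>" for t
    unfolding nowhere_dense_in_def
  proof (intro conjI, goal_cases)
    case 1 show ?case by (auto simp: B_def)
  next
    case 2
    show ?case
    proof (cases "0 < t \<and> ereal t < hausdorff_dim K")
      case False
      then have "B t = {}" by (auto simp: B_def)
      then show ?thesis by simp
    next
      case True
      show ?thesis
      proof (rule ccontr)
        let ?V = "?X interior_of (?X closure_of (B t))"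
        assume V: "?V \<noteq> {}"
        obtain W where W: "open W" "?V = f ` K \<inter> W"
          using openin_interior_of[of ?X "?X closure_of (B t)"] unfolding openin_open by metis
        from V obtain x0 where x0: "x0 \<in> K" "f x0 \<in> W" unfolding W(2) by blast
        have "\<exists>r>0. \<forall>x\<in>K. dist x x0 < r \<longrightarrow> f x \<in> W"
        proof -
          obtain e where e: "0 < e" "ball (f x0) e \<subseteq> W" using W(1) x0(2) by (meson open_contains_ball)
          obtain r where "0 < r" "\<forall>x\<in>K. dist x x0 < r \<longrightarrow> dist (f x) (f x0) < e"
            using f x0(1) e(1) unfolding continuous_on_iff by blast
          with e(2) show ?thesis by (intro exI[of _ r]) (auto simp: dist_commute subset_iff)
        qed
        then obtain r where r: "0 < r" "\<And>x. x \<in> K \<Longrightarrow> dist x x0 < r \<Longrightarrow> f x \<in> W" by blast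
        obtain n :: nat where n: "1 / real (Suc n) < r / 2"
          using reals_Archimedean[of "r / 2"] r(1) by (auto simp: inverse_eq_divide)
        obtain z where z: "z \<in> N n" "dist z x0 < 1 / real (Suc n)" using N(2)[of n] x0(1) by auto
        have sub: "f x \<in> W" if "x \<in> K \<inter> cball z (1 / real (Suc n))" for x
        proof (rule r(2))
          have "dist x x0 \<le> dist z x + dist z x0" using dist_triangle[of x x0 z] by (simp add: dist_commute)
          then show "dist x x0 < r" using that z(2) n by auto
        qed (use that in auto)
        obtain y0 \<rho> \<epsilon> where \<rho>: "0 < \<rho>" "0 < \<epsilon>"
          "\<And>y. y \<in> ball y0 \<rho> \<Longrightarrow> \<not> coverable t \<epsilon> {x \<in> K \<inter> cball z (1 / real (Suc n)). f x = y}"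
          using fib[OF z(1) t] True by blast
        \<comment> \<open>The empty set is coverable, so every value in
          \<open>ball y0 \<rho>\<close> is attained on the small closed ball; this places the ball
          inside the image.\<close>
        have "ball y0 \<rho> \<subseteq> f ` K \<inter> W"
        proof
          fix y assume "y \<in> ball y0 \<rho>"
          then have nc: "\<not> coverable t \<epsilon> {x \<in> K \<inter> cball z (1 / real (Suc n)). f x = y}" by (rule \<rho>(3))
          have "{x \<in> K \<inter> cball z (1 / real (Suc n)). f x = y} \<noteq> {}"
          proof
            assume "{x \<in> K \<inter> cball z (1 / real (Suc n)). f x = y} = {}"
            then have "coverable t \<epsilon> {x \<in> K \<inter> cball z (1 / real (Suc n)). f x = y}"
              using \<rho>(2) by (intro coverableI[of "{}"]) auto
            with nc show False ..
          qed
          then show "y \<in> f ` K \<inter> W" using sub by blast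
        qed
        then have y0: "y0 \<in> f ` K \<inter> W" using \<rho>(1) by (rule subsetD[OF _ centre_in_ball[THEN iffD2]])
        then have "y0 \<in> ?V" unfolding W(2) .
        then have "y0 \<in> ?X closure_of (B t)" by (rule subsetD[OF interior_of_subset])
        moreover have "openin ?X (f ` K \<inter> ball y0 \<rho>)" by (simp add: openin_open_Int)
        moreover have "y0 \<in> f ` K \<inter> ball y0 \<rho>"
          using y0 \<rho>(1) by simp
        ultimately have "\<exists>y. y \<in> B t \<and> y \<in> f ` K \<inter> ball y0 \<rho>" by (simp only: in_closure_of)
        then obtain y where y: "y \<in> B t" "y \<in> ball y0 \<rho>" by blast
        have "compact (?fib y)"
        proof -
          have "closedin (top_of_set K) (K \<inter> f -` {y})" by (rule continuous_closedin_preimage[OF f]) simp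
          then have "compact (K \<inter> f -` {y})" using K by (meson closedin_compact)
          moreover have "K \<inter> f -` {y} = ?fib y" by auto
          ultimately show ?thesis by simp
        qed
        then have "coverable t \<epsilon> (?fib y)"
          using y(1) True \<rho>(2) by (intro hausdorff_dim_less_imp_coverable) (auto simp: B_def)
        then have "coverable t \<epsilon> {x \<in> K \<inter> cball z (1 / real (Suc n)). f x = y}"
          by (rule coverable_subset) auto
        with \<rho>(3)[OF y(2)] show False ..
      qed
    qed
  qed
  have "f ` K - {y \<in> f ` K. hausdorff_dim (?fib y) = hausdorff_dim K} = (\<Union>n. B (real_of_rat (from_nat n)))"
  proof (intro equalityI subsetI)
    fix y assume y: "y \<in> f ` K - {y \<in> f ` K. hausdorff_dim (?fib y) = hausdorff_dim K}"
    then have "hausdorff_dim (?fib y) < hausdorff_dim K"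
      using hausdorff_dim_mono[of "?fib y" K] by (auto simp: order.strict_iff_order)
    then obtain q where q: "hausdorff_dim (?fib y) < ereal (real_of_rat q)" "ereal (real_of_rat q) < hausdorff_dim K"
      using ereal_dense3 by blast
    have "0 \<le> hausdorff_dim (?fib y)" using y by (intro hausdorff_dim_nonneg) auto
    then have "ereal 0 < ereal (real_of_rat q)" using q(1) by (metis le_less_trans zero_ereal_def)
    then have "y \<in> B (real_of_rat q)" using q y by (simp add: B_def)
    moreover have "q = from_nat (to_nat q)" by simp
    ultimately show "y \<in> (\<Union>n. B (real_of_rat (from_nat n)))" by (metis UN_I UNIV_I)
  next
    fix y assume "y \<in> (\<Union>n. B (real_of_rat (from_nat n)))"
    then show "y \<in> f ` K - {y \<in> f ` K. hausdorff_dim (?fib y) = hausdorff_dim K}"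
      by (auto simp: B_def dest: less_trans)
  qed
  then show ?thesis
    unfolding comeager_in_def meager_in_def
    by (intro conjI exI[of _ "\<lambda>n. B (real_of_rat (from_nat n))"] allI nowhere) auto
qed

text \<open>Witnessed by the point mass at the zero map. This settles the case in which there is no
  exponent to test, for instance dimension 0.\<close>

lemma prevalent_in_C_space:
  fixes K :: "'a::metric_space set"
  assumes K: "compact K"
  shows "prevalent_in (C_topology K) (C_add K) (C_space K :: ('a \<Rightarrow> 'b::real_normed_vector) set)"
proof (rule prevalent_in_random[OF K, of "measure_pmf (return_pmf ())" "\<lambda>_. restrict (\<lambda>_. 0) K" "C_space K"])
  have 0: "restrict (\<lambda>_. 0 :: 'b) K \<in> C_space K" by (intro restrict_in_C_space K continuous_intros)
  show "prob_space (measure_pmf (return_pmf ()))" by (rule measure_pmf.prob_space_axioms)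
  show "(\<lambda>_. restrict (\<lambda>_. 0 :: 'b) K) \<in> measurable (measure_pmf (return_pmf ())) (C_borel K)"
    using 0 by (intro measurable_const) simp
  show "C_space K \<in> sets (C_borel K :: ('a \<Rightarrow> 'b) measure)"
    using sets.top[of "C_borel K :: ('a \<Rightarrow> 'b) measure"] by simp
  show "AE w in measure_pmf (return_pmf ()). C_add K f (restrict (\<lambda>_. 0 :: 'b) K) \<in> C_space K"
    if "f \<in> C_space K" for f
    using C_add_closed[OF K that 0] by simp
qed auto

lemma prevalent_generic_fibre_dim:
  fixes K :: "'a::metric_space set"
  assumes K: "compact K"
    and dim: "\<forall>U. openin (top_of_set K) U \<and> U \<noteq> {} \<longrightarrow> hausdorff_dim U = hausdorff_dim K"
  shows "prevalent_in (C_topology K) (C_add K)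
     {f \<in> C_space K :: ('a \<Rightarrow> real ^ 'd) set.
        comeager_in (top_of_set (f ` K)) {y \<in> f ` K. hausdorff_dim {x \<in> K. f x = y} = hausdorff_dim K}}"
    (is "prevalent_in _ _ ?A")
proof -
  obtain N where N: "\<And>n::nat. finite (N n)" "\<And>n. N n \<subseteq> K" "\<And>n. K \<subseteq> (\<Union>z\<in>N n. ball z (1 / real (Suc n)))"
    using compact_nets[OF K] by blast
  define J where "J = {(z, n, t). z \<in> N n \<and> t \<in> \<rat> \<and> 0 < t \<and> ereal t < hausdorff_dim K}"
  have "countable ((\<Union>n. N n) \<times> (UNIV :: nat set) \<times> (\<rat> :: real set))"
    using N(1) by (intro countable_SIGMA countable_UN) (auto intro: countable_finite countable_rat)
  then have J: "countable J" by (rule countable_subset[rotated]) (auto simp: J_def)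
  show ?thesis
  proof (cases "J = {}")
    \<comment> \<open>No constraint arises: \<open>K\<close> is empty or has dimension 0.\<close>
    case True
    have "f \<in> ?A" if f: "f \<in> C_space K" for f
    proof (intro CollectI conjI f comeager_fibres[OF K C_spaceD[OF K f] N(2,3)])
      fix z n t assume "z \<in> N n" "t \<in> \<rat>" "0 < t" "ereal t < hausdorff_dim K"
      then have "(z, n, t) \<in> J" by (simp add: J_def)
      with True show "\<exists>y0. \<exists>\<rho>>0. \<exists>\<epsilon>>0. \<forall>y\<in>ball y0 \<rho>. \<not> coverable t \<epsilon> {x \<in> K \<inter> cball z (1 / real (Suc n)). f x = y}"
        by simp
    qed
    then have "?A = C_space K" by blast
    then show ?thesis using prevalent_in_C_space[OF K] by simp
  next
    case False
    define z where "z j = fst (from_nat_into J j)" for j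
    define n where "n j = fst (snd (from_nat_into J j))" for j
    define t where "t j = snd (snd (from_nat_into J j))" for j
    have in_J: "(z j, n j, t j) \<in> J" for j
      using from_nat_into[OF False, of j] by (simp add: z_def n_def t_def)
    have surj: "\<exists>j. z j = a \<and> n j = m \<and> t j = c" if "(a, m, c) \<in> J" for a m c
      using from_nat_into_surj[OF J that] by (auto simp: z_def n_def t_def) (metis fst_conv snd_conv)
    \<comment> \<open>The assumption on dimensions applies to the open balls; the closed balls
      provide the compact sets in which the fibres are examined.\<close>
    show ?thesis
    proof (rule prevalent_not_coverable[OF K, where Z = "\<lambda>j. K \<inter> cball (z j) (1 / real (Suc (n j)))"
          and U = "\<lambda>j. K \<inter> ball (z j) (1 / real (Suc (n j)))" and s = t])
      show "compact (K \<inter> cball (z j) (1 / real (Suc (n j))))" for j by (intro compact_Int_closed K closed_cball)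
      show "ereal (t j) < hausdorff_dim (K \<inter> ball (z j) (1 / real (Suc (n j))))" for j
      proof -
        have "z j \<in> K \<inter> ball (z j) (1 / real (Suc (n j)))" using in_J[of j] N(2) by (auto simp: J_def)
        moreover have "openin (top_of_set K) (K \<inter> ball (z j) (1 / real (Suc (n j))))" by (simp add: openin_open_Int)
        ultimately have "hausdorff_dim (K \<inter> ball (z j) (1 / real (Suc (n j)))) = hausdorff_dim K"
          using dim by blast
        then show ?thesis using in_J[of j] by (simp add: J_def)
      qed
      show "0 < t j" for j using in_J[of j] by (simp add: J_def)
      show "?A \<subseteq> C_space K" by blast
      fix f :: "'a \<Rightarrow> real ^ 'd" assume f: "f \<in> C_space K"
        and fib: "\<And>j. \<exists>y0. \<exists>\<rho>>0. \<exists>\<epsilon>>0. \<forall>y\<in>ball y0 \<rho>. \<not> coverable (t j) \<epsilon> {x \<in> K \<inter> cball (z j) (1 / real (Suc (n j))). f x = y}"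
      show "f \<in> ?A"
      proof (intro CollectI conjI f comeager_fibres[OF K C_spaceD[OF K f] N(2,3)])
        fix a m c assume "a \<in> N m" "c \<in> \<rat>" "0 < c" "ereal c < hausdorff_dim K"
        then have "(a, m, c) \<in> J" by (simp add: J_def)
        from surj[OF this] obtain j where "z j = a" "n j = m" "t j = c" by blast
        with fib[of j] show "\<exists>y0. \<exists>\<rho>>0. \<exists>\<epsilon>>0. \<forall>y\<in>ball y0 \<rho>. \<not> coverable c \<epsilon> {x \<in> K \<inter> cball a (1 / real (Suc m)). f x = y}"
          by simp
      qed
    qed auto
  qed
qed

lemma prevalent_generic_fibre_dim_imp:
  fixes K :: "'a::metric_space set"
  assumes K: "compact K"
    and prev: "prevalent_in (C_topology K) (C_add K)
     {f \<in> C_space K :: ('a \<Rightarrow> 'b::euclidean_space) set.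
        comeager_in (top_of_set (f ` K)) {y \<in> f ` K. hausdorff_dim {x \<in> K. f x = y} = hausdorff_dim K}}"
    and U: "openin (top_of_set K) U" "U \<noteq> {}"
  shows "hausdorff_dim U = hausdorff_dim K"
proof (rule ccontr)
  assume ne: "hausdorff_dim U \<noteq> hausdorff_dim K"
  have UK: "U \<subseteq> K" using openin_imp_subset[OF U(1)] .
  then have less: "hausdorff_dim U < hausdorff_dim K" using hausdorff_dim_mono[OF UK] ne by simp
  have "U \<noteq> K" using ne by blast
  then have "K - U \<noteq> {}" using UK by blast
  have cl: "closed (K - U)"
  proof -
    obtain T where "open T" "U = K \<inter> T" using U(1) by (auto simp: openin_open)
    then have "K - U = K - T" by blast
    then show ?thesis using compact_imp_closed[OF K] \<open>open T\<close> by (simp add: closed_Diff)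
  qed
  obtain x0 where x0: "x0 \<in> U" using U(2) by blast
  define a where "a = infdist x0 (K - U)"
  have a: "0 < a"
    unfolding a_def using infdist_pos_not_in_closed[OF cl \<open>K - U \<noteq> {}\<close>, of x0] x0 by simp
  obtain v :: 'b where v: "norm v = 1" using vector_choose_size[of 1] by auto
  define f0 where "f0 = restrict (\<lambda>x. (infdist x (K - U) / a) *\<^sub>R v) K"
  have f0: "f0 \<in> C_space K"
    unfolding f0_def using a by (intro restrict_in_C_space K continuous_intros) auto
  \<comment> \<open>With an error below 1/3, values taken outside \<open>U\<close> have norm below
    1/3 and the value at \<open>x0\<close> is within 1/3 of \<open>v\<close>; the ball of radius 1/2
    about the unit vector \<open>v\<close> separates the two. The intermediate \<open>r\<close>
    makes \<open>W\<close> open.\<close>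
  define W where "W = {f \<in> C_space K. \<exists>r<1/3. \<forall>x\<in>K. norm (f0 x - f x) \<le> r}"
  have "openin (C_topology K) W"
    unfolding openin_C_topology[OF K]
  proof (intro conjI ballI)
    fix f assume "f \<in> W"
    then obtain r where r: "r < 1 / 3" "\<And>x. x \<in> K \<Longrightarrow> norm (f0 x - f x) \<le> r" by (auto simp: W_def)
    show "\<exists>e>0. \<forall>g\<in>C_space K. (\<forall>x\<in>K. norm (f x - g x) \<le> e) \<longrightarrow> g \<in> W"
    proof (intro exI[of _ "(1 / 3 - r) / 2"] conjI ballI impI)
      fix g assume g: "g \<in> C_space K" "\<forall>x\<in>K. norm (f x - g x) \<le> (1 / 3 - r) / 2"
      have "norm (f0 x - g x) \<le> r + (1 / 3 - r) / 2" if "x \<in> K" for x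
      proof -
        have "norm (f0 x - g x) \<le> norm (f0 x - f x) + norm (f x - g x)"
          using norm_triangle_ineq[of "f0 x - f x" "f x - g x"] by simp
        also have "\<dots> \<le> r + (1 / 3 - r) / 2" using r(2)[OF that] g(2) that by (intro add_mono) auto
        finally show ?thesis .
      qed
      moreover have "r + (1 / 3 - r) / 2 < 1 / 3" using r(1) by (simp add: field_simps)
      ultimately show "g \<in> W" using g(1) unfolding W_def by blast
    qed (use r in simp)
  qed (auto simp: W_def)
  moreover have "f0 \<in> W" using f0 by (auto simp: W_def intro!: exI[of _ 0])
  ultimately have "\<not> shy_in (C_topology K) (C_add K) W" by (intro open_not_shy[OF K]) auto
  moreover have "shy_in (C_topology K) (C_add K) (C_space K -
      {f \<in> C_space K :: ('a \<Rightarrow> 'b) set. comeager_in (top_of_set (f ` K)) {y \<in> f ` K. hausdorff_dim {x \<in> K. f x = y} = hausdorff_dim K}})"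
    using prev by (simp add: prevalent_in_def topspace_C_topology)
  ultimately have "\<not> W \<subseteq> C_space K -
      {f \<in> C_space K :: ('a \<Rightarrow> 'b) set. comeager_in (top_of_set (f ` K)) {y \<in> f ` K. hausdorff_dim {x \<in> K. f x = y} = hausdorff_dim K}}"
    using shy_in_subset by blast
  then obtain f where f: "f \<in> W"
    and com: "comeager_in (top_of_set (f ` K)) {y \<in> f ` K. hausdorff_dim {x \<in> K. f x = y} = hausdorff_dim K}"
    by (auto simp: W_def)
  obtain r where r: "r < 1 / 3" "\<And>x. x \<in> K \<Longrightarrow> norm (f0 x - f x) \<le> r" using f by (auto simp: W_def)
  have fC: "f \<in> C_space K" using f by (simp add: W_def)
  let ?bad = "f ` K - {y \<in> f ` K. hausdorff_dim {x \<in> K. f x = y} = hausdorff_dim K}"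
  have "f ` K \<inter> ball v (1 / 2) \<subseteq> ?bad"
  proof
    fix y assume y: "y \<in> f ` K \<inter> ball v (1 / 2)"
    have "{x \<in> K. f x = y} \<subseteq> U"
    proof (rule subsetI, rule ccontr)
      fix x assume x: "x \<in> {x \<in> K. f x = y}" "x \<notin> U"
      then have "f0 x = 0" by (simp add: f0_def)
      then have "norm y < 1 / 3" using r(2)[of x] r(1) x by auto
      moreover have "norm (v - y) < 1 / 2" using y by (simp add: dist_norm)
      ultimately show False using v norm_triangle_ineq[of "v - y" y] by simp
    qed
    then have "hausdorff_dim {x \<in> K. f x = y} < hausdorff_dim K"
      using hausdorff_dim_mono less by (meson le_less_trans)
    then show "y \<in> ?bad" using y by auto
  qed
  moreover have "meager_in (top_of_set (f ` K)) ?bad" using com by (simp add: comeager_in_def)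
  moreover have "f x0 \<in> f ` K \<inter> ball v (1 / 2)"
  proof -
    have "f0 x0 = v" using x0 UK a by (auto simp: f0_def a_def)
    then show ?thesis using r(2)[of x0] r(1) x0 UK by (auto simp: dist_norm)
  qed
  moreover have "compact (f ` K)" by (rule compact_continuous_image[OF C_spaceD[OF K fC] K])
  ultimately show False using compact_open_not_meager[of "f ` K" "ball v (1 / 2)" "f x0"] by blast
qed

theorem theorem4p26:
  fixes K :: "'a::metric_space set"
  assumes "compact K"
  shows
    "prevalent_in (C_topology K) (C_add K)
       {f \<in> C_space K :: ('a \<Rightarrow> real ^ 'd) set.
          comeager_in (top_of_set (f ` K))
            {y \<in> f ` K. hausdorff_dim {x \<in> K. f x = y} = hausdorff_dim K}}
     \<longleftrightarrow>
     (\<forall>U. openin (top_of_set K) U \<and> U \<noteq> {} \<longrightarrow> hausdorff_dim U = hausdorff_dim K)"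
  using prevalent_generic_fibre_dim[OF assms] prevalent_generic_fibre_dim_imp[OF assms] by blast

end
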